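(* There exists a universal constant $\eta_0>0$ (depending only on $\varphi$ and $d$) such that the following holds for every $0<\eta<\eta_0$. Suppose that $u$ is divergence-free and that $\mathcal M(\nabla u)\in L^p((S,T)\times\mathbb R^d)$ for some $1\le p\le\infty$. Then the maximal function $\mathcal M_{\mathcal Q}$ associated with the $\eta$-admissible skewed cylinders generated by $u$ satisfies: (1) $\mathcal M_{\mathcal Q}$ is of strong type $(\infty,\infty)$: for every $f\in L^\infty((S,T)\times\mathbb R^d)$, $$\|\mathcal M_{\mathcal Q}f\|_{L^\infty((S,T)\times\mathbb R^d)}\le\|f\|_{L^\infty((S,T)\times\mathbb R^d)}.$$ (2) $\mathcal M_{\mathcal Q}$ is of weak type $(1,1)$: there is a constant $C_1$ depending only on $\varphi$ and $d$ such that for every $f\in L^1((S,T)\times\mathbb R^d)$ and every $\lambda>0$, $$\mathcal L^{d+1}\left(\left\{(t,x)\in(S,T)\times\mathbb R^d:(\mathcal M_{\mathcal Q}f)(t,x)>\lambda\right\}\right)\le\frac{C_1}{\lambda}\|f\|_{L^1((S,T)\times\mathbb R^d)}.$$ (3) $\mathcal M_{\mathcal Q}$ is of strong type $(q,q)$ for every $1<q<\infty$: there is a constant $C_q$ depending only on $\varphi$, $d$ and $q$ such that for every $f\in L^q((S,T)\times\mathbb R^d)$, $$\|\mathcal M_{\mathcal Q}f\|_{L^q((S,T)\times\mathbb R^d)}\le C_q\|f\|_{L^q((S,T)\times\mathbb R^d)}.$$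
   Context: Let $d\ge1$, $-\infty\le S<T\le\infty$, and let $u:(S,T)\times\mathbb R^d\to\mathbb R^d$ be a vector field with $u\in L^1_{\mathrm{loc}}(S,T;\dot W^{1,p}(\mathbb R^d))$ for some $1\le p\le\infty$. $B_r(x)\subset\mathbb R^d$ is the open ball of radius $r$ centred at $x$, $B_r=B_r(0)$. $\mathcal L^{n}$ is $n$-dimensional Lebesgue measure; $|\cdot|$ denotes $\mathcal L^d$ or $\mathcal L^{d+1}$ depending on the set, and $\fint$ denotes the average integral. Mollification: fix $\varphi\in C_c^\infty(B_1)$ with $\varphi\ge0$, $\int\varphi\,dx=1$; set $\varphi_\varepsilon=\varepsilon^{-d}\varphi(\cdot/\varepsilon)$ and $u_\varepsilon(t,x)=\int_{\mathbb R^d}u(t,x-y)\varphi_\varepsilon(y)\,dy$, so $u_\varepsilon\in L^1_{\mathrm{loc}}(S,T;C^1(\mathbb R^d))$. Mollified flow: for $\varepsilon>0$ and $(t,x)\in(S,T)\times\mathbb R^d$, $X_\varepsilon(t,x;\cdot)$ is the unique solution on $(S,T)$ of $\dot X_\varepsilon(t,x;s)=u_\varepsilon(s,X_\varepsilon(t,x;s))$, $X_\varepsilon(t,x;t)=x$ (dot = derivative in $s$). Skewed cylinder: if $S+\varepsilon^2<t<T-\varepsilon^2$, $Q_\varepsilon(t,x)=\{(s,y):|s-t|<\varepsilon^2,\ |y-X_\varepsilon(t,x;s)|<\varepsilon\}$. Spatial maximal function: $(\mathcal Mg)(x)=\sup_{r>0}\fint_{B_r(x)}|g(y)|\,dy$;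 $\mathcal M(\nabla u)$ is obtained by applying $\mathcal M$ to $\nabla u(t,\cdot)$ at each time $t$. Admissibility: for $\eta>0$, $Q_\varepsilon(t,x)$ (with $S+\varepsilon^2<t<T-\varepsilon^2$) is $\eta$-admissible if $\varepsilon^2\fint_{Q_\varepsilon(t,x)}\mathcal M(\nabla u)\,dy\,ds<\eta$. New maximal function: for $f\in L^1_{\mathrm{loc}}((S,T)\times\mathbb R^d)$, $$\mathcal M_{\mathcal Q}(f)(t,x)=\sup_{\varepsilon>0}\left\{\fint_{Q_\varepsilon(t,x)}|f(s,y)|\,dy\,ds:\ Q_\varepsilon(t,x)\text{ is }\eta\text{-admissible}\right\},$$ where only $\varepsilon$ with $\varepsilon^2<\min\{t-S,T-t\}$ are considered; under the hypotheses of the theorem the set of such $\varepsilon$ is nonempty for almost every $(t,x)$, so that $\mathcal M_{\mathcal Q}(f)$ is defined almost everywhere. *)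

theory Defs
  imports "HOL-Analysis.Analysis" "HOL-Probability.Essential_Supremum"
begin

subsection \<open>Lebesgue spaces and averages\<close>

text \<open>Meaningful for exponents \<open>r > 0\<close> only.\<close>

definition ennreal_powr :: "ennreal \<Rightarrow> real \<Rightarrow> ennreal" where
  "ennreal_powr a r = (if a = \<infinity> then \<infinity> else ennreal (enn2real a powr r))"

text \<open>\<open>esssup\<close> is \<open>\<infinity>\<close> on non-measurable functions, but \<open>nn_integral\<close> is a lower integral
  there; measurability is therefore always demanded separately.\<close>

definition Lp_norm :: "ennreal \<Rightarrow> 'a measure \<Rightarrow> ('a \<Rightarrow> ennreal) \<Rightarrow> ennreal" where
  "Lp_norm p M g =
     (if p = \<infinity> then esssup M g
      else ennreal_powr (\<integral>\<^sup>+ z. ennreal_powr (g z) (enn2real p) \<partial>M) (1 / enn2real p))"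

definition in_Lp :: "ennreal \<Rightarrow> 'a measure \<Rightarrow> ('a \<Rightarrow> real) \<Rightarrow> bool" where
  "in_Lp p M f \<longleftrightarrow> f \<in> borel_measurable M \<and> Lp_norm p M (\<lambda>z. ennreal \<bar>f z\<bar>) < \<infinity>"

definition average :: "'a::euclidean_space set \<Rightarrow> ('a \<Rightarrow> ennreal) \<Rightarrow> ennreal" where
  "average A g = (\<integral>\<^sup>+ z\<in>A. g z \<partial>lebesgue) / emeasure lebesgue A"

definition loc_integrable :: "'a::euclidean_space set \<Rightarrow> ('a \<Rightarrow> 'b::euclidean_space) \<Rightarrow> bool" where
  "loc_integrable U f \<longleftrightarrow> (\<forall>K. compact K \<and> K \<subseteq> U \<longrightarrow> f absolutely_integrable_on K)"

subsection \<open>Test functions and mollification\<close>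

primrec C_k :: "nat \<Rightarrow> ('a::euclidean_space \<Rightarrow> real) \<Rightarrow> bool" where
  "C_k 0 f \<longleftrightarrow> continuous_on UNIV f"
| "C_k (Suc k) f \<longleftrightarrow>
     (\<forall>x. f differentiable (at x)) \<and> (\<forall>v. C_k k (\<lambda>x. frechet_derivative f (at x) v))"

definition test_function :: "'a::euclidean_space set \<Rightarrow> ('a \<Rightarrow> real) \<Rightarrow> bool" where
  "test_function U f \<longleftrightarrow>
     (\<forall>k. C_k k f) \<and> compact (closure {x. f x \<noteq> 0}) \<and> closure {x. f x \<noteq> 0} \<subseteq> U"

definition mollifier :: "(real^'n \<Rightarrow> real) \<Rightarrow> bool" where
  "mollifier \<phi> \<longleftrightarrow>
     test_function (ball 0 1) \<phi> \<and> (\<forall>x. 0 \<le> \<phi> x) \<and> (LINT x|lebesgue. \<phi> x) = 1"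

definition rescale :: "(real^'n \<Rightarrow> real) \<Rightarrow> real \<Rightarrow> real^'n \<Rightarrow> real" where
  "rescale \<phi> \<epsilon> x = (1 / \<epsilon>) ^ CARD('n) * \<phi> ((1 / \<epsilon>) *\<^sub>R x)"

definition mollify ::
    "(real^'n \<Rightarrow> real) \<Rightarrow> (real \<Rightarrow> real^'n \<Rightarrow> real^'n) \<Rightarrow> real \<Rightarrow> real \<Rightarrow> real^'n \<Rightarrow> real^'n" where
  "mollify \<phi> u \<epsilon> t x = (LINT y|lebesgue. rescale \<phi> \<epsilon> y *\<^sub>R u t (x - y))"

subsection \<open>Time-dependent homogeneous Sobolev vector fields\<close>

abbreviation spacetime :: "ereal \<Rightarrow> ereal \<Rightarrow> (real \<times> (real^'n)) set" where
  "spacetime S T \<equiv> einterval S T \<times> UNIV"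

text \<open>\<open>A x $ i $ j\<close> is the weak partial derivative of the \<open>i\<close>-th component in direction \<open>j\<close>.\<close>

definition weak_gradient :: "(real^'n \<Rightarrow> real^'n) \<Rightarrow> (real^'n \<Rightarrow> real^'n^'n) \<Rightarrow> bool" where
  "weak_gradient v A \<longleftrightarrow>
     loc_integrable UNIV v \<and> loc_integrable UNIV A \<and>
     (\<forall>\<psi> i j. test_function UNIV \<psi> \<longrightarrow>
        (LINT x|lebesgue. v x $ i * frechet_derivative \<psi> (at x) (axis j 1)) =
        - (LINT x|lebesgue. A x $ i $ j * \<psi> x))"

text \<open>The field \<open>u\<close> lies in \<open>L\<^sup>1\<^sub>l\<^sub>o\<^sub>c(S,T; W\<^sup>1\<^sup>,\<^sup>p)\<close> (homogeneous Sobolev space) with spatial gradient \<open>G\<close>.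
  The homogeneous seminorm does not see functions of time alone; local integrability
  of \<open>u\<close> itself is what puts the mollified fields into \<open>L\<^sup>1\<^sub>l\<^sub>o\<^sub>c(S,T; C\<^sup>1)\<close>.
  \<open>norm (G t x)\<close> is the Frobenius norm.\<close>

definition L1loc_W1p ::
    "ereal \<Rightarrow> ereal \<Rightarrow> ennreal \<Rightarrow> (real \<Rightarrow> real^'n \<Rightarrow> real^'n) \<Rightarrow> (real \<Rightarrow> real^'n \<Rightarrow> real^'n^'n) \<Rightarrow> bool"
  where
  "L1loc_W1p S T p u G \<longleftrightarrow>
     loc_integrable (spacetime S T) (\<lambda>(t, x). u t x) \<and>
     (\<lambda>(t, x). G t x) \<in> borel_measurable (lebesgue_on (spacetime S T)) \<and>
     (AE t in lebesgue_on (einterval S T). weak_gradient (u t) (G t)) \<and>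
     (\<forall>K. compact K \<and> K \<subseteq> einterval S T \<longrightarrow>
        (\<integral>\<^sup>+ t\<in>K. Lp_norm p lebesgue (\<lambda>x. ennreal (norm (G t x))) \<partial>lebesgue) < \<infinity>)"

text \<open>The distributional divergence of a Sobolev field is the trace of its weak gradient.\<close>

definition divergence_free ::
    "ereal \<Rightarrow> ereal \<Rightarrow> (real \<Rightarrow> real^'n \<Rightarrow> real^'n^'n) \<Rightarrow> bool" where
  "divergence_free S T G \<longleftrightarrow> (AE (t, x) in lebesgue_on (spacetime S T). trace (G t x) = 0)"

definition maximal :: "('a::euclidean_space \<Rightarrow> 'b::real_normed_vector) \<Rightarrow> 'a \<Rightarrow> ennreal" where
  "maximal g x = (SUP r\<in>{0<..}. average (ball x r) (\<lambda>y. ennreal (norm (g y))))"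

definition grad_maximal :: "(real \<Rightarrow> real^'n \<Rightarrow> real^'n^'n) \<Rightarrow> real \<times> (real^'n) \<Rightarrow> ennreal" where
  "grad_maximal G = (\<lambda>(t, x). maximal (G t) x)"

subsection \<open>Mollified flow and skewed cylinders\<close>

text \<open>Caratheodory solution on \<open>(S,T)\<close> of \<open>\<gamma>' = b(s, \<gamma>)\<close>, \<open>\<gamma>(t) = x\<close>, for a field that is merely
  integrable in time. The integral from \<open>t\<close> to \<open>s\<close> is oriented. It is taken with respect to
  \<open>lebesgue\<close>, not \<open>lborel\<close>, because the integrand need not be Borel.\<close>

definition ode_solution ::
    "ereal \<Rightarrow> ereal \<Rightarrow> (real \<Rightarrow> real^'n \<Rightarrow> real^'n) \<Rightarrow> real \<Rightarrow> real^'n \<Rightarrow> (real \<Rightarrow> real^'n) \<Rightarrow> bool" where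
  "ode_solution S T b t x \<gamma> \<longleftrightarrow>
     (\<forall>s\<in>einterval S T.
        interval_lebesgue_integrable lebesgue (ereal t) (ereal s) (\<lambda>\<tau>. b \<tau> (\<gamma> \<tau>)) \<and>
        \<gamma> s = x + (LINT \<tau>=ereal t..ereal s|lebesgue. b \<tau> (\<gamma> \<tau>)))"

text \<open>The solution is unique on \<open>(S,T)\<close>; the choice only concerns irrelevant values outside.\<close>

definition flow ::
    "ereal \<Rightarrow> ereal \<Rightarrow> (real^'n \<Rightarrow> real) \<Rightarrow> (real \<Rightarrow> real^'n \<Rightarrow> real^'n) \<Rightarrow>
     real \<Rightarrow> real \<Rightarrow> real^'n \<Rightarrow> real \<Rightarrow> real^'n" where
  "flow S T \<phi> u \<epsilon> t x = (SOME \<gamma>. ode_solution S T (mollify \<phi> u \<epsilon>) t x \<gamma>)"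

definition cylinder ::
    "ereal \<Rightarrow> ereal \<Rightarrow> (real^'n \<Rightarrow> real) \<Rightarrow> (real \<Rightarrow> real^'n \<Rightarrow> real^'n) \<Rightarrow>
     real \<Rightarrow> real \<Rightarrow> real^'n \<Rightarrow> (real \<times> (real^'n)) set" where
  "cylinder S T \<phi> u \<epsilon> t x =
     {(s, y). \<bar>s - t\<bar> < \<epsilon>\<^sup>2 \<and> norm (y - flow S T \<phi> u \<epsilon> t x s) < \<epsilon>}"

definition admissible ::
    "ereal \<Rightarrow> ereal \<Rightarrow> (real^'n \<Rightarrow> real) \<Rightarrow> (real \<Rightarrow> real^'n \<Rightarrow> real^'n) \<Rightarrow>
     (real \<Rightarrow> real^'n \<Rightarrow> real^'n^'n) \<Rightarrow> real \<Rightarrow> real \<Rightarrow> real \<Rightarrow> real^'n \<Rightarrow> bool" where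
  "admissible S T \<phi> u G \<eta> \<epsilon> t x \<longleftrightarrow>
     0 < \<epsilon> \<and> S + ereal (\<epsilon>\<^sup>2) < ereal t \<and> ereal t < T - ereal (\<epsilon>\<^sup>2) \<and>
     ennreal (\<epsilon>\<^sup>2) * average (cylinder S T \<phi> u \<epsilon> t x) (grad_maximal G) < ennreal \<eta>"

text \<open>Where no cylinder is admissible, which happens on a null set only, the supremum is \<open>0\<close>.\<close>

definition cylinder_maximal ::
    "ereal \<Rightarrow> ereal \<Rightarrow> (real^'n \<Rightarrow> real) \<Rightarrow> (real \<Rightarrow> real^'n \<Rightarrow> real^'n) \<Rightarrow>
     (real \<Rightarrow> real^'n \<Rightarrow> real^'n^'n) \<Rightarrow> real \<Rightarrow> (real \<times> (real^'n) \<Rightarrow> real) \<Rightarrow>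
     real \<times> (real^'n) \<Rightarrow> ennreal" where
  "cylinder_maximal S T \<phi> u G \<eta> f = (\<lambda>(t, x).
     SUP \<epsilon>\<in>{\<epsilon>. admissible S T \<phi> u G \<eta> \<epsilon> t x}.
       average (cylinder S T \<phi> u \<epsilon> t x) (\<lambda>z. ennreal \<bar>f z\<bar>))"

end

theory Submission
  imports Defs
begin

text \<open>
  Everything follows from an engulfing property of the skewed cylinders. There is a threshold for \<open>\<eta>\<close>, depending on
  the mollifier and the dimension, below which an admissible cylinder \<open>Q\<^sub>\<delta>(s,y)\<close> that meets a cylinder
  \<open>Q\<^sub>\<epsilon>(t,x)\<close> with \<open>\<delta> \<le> \<epsilon>\<close> is contained in the enlargement of \<open>Q\<^sub>\<epsilon>(t,x)\<close> by a factor \<open>3\<close> in time and \<open>5\<close> in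
  space (\<open>engulfing\<close>). To see this, compare the two trajectories during the lifetime of the smaller cylinder. Their
  relative velocity is a difference of two mollifications of the same field, at different points and with different
  radii. Moving the centre and the radius simultaneously from one to the other, this difference is bounded by averages
  of \<open>\<bar>\<nabla>u\<bar>\<close> over the intermediate balls (\<open>convolve_diff_le\<close>). As long as the trajectories are at most \<open>4\<epsilon>\<close> apart,
  each intermediate ball lies in the ball of \<open>6\<close> times its radius about an arbitrary point \<open>z\<close> of the cross section of
  the smaller cylinder, so the relative velocity is at most a multiple of \<open>\<epsilon> \<M>(\<nabla>u)(z)\<close>
  (\<open>velocity_difference_le\<close>). Averaging over \<open>z\<close> and integrating in time, admissibility bounds the relative
  displacement by a multiple of \<open>\<eta> \<epsilon>\<close> (\<open>flow_distance_step\<close>). For small \<open>\<eta>\<close> this is at most \<open>\<epsilon>\<close>, and a continuity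
  argument shows that the distance \<open>4\<epsilon>\<close> is never exceeded (\<open>bootstrap\<close>).

  The rest of the argument for the weak type \<open>(1,1)\<close> is Vitali's. From finitely many cylinders a greedy selection
  extracts disjoint ones whose enlargements cover the union (\<open>vitali_finite_selection\<close>). The level sets of the maximal
  function are open, since averages over cylinders depend continuously on the centre
  (\<open>cylinder_integral_continuous\<close>, \<open>open_level_set\<close>); hence they are measurable and are exhausted by compact sets, each
  of which is covered by finitely many cylinders with large averages (\<open>cyl_max_weak_type\<close>). The bound on \<open>L\<^sup>\<infinity>\<close> holds
  for each average, and the exponents in between follow by interpolation (\<open>strong_type_of_level_sets\<close>).

  The flow itself is obtained from the theory of Caratheodory: a mollified field is Lipschitz in space with a constant
  that is locally integrable in time (\<open>mollified_field_caratheodory\<close>), because its Lipschitz constant is controlled by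
  the \<open>L\<^sup>p\<close> norm of the gradient. Such a field has solutions on the whole time interval (\<open>solution_exists\<close>), and two
  solutions stay, on compact intervals, within a constant factor of their distance at any other time
  (\<open>solutions_stable\<close>). The latter gives
  uniqueness and the continuous dependence of the cylinders on their centres.
\<close>

section \<open>Calculus of test functions\<close>

lemma C_k_SucD: "C_k (Suc k) f \<Longrightarrow> C_k k f"
proof (induction k arbitrary: f)
  case 0
  then show ?case
    by (simp add: continuous_on_eq_continuous_at differentiable_imp_continuous_within)
next
  case (Suc k)
  then show ?case by (metis C_k.simps(2))
qed

lemma C_k_const: "C_k k (\<lambda>_. c)"
  by (induction k arbitrary: c) (simp_all add: frechet_derivative_const)

lemma C_k_linear:
  assumes "bounded_linear f" shows "C_k k f"
proof (cases k)
  case 0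
  then show ?thesis using assms by (simp add: linear_continuous_on)
next
  case (Suc j)
  have "frechet_derivative f (at x) = f" for x
    using assms bounded_linear_imp_has_derivative frechet_derivative_at by metis
  then show ?thesis
    using Suc C_k_const assms bounded_linear_imp_differentiable by auto
qed

lemma frechet_derivative_has_derivative_eq:
  assumes "\<And>x. (f has_derivative f' x) (at x)"
  shows "frechet_derivative f (at x) v = f' x v"
  using frechet_derivative_at[OF assms[of x]] by simp

lemma C_k_SucI:
  assumes "\<And>x. (f has_derivative f' x) (at x)" "\<And>v. C_k k (\<lambda>x. f' x v)"
  shows "C_k (Suc k) f"
  using assms frechet_derivative_has_derivative_eq[OF assms(1)]
  by (auto simp: differentiable_def)

lemma C_k_has_derivative:
  "C_k (Suc k) f \<Longrightarrow> (f has_derivative frechet_derivative f (at x)) (at x)"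
  by (simp add: frechet_derivative_works)

lemma C_k_add:
  assumes "C_k k f" "C_k k g" shows "C_k k (\<lambda>x. f x + g x)"
  using assms
proof (induction k arbitrary: f g)
  case 0
  then show ?case by (simp add: continuous_on_add)
next
  case (Suc k)
  show ?case
  proof (rule C_k_SucI)
    show "((\<lambda>x. f x + g x) has_derivative
        (\<lambda>v. frechet_derivative f (at x) v + frechet_derivative g (at x) v)) (at x)" for x
      using Suc.prems by (intro has_derivative_add C_k_has_derivative)
    show "C_k k (\<lambda>x. frechet_derivative f (at x) v + frechet_derivative g (at x) v)" for v
      by (rule Suc.IH) (use Suc.prems in simp_all)
  qed
qed

lemma C_k_mult:
  assumes "C_k k f" "C_k k g" shows "C_k k (\<lambda>x. f x * g x)"
  using assms
proof (induction k arbitrary: f g)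
  case 0
  then show ?case by (simp add: continuous_on_mult)
next
  case (Suc k)
  show ?case
  proof (rule C_k_SucI)
    show "((\<lambda>x. f x * g x) has_derivative
        (\<lambda>v. f x * frechet_derivative g (at x) v + frechet_derivative f (at x) v * g x)) (at x)" for x
      using Suc.prems by (intro has_derivative_mult C_k_has_derivative)
    show "C_k k (\<lambda>x. f x * frechet_derivative g (at x) v + frechet_derivative f (at x) v * g x)" for v
      by (intro C_k_add Suc.IH C_k_SucD[OF Suc.prems(1)] C_k_SucD[OF Suc.prems(2)])
        (use Suc.prems in simp_all)
  qed
qed

lemma C_k_compose_affine:
  assumes "C_k k f" shows "C_k k (\<lambda>x. f (a + c *\<^sub>R x))"
  using assms
proof (induction k arbitrary: f)
  case 0
  then have "continuous_on UNIV f" by simp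
  then show ?case
    by (auto intro!: continuous_on_compose2[of UNIV f] continuous_intros)
next
  case (Suc k)
  show ?case
  proof (rule C_k_SucI)
    show "((\<lambda>x. f (a + c *\<^sub>R x)) has_derivative
        (\<lambda>v. frechet_derivative f (at (a + c *\<^sub>R x)) (c *\<^sub>R v))) (at x)" for x
      by (rule has_derivative_compose[OF _ C_k_has_derivative[OF Suc.prems]])
        (auto intro!: derivative_eq_intros)
    show "C_k k (\<lambda>x. frechet_derivative f (at (a + c *\<^sub>R x)) (c *\<^sub>R v))" for v
      by (rule Suc.IH) (use Suc.prems in simp)
  qed
qed

lemma mollifier_facts:
  assumes "mollifier \<phi>"
  shows mollifier_C_k: "C_k k \<phi>"
    and mollifier_nonneg: "0 \<le> \<phi> x"
    and mollifier_support: "1 \<le> norm x \<Longrightarrow> \<phi> x = 0"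
    and mollifier_deriv_support: "1 \<le> norm x \<Longrightarrow> frechet_derivative \<phi> (at x) = (\<lambda>_. 0)"
proof -
  have tf: "test_function (ball 0 1) \<phi>" and nn: "\<forall>x. 0 \<le> \<phi> x"
    using assms by (auto simp: mollifier_def)
  show "C_k k \<phi>" "0 \<le> \<phi> x" using tf nn by (auto simp: test_function_def)
  have sub: "closure {x. \<phi> x \<noteq> 0} \<subseteq> ball 0 1" using tf by (auto simp: test_function_def)
  assume x: "1 \<le> norm x"
  then have nin: "x \<notin> closure {x. \<phi> x \<noteq> 0}" using sub by auto
  then show "\<phi> x = 0" using closure_subset[of "{x. \<phi> x \<noteq> 0}"] by auto
  have "((\<lambda>_. 0) has_derivative (\<lambda>_. 0)) (at x)" by simp
  then have "(\<phi> has_derivative (\<lambda>_. 0)) (at x)"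
  proof (rule has_derivative_transform_within_open)
    show "open (- closure {x. \<phi> x \<noteq> 0})" by auto
    show "x \<in> - closure {x. \<phi> x \<noteq> 0}" using nin by simp
    fix y assume "y \<in> - closure {x. \<phi> x \<noteq> 0}"
    then show "0 = \<phi> y" using closure_subset[of "{x. \<phi> x \<noteq> 0}"] by auto
  qed
  then show "frechet_derivative \<phi> (at x) = (\<lambda>_. 0)"
    by (metis frechet_derivative_at)
qed

lemma mollifier_bounded:
  assumes "mollifier \<phi>"
  obtains B where "0 \<le> B" "\<And>x. \<phi> x \<le> B"
proof -
  have c: "continuous_on (cball 0 1) \<phi>"
    using mollifier_C_k[OF assms, of 0] continuous_on_subset by (metis C_k.simps(1) subset_UNIV)
  then have "bounded (\<phi> ` cball 0 1)"
    by (intro compact_imp_bounded compact_continuous_image) auto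
  then obtain B where B: "\<And>x. x \<in> cball 0 1 \<Longrightarrow> norm (\<phi> x) \<le> B" "0 < B"
    by (metis bounded_pos imageI)
  have "\<phi> x \<le> B" for x
  proof (cases "norm x \<le> 1")
    case True
    then show ?thesis using B(1)[of x] by simp
  next
    case False
    then show ?thesis using mollifier_support[OF assms, of x] B(2) by simp
  qed
  then show ?thesis using that B(2) by (meson less_imp_le)
qed

lemma mollifier_deriv_bounded:
  fixes \<phi> :: "real^'n \<Rightarrow> real"
  assumes "mollifier \<phi>"
  obtains B where "0 \<le> B" "\<And>x v. \<bar>frechet_derivative \<phi> (at x) v\<bar> \<le> B * norm v"
proof -
  let ?D = "\<lambda>x v. frechet_derivative \<phi> (at x) v"
  have "\<exists>B\<ge>0. \<forall>x. \<bar>?D x (axis j 1)\<bar> \<le> B" for j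
  proof -
    have "continuous_on UNIV (\<lambda>x. ?D x (axis j 1))"
      using mollifier_C_k[OF assms, of "Suc 0"] by simp
    then have "bounded ((\<lambda>x. ?D x (axis j 1)) ` cball 0 1)"
      by (intro compact_imp_bounded compact_continuous_image) (auto intro: continuous_on_subset)
    then obtain B where B: "\<And>x. x \<in> cball 0 1 \<Longrightarrow> norm (?D x (axis j 1)) \<le> B" "0 < B"
      by (metis (no_types, lifting) bounded_pos imageI)
    have "\<bar>?D x (axis j 1)\<bar> \<le> B" for x
    proof (cases "norm x \<le> 1")
      case True
      then show ?thesis using B(1)[of x] by simp
    next
      case False
      then show ?thesis using mollifier_deriv_support[OF assms, of x] B(2) by simp
    qed
    then show ?thesis using B(2) by (intro exI[of _ B]) auto
  qed
  then obtain B where B: "\<And>j. 0 \<le> B j" "\<And>j x. \<bar>?D x (axis j 1)\<bar> \<le> B j" by metis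
  show ?thesis
  proof
    show "0 \<le> (\<Sum>j\<in>UNIV. B j)" using B(1) by (simp add: sum_nonneg)
    fix x v :: "real^'n"
    have lin: "bounded_linear (?D x)"
      using C_k_has_derivative[OF mollifier_C_k[OF assms, of "Suc 0"]] has_derivative_bounded_linear by blast
    have "v = (\<Sum>j\<in>UNIV. (v $ j) *\<^sub>R axis j 1)"
      using basis_expansion[of v] by (simp add: scalar_mult_eq_scaleR)
    then have "?D x v = ?D x (\<Sum>j\<in>UNIV. (v $ j) *\<^sub>R axis j 1)" by simp
    also have "\<dots> = (\<Sum>j\<in>UNIV. v $ j * ?D x (axis j 1))"
      using linear_sum[OF bounded_linear.linear[OF lin], of "\<lambda>j. (v $ j) *\<^sub>R axis j 1" UNIV]
        linear_cmul[OF bounded_linear.linear[OF lin]] by simp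
    finally have "\<bar>?D x v\<bar> \<le> (\<Sum>j\<in>UNIV. \<bar>v $ j\<bar> * \<bar>?D x (axis j 1)\<bar>)"
      using sum_abs[of "\<lambda>j. v $ j * ?D x (axis j 1)" UNIV] by (simp add: abs_mult)
    also have "\<dots> \<le> (\<Sum>j\<in>UNIV. norm v * B j)"
      by (intro sum_mono mult_mono B component_le_norm_cart) auto
    finally show "\<bar>?D x v\<bar> \<le> (\<Sum>j\<in>UNIV. B j) * norm v"
      by (simp add: sum_distrib_left mult.commute)
  qed
qed


section \<open>Mollification at variable centre and radius\<close>

text \<open>The mollification with the variable moved into the kernel. In this form the field \<open>v\<close>, which is not smooth, stays
  put when the centre and the radius vary, and all derivatives fall on the kernel.\<close>

definition convolve :: "(real^'n \<Rightarrow> real) \<Rightarrow> (real^'n \<Rightarrow> real^'n) \<Rightarrow> real \<Rightarrow> real^'n \<Rightarrow> real^'n" where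
  "convolve \<phi> v r x = (LINT y|lebesgue. rescale \<phi> r (x - y) *\<^sub>R v y)"

lemma lebesgue_eq_distr_reflect:
  fixes x :: "'a::euclidean_space"
  shows "lebesgue = distr lebesgue lebesgue (\<lambda>y. x - y)"
    and "(\<lambda>y. x - y) \<in> lebesgue \<rightarrow>\<^sub>M lebesgue"
proof -
  have T: "(\<lambda>y. x + (\<Sum>j\<in>Basis. (- 1 * (y \<bullet> j)) *\<^sub>R j)) = (\<lambda>y. x - y)"
    by (simp add: sum_negf euclidean_representation)
  show "lebesgue = distr lebesgue lebesgue (\<lambda>y. x - y)"
    using lebesgue_affine_euclidean[of "\<lambda>_. -1" x] unfolding T by (simp add: density_1)
  show "(\<lambda>y. x - y) \<in> lebesgue \<rightarrow>\<^sub>M lebesgue"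
    using lebesgue_affine_measurable[of "\<lambda>_. -1" x] unfolding T by simp
qed

lemma borel_measurable_rescale:
  assumes "mollifier \<phi>"
  shows "(\<lambda>y. rescale \<phi> r (x - y)) \<in> borel_measurable borel"
proof -
  have "continuous_on UNIV \<phi>" using mollifier_C_k[OF assms, of 0] by simp
  then have [measurable]: "\<phi> \<in> borel_measurable borel" by (rule borel_measurable_continuous_onI)
  show ?thesis unfolding rescale_def by measurable
qed

lemma mollify_eq_convolve:
  assumes \<phi>: "mollifier \<phi>" and u: "u t \<in> borel_measurable lebesgue"
  shows "mollify \<phi> u r t x = convolve \<phi> (u t) r x"
proof -
  let ?f = "\<lambda>y. rescale \<phi> r (x - y) *\<^sub>R u t y"
  have "(\<lambda>y. rescale \<phi> r (x - y)) \<in> borel_measurable lebesgue"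
    using borel_measurable_rescale[OF \<phi>] by (simp add: measurable_completion)
  then have "?f \<in> borel_measurable lebesgue"
    using u by (rule borel_measurable_scaleR)
  then have "(LINT y|distr lebesgue lebesgue (\<lambda>y. x - y). ?f y) = (LINT y|lebesgue. ?f (x - y))"
    by (intro integral_distr lebesgue_eq_distr_reflect) simp
  then show ?thesis
    unfolding lebesgue_eq_distr_reflect(1)[of x, symmetric] by (simp add: mollify_def convolve_def)
qed

lemma rescale_bounds:
  fixes \<phi> :: "real^'n \<Rightarrow> real"
  assumes "mollifier \<phi>" "0 < r"
  shows rescale_nonneg: "0 \<le> rescale \<phi> r z"
    and rescale_support: "r \<le> norm z \<Longrightarrow> rescale \<phi> r z = 0"
    and rescale_deriv_support: "r \<le> norm z \<Longrightarrow> frechet_derivative \<phi> (at ((1/r) *\<^sub>R z)) = (\<lambda>_. 0)"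
  using assms mollifier_nonneg[OF assms(1)] mollifier_support[OF assms(1), of "(1/r) *\<^sub>R z"]
    mollifier_deriv_support[OF assms(1), of "(1/r) *\<^sub>R z"]
  by (auto simp: rescale_def)

lemma rescale_reflect_has_derivative:
  fixes \<phi> :: "real^'n \<Rightarrow> real"
  assumes "mollifier \<phi>"
  shows "((\<lambda>y. rescale \<phi> r (x - y)) has_derivative
    (\<lambda>v. - ((1/r) ^ CARD('n) / r * frechet_derivative \<phi> (at ((1/r) *\<^sub>R (x - y))) v))) (at y)"
proof -
  let ?w = "(1/r) *\<^sub>R (x - y)"
  have d: "(\<phi> has_derivative frechet_derivative \<phi> (at ?w)) (at ?w)"
    by (rule C_k_has_derivative[OF mollifier_C_k[OF assms]])
  have lin: "linear (frechet_derivative \<phi> (at ?w))"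
    using d has_derivative_linear by blast
  have "((\<lambda>y. \<phi> ((1/r) *\<^sub>R (x - y))) has_derivative
      (\<lambda>v. frechet_derivative \<phi> (at ?w) ((1/r) *\<^sub>R (- v)))) (at y)"
    by (rule has_derivative_compose[where g = \<phi> and f = "\<lambda>y. (1/r) *\<^sub>R (x - y)", OF _ d]) (auto intro!: derivative_eq_intros)
  then have "((\<lambda>y. (1/r) ^ CARD('n) * \<phi> ((1/r) *\<^sub>R (x - y))) has_derivative
      (\<lambda>v. (1/r) ^ CARD('n) * frechet_derivative \<phi> (at ?w) ((1/r) *\<^sub>R (- v)))) (at y)"
    by (rule has_derivative_mult_right)
  moreover have "frechet_derivative \<phi> (at ?w) ((1/r) *\<^sub>R (- v)) = - (frechet_derivative \<phi> (at ?w) v / r)" for v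
    using linear_cmul[OF lin, of "-1/r" v] by simp
  ultimately show ?thesis by (simp add: rescale_def)
qed

text \<open>The velocity field that transports the kernel of centre \<open>x\<close> and radius \<open>r\<close> when the centre moves with
  velocity \<open>a\<close> and the radius grows with rate \<open>b\<close>.\<close>

definition kernel_velocity :: "real^'n \<Rightarrow> real \<Rightarrow> real^'n \<Rightarrow> real \<Rightarrow> real^'n \<Rightarrow> real^'n" where
  "kernel_velocity a b x r y = a - (b / r) *\<^sub>R (x - y)"

lemma norm_kernel_velocity_le:
  assumes "0 < r" "norm (x - y) \<le> r"
  shows "norm (kernel_velocity a b x r y) \<le> norm a + \<bar>b\<bar>"
proof -
  have "norm (kernel_velocity a b x r y) \<le> norm a + norm ((b / r) *\<^sub>R (x - y))"
    unfolding kernel_velocity_def by (rule norm_triangle_ineq4)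
  also have "norm ((b / r) *\<^sub>R (x - y)) = \<bar>b\<bar> * (norm (x - y) / r)"
    using assms by (simp add: abs_mult)
  also have "\<dots> \<le> \<bar>b\<bar> * 1"
    using assms by (intro mult_left_mono) auto
  finally show ?thesis by simp
qed

text \<open>The flux of the kernel, that is the kernel times its velocity, is what the weak gradient will be tested with.\<close>

lemma kernel_flux_test_function:
  fixes \<phi> :: "real^'n \<Rightarrow> real"
  assumes \<phi>: "mollifier \<phi>" and r: "0 < r"
  shows "test_function UNIV (\<lambda>y. rescale \<phi> r (x - y) * kernel_velocity a b x r y $ j)" (is "test_function _ ?f")
proof -
  have "C_k k ?f" for k
  proof (rule C_k_mult)
    have "C_k k (\<lambda>y. \<phi> ((1/r) *\<^sub>R x + (- 1/r) *\<^sub>R y))"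
      by (rule C_k_compose_affine[OF mollifier_C_k[OF \<phi>]])
    moreover have "(\<lambda>y. rescale \<phi> r (x - y)) = (\<lambda>y. (1/r) ^ CARD('n) * \<phi> ((1/r) *\<^sub>R x + (- 1/r) *\<^sub>R y))"
      by (simp add: rescale_def scaleR_diff_right)
    ultimately show "C_k k (\<lambda>y. rescale \<phi> r (x - y))"
      using C_k_mult[OF C_k_const] by simp
    have "(\<lambda>y. kernel_velocity a b x r y $ j) = (\<lambda>y. (a $ j - (b / r) * x $ j) + (b / r) * y $ j)"
      by (auto simp: kernel_velocity_def algebra_simps)
    moreover have "bounded_linear (\<lambda>y::real^'n. (b / r) * y $ j)"
      by (intro bounded_linear_const_mult bounded_linear_vec_nth)
    ultimately show "C_k k (\<lambda>y. kernel_velocity a b x r y $ j)"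
      by (simp only:) (intro C_k_add C_k_const C_k_linear)
  qed
  moreover have "{y. ?f y \<noteq> 0} \<subseteq> cball x r"
    using rescale_support[OF \<phi> r] by (force simp: dist_norm)
  then have "compact (closure {y. ?f y \<noteq> 0})"
    using bounded_subset compact_closure bounded_cball by blast
  ultimately show ?thesis by (simp add: test_function_def)
qed

text \<open>The continuity equation of the kernel: it is the reason why the derivative of a mollified field along a
  path of centres and radii is governed by the gradient of the field, averaged over the moving ball.\<close>

lemma rescale_continuity_equation:
  fixes \<phi> :: "real^'n \<Rightarrow> real" and x :: "real \<Rightarrow> real^'n" and y :: "real^'n" and r :: "real \<Rightarrow> real" and b :: real
  assumes \<phi>: "mollifier \<phi>" and r: "0 < r \<theta>"
    and x': "(x has_vector_derivative a) (at \<theta>)" and r': "(r has_real_derivative b) (at \<theta>)"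
  defines "k' \<equiv> - ((1 / r \<theta>) ^ CARD('n) / r \<theta>) *
      (CARD('n) * b * \<phi> ((1 / r \<theta>) *\<^sub>R (x \<theta> - y))
        - frechet_derivative \<phi> (at ((1 / r \<theta>) *\<^sub>R (x \<theta> - y))) (kernel_velocity a b (x \<theta>) (r \<theta>) y))"
  shows "((\<lambda>\<theta>. rescale \<phi> (r \<theta>) (x \<theta> - y)) has_real_derivative k') (at \<theta>)"
    and "k' = - (\<Sum>j\<in>UNIV. frechet_derivative
        (\<lambda>y. rescale \<phi> (r \<theta>) (x \<theta> - y) * kernel_velocity a b (x \<theta>) (r \<theta>) y $ j) (at y) (axis j 1))"
proof -
  let ?N = "CARD('n)" and ?w = "(1 / r \<theta>) *\<^sub>R (x \<theta> - y)" and ?V = "kernel_velocity a b (x \<theta>) (r \<theta>) y"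
  let ?D = "frechet_derivative \<phi> (at ?w)"
  have d: "(\<phi> has_derivative ?D) (at ?w)"
    by (rule C_k_has_derivative[OF mollifier_C_k[OF \<phi>]])
  have lin: "linear ?D"
    using d has_derivative_linear by blast
  have inv: "((\<lambda>\<theta>. 1 / r \<theta>) has_real_derivative - b / (r \<theta>)\<^sup>2) (at \<theta>)"
    using r by (auto intro!: derivative_eq_intros r' simp: power2_eq_square)
  have w': "((\<lambda>\<theta>. (1 / r \<theta>) *\<^sub>R (x \<theta> - y)) has_vector_derivative (1 / r \<theta>) *\<^sub>R ?V) (at \<theta>)"
  proof -
    have "((\<lambda>\<theta>. x \<theta> - y) has_vector_derivative a) (at \<theta>)"
      using has_vector_derivative_diff[OF x' has_vector_derivative_const[of y]] by simp
    from has_vector_derivative_scaleR[OF inv this] show ?thesis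
      by (simp add: kernel_velocity_def algebra_simps power2_eq_square)
  qed
  have "((\<lambda>\<theta>. \<phi> ((1 / r \<theta>) *\<^sub>R (x \<theta> - y))) has_vector_derivative ?D ((1 / r \<theta>) *\<^sub>R ?V)) (at \<theta>)"
    using has_derivative_compose[where g = \<phi> and f = "\<lambda>\<theta>. (1 / r \<theta>) *\<^sub>R (x \<theta> - y)",
        OF w'[unfolded has_vector_derivative_def] d]
    by (simp add: has_vector_derivative_def linear_cmul[OF lin])
  then have p': "((\<lambda>\<theta>. \<phi> ((1 / r \<theta>) *\<^sub>R (x \<theta> - y))) has_real_derivative ?D ?V / r \<theta>) (at \<theta>)"
    by (simp add: has_real_derivative_iff_has_vector_derivative linear_cmul[OF lin])
  have N: "(1 / r \<theta>) ^ (?N - 1) = (1 / r \<theta>) ^ ?N * r \<theta>"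
    using r by (cases ?N) auto
  have "((\<lambda>\<theta>. (1 / r \<theta>) ^ ?N) has_real_derivative ?N * ((- b / (r \<theta>)\<^sup>2) * (1 / r \<theta>) ^ (?N - 1))) (at \<theta>)"
    using DERIV_power[OF inv, of ?N] by simp
  then have pw': "((\<lambda>\<theta>. (1 / r \<theta>) ^ ?N) has_real_derivative - (?N * b * (1 / r \<theta>) ^ ?N / r \<theta>)) (at \<theta>)"
    unfolding N using r by (simp add: power2_eq_square field_simps)
  show "((\<lambda>\<theta>. rescale \<phi> (r \<theta>) (x \<theta> - y)) has_real_derivative k') (at \<theta>)"
    unfolding rescale_def k'_def
    by (rule DERIV_cong[OF DERIV_mult[OF pw' p']]) (use r in \<open>simp add: field_simps\<close>)
  let ?c = "(1 / r \<theta>) ^ ?N"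
  have fd: "frechet_derivative
        (\<lambda>y. rescale \<phi> (r \<theta>) (x \<theta> - y) * kernel_velocity a b (x \<theta>) (r \<theta>) y $ j) (at y) (axis j 1)
      = ?c * \<phi> ?w * (b / r \<theta>) - ?c / r \<theta> * (?V $ j * ?D (axis j 1))" for j
  proof -
    have V': "((\<lambda>y. kernel_velocity a b (x \<theta>) (r \<theta>) y $ j) has_derivative (\<lambda>v. (b / r \<theta>) * v $ j)) (at y)"
      unfolding kernel_velocity_def using r
      by (auto intro!: derivative_eq_intros bounded_linear.has_derivative[OF bounded_linear_vec_nth])
    note * = has_derivative_mult[OF rescale_reflect_has_derivative[OF \<phi>, of "r \<theta>" "x \<theta>" y] V']
    show ?thesis
      unfolding frechet_derivative_at[OF *, symmetric] by (simp add: rescale_def mult.commute)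
  qed
  have "?V = (\<Sum>j\<in>UNIV. (?V $ j) *\<^sub>R axis j 1)"
    using basis_expansion[of ?V] by (simp add: scalar_mult_eq_scaleR)
  then have "?D ?V = ?D (\<Sum>j\<in>UNIV. (?V $ j) *\<^sub>R axis j 1)" by simp
  also have "\<dots> = (\<Sum>j\<in>UNIV. ?V $ j * ?D (axis j 1))"
    using linear_sum[OF lin, of "\<lambda>j. (?V $ j) *\<^sub>R axis j 1" UNIV] linear_cmul[OF lin] by simp
  finally have DV: "?D ?V = (\<Sum>j\<in>UNIV. ?V $ j * ?D (axis j 1))" .
  show "k' = - (\<Sum>j\<in>UNIV. frechet_derivative
        (\<lambda>y. rescale \<phi> (r \<theta>) (x \<theta> - y) * kernel_velocity a b (x \<theta>) (r \<theta>) y $ j) (at y) (axis j 1))"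
    unfolding fd sum_subtractf sum_distrib_left[symmetric] DV[symmetric] k'_def
    by (simp add: algebra_simps)
qed


lemma has_real_derivative_lebesgue_integral:
  fixes k :: "real \<Rightarrow> 'a \<Rightarrow> real"
  assumes I: "convex I" "\<theta>\<^sub>0 \<in> I"
    and int: "\<And>\<theta>. \<theta> \<in> I \<Longrightarrow> integrable M (k \<theta>)"
    and der: "\<And>\<theta> y. \<theta> \<in> I \<Longrightarrow> ((\<lambda>\<theta>. k \<theta> y) has_real_derivative k' \<theta> y) (at \<theta> within I)"
    and bnd: "\<And>\<theta> y. \<theta> \<in> I \<Longrightarrow> \<bar>k' \<theta> y\<bar> \<le> g y" and g: "integrable M g"
    and meas: "k' \<theta>\<^sub>0 \<in> borel_measurable M"
  shows "((\<lambda>\<theta>. LINT y|M. k \<theta> y) has_real_derivative (LINT y|M. k' \<theta>\<^sub>0 y)) (at \<theta>\<^sub>0 within I)"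
  unfolding has_field_derivative_iff tendsto_at_iff_sequentially
proof (intro allI impI)
  fix s :: "nat \<Rightarrow> real" assume s: "\<forall>i. s i \<in> I - {\<theta>\<^sub>0}" "s \<longlonglongrightarrow> \<theta>\<^sub>0"
  let ?q = "\<lambda>i y. (k (s i) y - k \<theta>\<^sub>0 y) / (s i - \<theta>\<^sub>0)"
  have "(\<lambda>i. LINT y|M. ?q i y) \<longlonglongrightarrow> (LINT y|M. k' \<theta>\<^sub>0 y)"
  proof (rule integral_dominated_convergence[where w = g])
    show "k' \<theta>\<^sub>0 \<in> borel_measurable M" "integrable M g" by fact+
    show "?q i \<in> borel_measurable M" for i
      using int[of "s i"] int[of \<theta>\<^sub>0] s(1) I(2) by (intro borel_measurable_divide borel_measurable_diff) auto
    have "(\<lambda>i. ?q i y) \<longlonglongrightarrow> k' \<theta>\<^sub>0 y" for y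
      using der[OF I(2), of y] s unfolding has_field_derivative_iff tendsto_at_iff_sequentially
      by (auto simp: comp_def)
    then show "AE y in M. (\<lambda>i. ?q i y) \<longlonglongrightarrow> k' \<theta>\<^sub>0 y" by simp
    have "norm (?q i y) \<le> g y" for i y
    proof -
      have "norm (k (s i) y - k \<theta>\<^sub>0 y) \<le> g y * norm (s i - \<theta>\<^sub>0)"
        by (rule field_differentiable_bound[OF I(1) der]) (use bnd s(1) I(2) in auto)
      moreover have "s i - \<theta>\<^sub>0 \<noteq> 0" using s(1) by auto
      ultimately show ?thesis by (simp add: divide_le_eq)
    qed
    then show "AE y in M. norm (?q i y) \<le> g y" for i by simp
  qed
  moreover have "(LINT y|M. ?q i y) = ((LINT y|M. k (s i) y) - (LINT y|M. k \<theta>\<^sub>0 y)) / (s i - \<theta>\<^sub>0)" for i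
    using int[of "s i"] int[of \<theta>\<^sub>0] s(1) I(2) by simp
  ultimately show "((\<lambda>y. ((LINT x|M. k y x) - (LINT x|M. k \<theta>\<^sub>0 x)) / (y - \<theta>\<^sub>0)) \<circ> s) \<longlonglongrightarrow> (LINT y|M. k' \<theta>\<^sub>0 y)"
    by (simp only: comp_def)
qed

lemma integrable_scaleR_compact_support:
  fixes f :: "'a::euclidean_space \<Rightarrow> 'b::euclidean_space"
  assumes f: "loc_integrable UNIV f" and g: "g \<in> borel_measurable borel" "\<And>y. \<bar>g y\<bar> \<le> K"
    and supp: "\<And>y. y \<notin> cball c R \<Longrightarrow> g y = 0"
  shows "integrable lebesgue (\<lambda>y. g y *\<^sub>R f y)"
proof -
  have "f absolutely_integrable_on cball c R" using f by (simp add: loc_integrable_def)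
  then have fi: "integrable lebesgue (\<lambda>y. indicator (cball c R) y *\<^sub>R f y)"
    by (simp add: set_integrable_def)
  have eq: "g y *\<^sub>R f y = g y *\<^sub>R (indicator (cball c R) y *\<^sub>R f y)" for y
    using supp[of y] by (auto simp: indicator_def)
  have gm: "g \<in> borel_measurable lebesgue" using g(1) by (simp add: measurable_completion)
  show ?thesis
  proof (subst eq, rule Bochner_Integration.integrable_bound)
    show "integrable lebesgue (\<lambda>y. K *\<^sub>R (indicator (cball c R) y *\<^sub>R f y))"
      using fi by (rule integrable_scaleR_right)
    show "(\<lambda>y. g y *\<^sub>R (indicator (cball c R) y *\<^sub>R f y)) \<in> borel_measurable lebesgue"
      by (intro borel_measurable_scaleR gm borel_measurable_integrable[OF fi])
    have "norm (g y *\<^sub>R (indicator (cball c R) y *\<^sub>R f y)) \<le> norm (K *\<^sub>R (indicator (cball c R) y *\<^sub>R f y))" for y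
      using g(2)[of y] by (auto intro!: mult_right_mono simp: indicator_def)
    then show "AE y in lebesgue. norm (g y *\<^sub>R (indicator (cball c R) y *\<^sub>R f y))
        \<le> norm (K *\<^sub>R (indicator (cball c R) y *\<^sub>R f y))" by simp
  qed
qed

lemma open_compact_exhaustion:
  fixes U :: "'a::euclidean_space set"
  assumes "open U"
  obtains C where "\<And>n. compact (C n)" "\<And>n. C n \<subseteq> U" "incseq C" "(\<Union>n. C n) = U"
proof (rule open_Union_compact_subsets[OF assms])
  fix C assume C: "\<And>n. compact (C n)" "\<And>n. C n \<subseteq> U" "\<And>n. C n \<subseteq> interior (C (Suc n))" "\<Union> (range C) = U"
  have "incseq C" using C(3) interior_subset by (intro incseq_SucI) blast
  then show thesis by (rule that[OF C(1,2)]) (use C(4) in simp)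
qed

lemma borel_measurable_loc_integrable_on:
  fixes f :: "'a::euclidean_space \<Rightarrow> 'b::euclidean_space"
  assumes f: "loc_integrable U f" and U: "open U"
  shows "(\<lambda>z. indicator U z *\<^sub>R f z) \<in> borel_measurable lebesgue"
proof -
  obtain C where C: "\<And>n. compact (C n)" "\<And>n. C n \<subseteq> U" "incseq C" "(\<Union>n. C n) = U"
    using open_compact_exhaustion[OF U] by blast
  show ?thesis
  proof (rule borel_measurable_LIMSEQ_metric)
    show "(\<lambda>z. indicator (C n) z *\<^sub>R f z) \<in> borel_measurable lebesgue" for n
    proof -
      have "f absolutely_integrable_on C n" using f C by (simp add: loc_integrable_def)
      then show ?thesis unfolding set_integrable_def by (rule borel_measurable_integrable)
    qed
    show "(\<lambda>n. indicator (C n) z *\<^sub>R f z) \<longlonglongrightarrow> indicator U z *\<^sub>R f z" for z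
      unfolding C(4)[symmetric] by (intro tendsto_scaleR tendsto_const LIMSEQ_indicator_incseq C(3))
  qed
qed

lemma borel_measurable_loc_integrable:
  fixes f :: "'a::euclidean_space \<Rightarrow> 'b::euclidean_space"
  assumes "loc_integrable UNIV f" shows "f \<in> borel_measurable lebesgue"
  using borel_measurable_loc_integrable_on[OF assms] by simp

lemma integral_component_cart:
  fixes f :: "'a \<Rightarrow> 'b::euclidean_space^'n"
  assumes "integrable M f"
  shows "integrable M (\<lambda>y. f y $ i)" "(LINT y|M. f y) $ i = (LINT y|M. f y $ i)"
  using integrable_bounded_linear[OF bounded_linear_vec_nth assms]
    integral_bounded_linear[OF bounded_linear_vec_nth assms] by auto

lemma loc_integrable_component:
  fixes f :: "'a::euclidean_space \<Rightarrow> 'b::euclidean_space^'n"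
  assumes "loc_integrable U f" shows "loc_integrable U (\<lambda>y. f y $ i)"
  unfolding loc_integrable_def
proof (intro allI impI)
  fix K assume "compact K \<and> K \<subseteq> U"
  then have "f absolutely_integrable_on K" using assms by (simp add: loc_integrable_def)
  then show "(\<lambda>y. f y $ i) absolutely_integrable_on K"
    using integral_component_cart(1)[of lebesgue "\<lambda>y. indicator K y *\<^sub>R f y" i]
    by (simp add: set_integrable_def)
qed

lemma emeasure_ball_scale:
  fixes x :: "'a::euclidean_space"
  assumes "0 \<le> r"
  shows "emeasure lebesgue (ball x r) = ennreal (measure lborel (ball (0::'a) 1) * r ^ DIM('a))"
proof -
  have "emeasure lebesgue (ball x r) = ennreal (measure lborel (ball x r))"
    using emeasure_lborel_ball_finite[of x r] by (simp add: emeasure_eq_ennreal_measure)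
  also have "measure lborel (ball x r) = r ^ DIM('a) * measure lborel (ball (0::'a) 1)"
    using content_ball_conv_unit_ball[OF assms, of x] by simp
  finally show ?thesis by (simp add: mult.commute)
qed

lemma unit_ball_pos: "0 < measure lborel (ball (0::'a::euclidean_space) 1)"
  using content_ball_pos[of 1 "0::'a"] by simp

lemma nn_integral_ball_eq_average:
  fixes x :: "'a::euclidean_space"
  assumes "0 < r"
  shows "(\<integral>\<^sup>+ z\<in>ball x r. g z \<partial>lebesgue) = ennreal (measure lborel (ball (0::'a) 1) * r ^ DIM('a)) * average (ball x r) g"
proof -
  let ?m = "measure lborel (ball (0::'a) 1) * r ^ DIM('a)"
  have "0 < ?m" using unit_ball_pos[where 'a='a] assms by simp
  then have m: "ennreal ?m \<noteq> 0" "ennreal ?m \<noteq> top" by (auto simp: ennreal_eq_0_iff)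
  show ?thesis
    unfolding average_def emeasure_ball_scale[OF less_imp_le[OF assms]] ennreal_times_divide
      mult.commute[of "ennreal _"] ennreal_mult_divide_eq[OF m] ..
qed

text \<open>Differentiate along the segment from \<open>(x\<^sub>0, r\<^sub>0)\<close> to \<open>(x\<^sub>1, r\<^sub>1)\<close>. By the continuity equation the derivative of the
  kernel is minus the divergence of its flux, and testing the weak gradient with the flux turns the derivative of the
  mollification into an average of \<open>A\<close> over the moving ball. The radius has to move along with the centre because
  cylinders of different sizes belong to flows with different mollification radii.\<close>

lemma convolve_diff_le:
  fixes \<phi> :: "real^'n \<Rightarrow> real" and v :: "real^'n \<Rightarrow> real^'n" and B m :: real
  assumes \<phi>: "mollifier \<phi>" and B: "0 \<le> B" "\<And>x. \<phi> x \<le> B"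
    and A: "weak_gradient v A" and r01: "0 < r\<^sub>0" "0 < r\<^sub>1" and m: "0 \<le> m"
    and avg: "\<And>\<theta>. 0 \<le> \<theta> \<Longrightarrow> \<theta> \<le> 1 \<Longrightarrow>
      average (ball (x\<^sub>0 + \<theta> *\<^sub>R (x\<^sub>1 - x\<^sub>0)) (r\<^sub>0 + \<theta> * (r\<^sub>1 - r\<^sub>0))) (\<lambda>y. ennreal (norm (A y))) \<le> ennreal m"
  shows "norm (convolve \<phi> v r\<^sub>1 x\<^sub>1 - convolve \<phi> v r\<^sub>0 x\<^sub>0)
    \<le> CARD('n) * B * measure lborel (ball (0::real^'n) 1) * (norm (x\<^sub>1 - x\<^sub>0) + \<bar>r\<^sub>1 - r\<^sub>0\<bar>) * m"
proof -
  define a b where "a = x\<^sub>1 - x\<^sub>0" and "b = r\<^sub>1 - r\<^sub>0"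
  define x r where "x \<theta> = x\<^sub>0 + \<theta> *\<^sub>R a" and "r \<theta> = r\<^sub>0 + \<theta> * b" for \<theta>
  let ?N = "CARD('n)" and ?\<omega> = "measure lborel (ball (0::real^'n) 1)"
  define V where "V \<theta> y = kernel_velocity a b (x \<theta>) (r \<theta>) y" for \<theta> y
  define k where "k \<theta> y = rescale \<phi> (r \<theta>) (x \<theta> - y)" for \<theta> y
  define \<psi> where "\<psi> \<theta> j y = k \<theta> y * V \<theta> y $ j" for \<theta> j y
  define k' where "k' \<theta> y = - (\<Sum>j\<in>UNIV. frechet_derivative (\<psi> \<theta> j) (at y) (axis j 1))" for \<theta> y
  obtain B' where B': "0 \<le> B'" "\<And>x v. \<bar>frechet_derivative \<phi> (at x) v\<bar> \<le> B' * norm v"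
    using mollifier_deriv_bounded[OF \<phi>] by blast
  define r\<^sub>m where "r\<^sub>m = min r\<^sub>0 r\<^sub>1"
  have rm: "0 < r\<^sub>m" using r01 by (simp add: r\<^sub>m_def)
  have conv: "r \<theta> = (1 - \<theta>) * r\<^sub>0 + \<theta> * r\<^sub>1" for \<theta> by (simp add: r_def b_def algebra_simps)
  have r_ge: "r\<^sub>m \<le> r \<theta>" and r_le: "r \<theta> \<le> max r\<^sub>0 r\<^sub>1" if "\<theta> \<in> {0..1}" for \<theta>
    using convex_bound_le[of r\<^sub>0 "max r\<^sub>0 r\<^sub>1" r\<^sub>1 "1 - \<theta>" \<theta>] convex_bound_le[of "- r\<^sub>0" "- r\<^sub>m" "- r\<^sub>1" "1 - \<theta>" \<theta>] that
    unfolding conv by (auto simp: r\<^sub>m_def algebra_simps)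
  have rp: "0 < r \<theta>" if "\<theta> \<in> {0..1}" for \<theta> using r_ge[OF that] rm by simp
  \<comment> \<open>All the kernels along the segment live in this ball, which yields an integrable majorant.\<close>
  define \<rho> where "\<rho> = norm a + max r\<^sub>0 r\<^sub>1"
  have far: "r \<theta> < norm (x \<theta> - y)" if "\<theta> \<in> {0..1}" "y \<notin> cball x\<^sub>0 \<rho>" for \<theta> y
  proof -
    have "norm (\<theta> *\<^sub>R a) \<le> norm a" using that(1) by (simp add: mult_left_le_one_le)
    then have "norm (x\<^sub>0 - y) \<le> norm a + norm (x \<theta> - y)"
      using norm_triangle_ineq4[of "x \<theta> - y" "\<theta> *\<^sub>R a"] by (simp add: x_def)
    then show ?thesis using that r_le[OF that(1)] by (simp add: \<rho>_def dist_norm)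
  qed
  have xd: "(x has_vector_derivative a) (at \<theta>)" for \<theta>
    unfolding x_def by (auto intro!: derivative_eq_intros)
  have rd: "(r has_real_derivative b) (at \<theta>)" for \<theta>
    unfolding r_def by (auto intro!: derivative_eq_intros)
  let ?w = "\<lambda>\<theta> y. (1 / r \<theta>) *\<^sub>R (x \<theta> - y)"
  have k'_eq: "k' \<theta> y = - ((1 / r \<theta>) ^ ?N / r \<theta>) *
      (?N * b * \<phi> (?w \<theta> y) - frechet_derivative \<phi> (at (?w \<theta> y)) (V \<theta> y))"
    and k_deriv: "((\<lambda>\<theta>. k \<theta> y) has_real_derivative k' \<theta> y) (at \<theta>)" if "\<theta> \<in> {0..1}" for \<theta> y
  proof -
    note * = rescale_continuity_equation[where r = r and x = x and y = y, OF \<phi> rp[OF that] xd rd]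
    show eq: "k' \<theta> y = - ((1 / r \<theta>) ^ ?N / r \<theta>) *
      (?N * b * \<phi> (?w \<theta> y) - frechet_derivative \<phi> (at (?w \<theta> y)) (V \<theta> y))"
      unfolding k'_def \<psi>_def k_def V_def by (rule *(2)[symmetric])
    show "((\<lambda>\<theta>. k \<theta> y) has_real_derivative k' \<theta> y) (at \<theta>)"
      unfolding eq unfolding k_def V_def by (rule *(1))
  qed
  define K where "K = (1 / r\<^sub>m) ^ ?N / r\<^sub>m * (?N * \<bar>b\<bar> * B + B' * (norm a + \<bar>b\<bar>))"
  have k'_bound: "\<bar>k' \<theta> y\<bar> \<le> K" and k'_supp: "r \<theta> \<le> norm (x \<theta> - y) \<Longrightarrow> k' \<theta> y = 0" if \<theta>: "\<theta> \<in> {0..1}" for \<theta> y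
  proof -
    show z: "k' \<theta> y = 0" if "r \<theta> \<le> norm (x \<theta> - y)"
      unfolding k'_eq[OF \<theta>] using rescale_deriv_support[OF \<phi> rp[OF \<theta>] that] rescale_support[OF \<phi> rp[OF \<theta>] that] rp[OF \<theta>]
      by (auto simp: rescale_def)
    have K0: "0 \<le> K" using rm B(1) B'(1) by (auto simp: K_def intro!: mult_nonneg_nonneg add_nonneg_nonneg divide_nonneg_nonneg)
    show "\<bar>k' \<theta> y\<bar> \<le> K"
    proof (cases "norm (x \<theta> - y) \<le> r \<theta>")
      case True
      have "\<bar>k' \<theta> y\<bar> = (1 / r \<theta>) ^ ?N / r \<theta> *
          \<bar>?N * b * \<phi> (?w \<theta> y) - frechet_derivative \<phi> (at (?w \<theta> y)) (V \<theta> y)\<bar>"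
        unfolding k'_eq[OF \<theta>] using rp[OF \<theta>] by (simp add: abs_mult)
      also have "\<dots> \<le> K" unfolding K_def
      proof (intro mult_mono frac_le power_mono)
        have "\<bar>frechet_derivative \<phi> (at (?w \<theta> y)) (V \<theta> y)\<bar> \<le> B' * (norm a + \<bar>b\<bar>)"
          using B'(2) norm_kernel_velocity_le[OF rp[OF \<theta>] True, of a b] B'(1)
          by (fastforce simp: V_def intro: order_trans mult_left_mono)
        moreover have "\<bar>?N * b * \<phi> (?w \<theta> y)\<bar> \<le> ?N * \<bar>b\<bar> * B"
          using B(2)[of "?w \<theta> y"] mollifier_nonneg[OF \<phi>, of "?w \<theta> y"]
          by (auto simp: abs_mult intro!: mult_left_mono)
        ultimately show "\<bar>?N * b * \<phi> (?w \<theta> y) - frechet_derivative \<phi> (at (?w \<theta> y)) (V \<theta> y)\<bar>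
            \<le> ?N * \<bar>b\<bar> * B + B' * (norm a + \<bar>b\<bar>)" by linarith
      qed (use rm r_ge[OF \<theta>] rp[OF \<theta>] in auto)
      finally show ?thesis .
    qed (use z K0 in auto)
  qed
  have tf: "test_function UNIV (\<psi> \<theta> j)" if "\<theta> \<in> {0..1}" for \<theta> j
  proof -
    have "\<psi> \<theta> j = (\<lambda>y. rescale \<phi> (r \<theta>) (x \<theta> - y) * kernel_velocity a b (x \<theta>) (r \<theta>) y $ j)"
      by (simp add: fun_eq_iff \<psi>_def k_def V_def)
    then show ?thesis using kernel_flux_test_function[OF \<phi> rp[OF that]] by simp
  qed
  have \<psi>_C: "C_k n (\<psi> \<theta> j)" if "\<theta> \<in> {0..1}" for n \<theta> j
    using tf[OF that] by (simp add: test_function_def)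
  have d\<psi>_cont: "continuous_on UNIV (\<lambda>y. frechet_derivative (\<psi> \<theta> j) (at y) (axis j 1))" if "\<theta> \<in> {0..1}" for \<theta> j
    using \<psi>_C[OF that, of "Suc 0" j] by simp
  have k'_meas: "k' \<theta> \<in> borel_measurable borel" if "\<theta> \<in> {0..1}" for \<theta>
    unfolding k'_def
    by (intro borel_measurable_uminus borel_measurable_sum borel_measurable_continuous_onI d\<psi>_cont that)
  have vl: "loc_integrable UNIV v" and Al: "loc_integrable UNIV A"
    and wg: "\<And>\<psi> i j. test_function UNIV \<psi> \<Longrightarrow>
        (LINT x|lebesgue. v x $ i * frechet_derivative \<psi> (at x) (axis j 1)) = - (LINT x|lebesgue. A x $ i $ j * \<psi> x)"
    using A unfolding weak_gradient_def by auto
  have k_meas: "k \<theta> \<in> borel_measurable borel" for \<theta>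
    unfolding k_def by (rule borel_measurable_rescale[OF \<phi>])
  have k_bound: "0 \<le> k \<theta> y" "k \<theta> y \<le> (1 / r \<theta>) ^ ?N * B" if "\<theta> \<in> {0..1}" for \<theta> y
    using B(2) rp[OF that] mollifier_nonneg[OF \<phi>] by (auto simp: k_def rescale_def intro!: mult_left_mono)
  have k_supp: "k \<theta> y = 0" if "\<theta> \<in> {0..1}" "r \<theta> \<le> norm (x \<theta> - y)" for \<theta> y
    using rescale_support[OF \<phi> rp[OF that(1)] that(2)] by (simp add: k_def)
  have kv_int: "integrable lebesgue (\<lambda>y. k \<theta> y *\<^sub>R v y)" if "\<theta> \<in> {0..1}" for \<theta>
    by (rule integrable_scaleR_compact_support[where c = "x\<^sub>0" and R = \<rho> and K = "(1 / r \<theta>) ^ ?N * B", OF vl k_meas])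
      (use k_bound[OF that] k_supp[OF that] far[OF that] in \<open>auto simp: less_imp_le\<close>)
  define h where "h i \<theta> = (LINT y|lebesgue. k \<theta> y * v y $ i)" for i \<theta>
  have h_eq: "h i \<theta> = convolve \<phi> v (r \<theta>) (x \<theta>) $ i" if "\<theta> \<in> {0..1}" for i \<theta>
    using integral_component_cart(2)[OF kv_int[OF that], of i] by (simp add: h_def convolve_def k_def)
  have h_deriv: "(h i has_real_derivative (LINT y|lebesgue. k' \<theta> y * v y $ i)) (at \<theta> within {0..1})"
    if "\<theta> \<in> {0..1}" for i \<theta>
    unfolding h_def
  proof (rule has_real_derivative_lebesgue_integral[where g = "\<lambda>y. (K * indicator (cball x\<^sub>0 \<rho>) y) * \<bar>v y $ i\<bar>"])
    show "integrable lebesgue (\<lambda>y. k \<theta> y * v y $ i)" if "\<theta> \<in> {0..1}" for \<theta>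
      using integral_component_cart(1)[OF kv_int[OF that], of i] by simp
    show "((\<lambda>\<theta>. k \<theta> y * v y $ i) has_real_derivative k' \<theta> y * v y $ i) (at \<theta> within {0..1})"
      if "\<theta> \<in> {0..1}" for \<theta> y
      using k_deriv[OF that, of y] by (intro DERIV_cmult_right) (rule has_field_derivative_at_within)
    show "\<bar>k' \<theta> y * v y $ i\<bar> \<le> (K * indicator (cball x\<^sub>0 \<rho>) y) * \<bar>v y $ i\<bar>" if "\<theta> \<in> {0..1}" for \<theta> y
    proof (cases "y \<in> cball x\<^sub>0 \<rho>")
      case True
      then show ?thesis using k'_bound[OF that, of y] by (auto simp: abs_mult intro!: mult_right_mono)
    next
      case False
      then show ?thesis using k'_supp[OF that] far[OF that False] by simp
    qed
    have "integrable lebesgue (\<lambda>y. K * (indicator (cball x\<^sub>0 \<rho>) y *\<^sub>R (v y $ i)))"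
    proof -
      have "(\<lambda>y. v y $ i) absolutely_integrable_on cball x\<^sub>0 \<rho>"
        using loc_integrable_component[OF vl, of i] by (simp add: loc_integrable_def)
      then show ?thesis unfolding set_integrable_def by (rule integrable_mult_right)
    qed
    from integrable_abs[OF this]
    have "integrable lebesgue (\<lambda>y. \<bar>K * (indicator (cball x\<^sub>0 \<rho>) y *\<^sub>R (v y $ i))\<bar>)" .
    moreover have "0 \<le> K" using k'_bound[of 0 0] by simp
    ultimately show "integrable lebesgue (\<lambda>y. (K * indicator (cball x\<^sub>0 \<rho>) y) * \<bar>v y $ i\<bar>)"
      by (simp add: abs_mult mult.assoc)
    have "k' \<theta> \<in> borel_measurable lebesgue" using k'_meas[OF that] by (simp add: measurable_completion)
    then show "(\<lambda>y. k' \<theta> y * v y $ i) \<in> borel_measurable lebesgue"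
      using borel_measurable_loc_integrable[OF loc_integrable_component[OF vl, of i]] by simp
  qed (use that in auto)
  have h'_eq: "(LINT y|lebesgue. k' \<theta> y * v y $ i) = (LINT y|lebesgue. k \<theta> y * (A y $ i \<bullet> V \<theta> y))"
    and h'_int: "integrable lebesgue (\<lambda>y. k \<theta> y * (A y $ i \<bullet> V \<theta> y))" if \<theta>: "\<theta> \<in> {0..1}" for i \<theta>
  proof -
    have \<psi>z: "\<psi> \<theta> j y = 0" if "y \<notin> cball (x \<theta>) (r \<theta>)" for j y
      using k_supp[OF \<theta>, of y] that by (simp add: \<psi>_def dist_norm)
    have bnd: "\<exists>K. \<forall>y. \<bar>g y\<bar> \<le> K" if "continuous_on UNIV g" "\<And>y. y \<notin> cball (x \<theta>) (r \<theta>) \<Longrightarrow> g y = 0" for g :: "real^'n \<Rightarrow> real"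
    proof -
      have "bounded (g ` cball (x \<theta>) (r \<theta>))"
        using that(1) by (intro compact_imp_bounded compact_continuous_image) (auto intro: continuous_on_subset)
      then obtain c where c: "0 < c" "\<And>y. y \<in> cball (x \<theta>) (r \<theta>) \<Longrightarrow> norm (g y) \<le> c"
        by (metis bounded_pos imageI)
      then have "\<bar>g y\<bar> \<le> c" for y using that(2)[of y] by (cases "y \<in> cball (x \<theta>) (r \<theta>)") auto
      then show ?thesis by blast
    qed
    let ?d = "\<lambda>j y. frechet_derivative (\<psi> \<theta> j) (at y) (axis j 1)"
    have dz: "?d j y = 0" if y: "y \<notin> cball (x \<theta>) (r \<theta>)" for j y
    proof -
      have "(\<psi> \<theta> j has_derivative (\<lambda>_. 0)) (at y)"
      proof (rule has_derivative_transform_within_open[where f = "\<lambda>_. 0"])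
        show "open (- cball (x \<theta>) (r \<theta>))" by auto
      qed (use y \<psi>z in \<open>auto simp del: mem_cball\<close>)
      from frechet_derivative_at[OF this] show ?thesis by metis
    qed
    have int1: "integrable lebesgue (\<lambda>y. v y $ i * ?d j y)" for j
    proof -
      obtain c where "\<And>y. \<bar>?d j y\<bar> \<le> c" using bnd[OF d\<psi>_cont[OF \<theta>] dz] by blast
      from integrable_scaleR_compact_support[OF loc_integrable_component[OF vl, of i]
          borel_measurable_continuous_onI[OF d\<psi>_cont[OF \<theta>]] this dz]
      show ?thesis by (simp add: mult.commute)
    qed
    have int2: "integrable lebesgue (\<lambda>y. A y $ i $ j * \<psi> \<theta> j y)" for j
    proof -
      have c0: "continuous_on UNIV (\<psi> \<theta> j)" using \<psi>_C[OF \<theta>, of 0 j] by simp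
      obtain c where "\<And>y. \<bar>\<psi> \<theta> j y\<bar> \<le> c" using bnd[OF c0 \<psi>z] by blast
      from integrable_scaleR_compact_support[OF loc_integrable_component[OF loc_integrable_component[OF Al, of i], of j]
          borel_measurable_continuous_onI[OF c0] this \<psi>z]
      show ?thesis by (simp add: mult.commute)
    qed
    have sum_eq: "k \<theta> y * (A y $ i \<bullet> V \<theta> y) = (\<Sum>j\<in>UNIV. A y $ i $ j * \<psi> \<theta> j y)" for y
      by (simp add: inner_vec_def \<psi>_def sum_distrib_left mult.left_commute)
    show "integrable lebesgue (\<lambda>y. k \<theta> y * (A y $ i \<bullet> V \<theta> y))"
      unfolding sum_eq by (intro Bochner_Integration.integrable_sum int2)
    have "(LINT y|lebesgue. k' \<theta> y * v y $ i) = (LINT y|lebesgue. - (\<Sum>j\<in>UNIV. v y $ i * ?d j y))"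
      by (intro Bochner_Integration.integral_cong) (auto simp: k'_def sum_distrib_left mult.commute)
    also have "\<dots> = - (\<Sum>j\<in>UNIV. LINT y|lebesgue. v y $ i * ?d j y)"
      using int1 by (simp add: Bochner_Integration.integral_sum)
    also have "\<dots> = (\<Sum>j\<in>UNIV. LINT y|lebesgue. A y $ i $ j * \<psi> \<theta> j y)"
      by (simp add: wg[OF tf[OF \<theta>]] sum_negf)
    also have "\<dots> = (LINT y|lebesgue. k \<theta> y * (A y $ i \<bullet> V \<theta> y))"
      unfolding sum_eq using int2 by (simp add: Bochner_Integration.integral_sum)
    finally show "(LINT y|lebesgue. k' \<theta> y * v y $ i) = (LINT y|lebesgue. k \<theta> y * (A y $ i \<bullet> V \<theta> y))" .
  qed
  \<comment> \<open>The estimate is made for each component of the field, whence the factor \<open>CARD('n)\<close> at the end.\<close>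
  define c where "c = (norm a + \<bar>b\<bar>) * B * ?\<omega> * m"
  have h'_bound: "\<bar>LINT y|lebesgue. k' \<theta> y * v y $ i\<bar> \<le> c" if \<theta>: "\<theta> \<in> {0..1}" for i \<theta>
  proof -
    have c0: "0 \<le> c" using B(1) m by (simp add: c_def)
    let ?q = "(norm a + \<bar>b\<bar>) * ((1 / r \<theta>) ^ ?N * B)"
    have q0: "0 \<le> ?q" using B(1) rp[OF \<theta>] by simp
    have Am: "(\<lambda>y. ennreal (norm (A y)) * indicator (ball (x \<theta>) (r \<theta>)) y) \<in> borel_measurable lebesgue"
      using borel_measurable_loc_integrable[OF Al]
      by (intro borel_measurable_times_ennreal borel_measurable_indicator
          measurable_compose[OF _ measurable_ennreal] borel_measurable_norm) auto
    have "ennreal \<bar>LINT y|lebesgue. k' \<theta> y * v y $ i\<bar> = ennreal (norm (LINT y|lebesgue. k \<theta> y * (A y $ i \<bullet> V \<theta> y)))"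
      by (simp only: h'_eq[OF \<theta>] real_norm_def)
    also have "\<dots> \<le> (\<integral>\<^sup>+ y. ennreal (norm (k \<theta> y * (A y $ i \<bullet> V \<theta> y))) \<partial>lebesgue)"
      by (rule integral_norm_bound_ennreal[OF h'_int[OF \<theta>]])
    also have "\<dots> \<le> (\<integral>\<^sup>+ y. ennreal ?q * (ennreal (norm (A y)) * indicator (ball (x \<theta>) (r \<theta>)) y) \<partial>lebesgue)"
    proof (rule nn_integral_mono)
      fix y
      show "ennreal (norm (k \<theta> y * (A y $ i \<bullet> V \<theta> y)))
          \<le> ennreal ?q * (ennreal (norm (A y)) * indicator (ball (x \<theta>) (r \<theta>)) y)"
      proof (cases "norm (x \<theta> - y) < r \<theta>")
        case True
        have "norm (k \<theta> y * (A y $ i \<bullet> V \<theta> y)) \<le> ((1 / r \<theta>) ^ ?N * B) * (norm (A y) * (norm a + \<bar>b\<bar>))"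
        proof (subst norm_mult, rule mult_mono)
          have "norm (A y $ i \<bullet> V \<theta> y) \<le> norm (A y $ i) * norm (V \<theta> y)" using Cauchy_Schwarz_ineq2[of "A y $ i" "V \<theta> y"] by simp
          also have "\<dots> \<le> norm (A y) * (norm a + \<bar>b\<bar>)"
            using norm_kernel_velocity_le[OF rp[OF \<theta>], of "x \<theta>" y a b] True
            by (intro mult_mono Finite_Cartesian_Product.norm_nth_le) (auto simp: V_def)
          finally show "norm (A y $ i \<bullet> V \<theta> y) \<le> norm (A y) * (norm a + \<bar>b\<bar>)" .
          show "norm (k \<theta> y) \<le> (1 / r \<theta>) ^ ?N * B" using k_bound[OF \<theta>, of y] by (simp only: real_norm_def abs_of_nonneg)
          show "0 \<le> (1 / r \<theta>) ^ ?N * B" using k_bound[OF \<theta>, of y] by (rule order_trans)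
        qed simp
        also have "\<dots> = ?q * norm (A y)" by simp
        finally have "ennreal (norm (k \<theta> y * (A y $ i \<bullet> V \<theta> y))) \<le> ennreal (?q * norm (A y))" by (rule ennreal_leI)
        then show ?thesis using True q0 by (simp add: ennreal_mult' dist_norm)
      next
        case False
        then show ?thesis using k_supp[OF \<theta>, of y] by simp
      qed
    qed
    also have "\<dots> = ennreal ?q * (\<integral>\<^sup>+ y\<in>ball (x \<theta>) (r \<theta>). ennreal (norm (A y)) \<partial>lebesgue)"
      by (rule nn_integral_cmult[OF Am])
    also have "\<dots> = ennreal ?q * (ennreal (?\<omega> * r \<theta> ^ ?N) * average (ball (x \<theta>) (r \<theta>)) (\<lambda>y. ennreal (norm (A y))))"
      by (subst nn_integral_ball_eq_average[OF rp[OF \<theta>]]) simp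
    also have "\<dots> \<le> ennreal ?q * (ennreal (?\<omega> * r \<theta> ^ ?N) * ennreal m)"
      using avg[of \<theta>] \<theta> by (intro mult_left_mono) (auto simp: x_def r_def a_def b_def)
    also have "\<dots> = ennreal (?q * (?\<omega> * r \<theta> ^ ?N * m))"
      using q0 m rp[OF \<theta>] by (simp add: ennreal_mult'' ennreal_mult')
    also have "?q * (?\<omega> * r \<theta> ^ ?N * m) = c"
      using rp[OF \<theta>] by (simp add: c_def power_one_over field_simps)
    finally show ?thesis using c0 by (simp add: ennreal_le_iff)
  qed
  have comp: "\<bar>(convolve \<phi> v r\<^sub>1 x\<^sub>1 - convolve \<phi> v r\<^sub>0 x\<^sub>0) $ i\<bar> \<le> c" for i
  proof -
    have "norm (h i 1 - h i 0) \<le> c * norm (1 - (0::real))"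
      by (rule field_differentiable_bound[where S = "{0..1}", OF _ h_deriv]) (use h'_bound in auto)
    then show ?thesis by (simp add: h_eq x_def r_def a_def b_def)
  qed
  have "norm (convolve \<phi> v r\<^sub>1 x\<^sub>1 - convolve \<phi> v r\<^sub>0 x\<^sub>0)
      \<le> (\<Sum>i\<in>UNIV. \<bar>(convolve \<phi> v r\<^sub>1 x\<^sub>1 - convolve \<phi> v r\<^sub>0 x\<^sub>0) $ i\<bar>)"
    by (rule norm_le_l1_cart)
  also have "\<dots> \<le> (\<Sum>i\<in>(UNIV::'n set). c)" by (intro sum_mono comp)
  also have "\<dots> = ?N * B * ?\<omega> * (norm (x\<^sub>1 - x\<^sub>0) + \<bar>r\<^sub>1 - r\<^sub>0\<bar>) * m"
    by (simp add: c_def a_def b_def algebra_simps)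
  finally show ?thesis .
qed


section \<open>Flows of fields that are integrable in time and Lipschitz in space\<close>

lemma absolutely_integrable_mult_continuous:
  fixes \<beta> h :: "real \<Rightarrow> real"
  assumes "\<beta> absolutely_integrable_on {c..d}" "continuous_on {c..d} h"
  shows "(\<lambda>\<tau>. \<beta> \<tau> * h \<tau>) absolutely_integrable_on {c..d}"
proof -
  have "(\<lambda>\<tau>. h \<tau> * \<beta> \<tau>) absolutely_integrable_on {c..d}"
  proof (rule absolutely_integrable_bounded_measurable_product_real)
    show "bounded (h ` {c..d})" using assms(2) by (intro compact_imp_bounded compact_continuous_image) auto
    show "h \<in> borel_measurable (lebesgue_on {c..d})"
      using assms(2) by (intro continuous_imp_measurable_on_sets_lebesgue) auto
  qed (use assms in auto)
  then show ?thesis by (simp add: mult.commute)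
qed

lemma integral_combine_diff:
  fixes f :: "real \<Rightarrow> 'a::euclidean_space"
  assumes "f absolutely_integrable_on {c..e}" "c \<le> d" "d \<le> e"
  shows "integral {c..d} f + integral {d..e} f = integral {c..e} f"
    and "f absolutely_integrable_on {c..d}" "f absolutely_integrable_on {d..e}"
proof -
  show "integral {c..d} f + integral {d..e} f = integral {c..e} f"
    by (rule Henstock_Kurzweil_Integration.integral_combine[OF assms(2,3) set_lebesgue_integral_eq_integral(1)[OF assms(1)]])
  show "f absolutely_integrable_on {c..d}" "f absolutely_integrable_on {d..e}"
    by (rule absolutely_integrable_on_subinterval[OF assms(1)], use assms in auto)+
qed

text \<open>By bisection: on an interval on which the integral of \<open>L\<close> is small the estimate is elementary, and it is
  multiplicative over adjacent intervals.\<close>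

lemma gronwall_two_sided:
  fixes D L :: "real \<Rightarrow> real"
  assumes cd: "c \<le> d" and D: "continuous_on {c..d} D" "\<And>s. s \<in> {c..d} \<Longrightarrow> 0 \<le> D s"
    and l: "L absolutely_integrable_on {c..d}" "\<And>s. 0 \<le> L s"
    and diff: "\<And>s s'. c \<le> s \<Longrightarrow> s \<le> s' \<Longrightarrow> s' \<le> d \<Longrightarrow> \<bar>D s' - D s\<bar> \<le> integral {s..s'} (\<lambda>\<tau>. L \<tau> * D \<tau>)"
  shows "D d \<le> exp (2 * integral {c..d} L) * D c" "D c \<le> exp (2 * integral {c..d} L) * D d"
proof -
  let ?P = "\<lambda>a b. c \<le> a \<and> b \<le> d \<and> a \<le> b \<longrightarrow>
    D b \<le> exp (2 * integral {a..b} L) * D a \<and> D a \<le> exp (2 * integral {a..b} L) * D b"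
  have lsub: "L absolutely_integrable_on {a..b}" if "c \<le> a" "b \<le> d" for a b
    by (rule absolutely_integrable_on_subinterval[OF l(1)]) (use that in auto)
  have "?P c d"
  proof (rule Bolzano[OF cd, where P = ?P])
    fix a b e assume P: "?P a b" "?P b e" and ord: "a \<le> b" "b \<le> e"
    show "?P a e"
    proof
      assume ae: "c \<le> a \<and> e \<le> d \<and> a \<le> e"
      let ?x = "exp (2 * integral {a..b} L)" and ?y = "exp (2 * integral {b..e} L)"
      have xy: "exp (2 * integral {a..e} L) = ?x * ?y"
        using integral_combine_diff(1)[OF lsub[of a e] ord] ae by (simp add: exp_add[symmetric] distrib_left[symmetric])
      have 1: "D b \<le> ?x * D a" "D a \<le> ?x * D b" "D e \<le> ?y * D b" "D b \<le> ?y * D e"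
        using P ord ae by auto
      have "D e \<le> ?y * (?x * D a)" by (rule order_trans[OF 1(3)]) (simp add: 1(1))
      moreover have "D a \<le> ?x * (?y * D e)" by (rule order_trans[OF 1(2)]) (simp add: 1(4))
      ultimately show "D e \<le> exp (2 * integral {a..e} L) * D a \<and> D a \<le> exp (2 * integral {a..e} L) * D e"
        unfolding xy by (simp add: mult_ac)
    qed
  next
    fix x assume x: "c \<le> x" "x \<le> d"
    have "continuous_on {c..d} (\<lambda>s. integral {c..s} L)"
      using l(1) by (intro indefinite_integral_continuous_1 set_lebesgue_integral_eq_integral(1))
    then obtain \<delta> where \<delta>: "0 < \<delta>"
        "\<And>s. s \<in> {c..d} \<Longrightarrow> \<bar>s - x\<bar> < \<delta> \<Longrightarrow> \<bar>integral {c..s} L - integral {c..x} L\<bar> < 1/8"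
      using x unfolding continuous_on_iff by (metis atLeastAtMost_iff dist_real_def zero_less_divide_1_iff zero_less_numeral)
    show "\<exists>\<delta>>0. \<forall>a b. a \<le> x \<and> x \<le> b \<and> b - a < \<delta> \<longrightarrow> ?P a b"
    proof (intro exI[of _ \<delta>] conjI \<delta>(1) allI impI)
      fix a b assume ab: "a \<le> x \<and> x \<le> b \<and> b - a < \<delta>" "c \<le> a \<and> b \<le> d \<and> a \<le> b"
      define q where "q = integral {a..b} L"
      have lab: "L absolutely_integrable_on {a..b}" using lsub ab by auto
      have "q = integral {c..b} L - integral {c..a} L"
        using integral_combine_diff(1)[OF lsub[of c b], of a] ab by (simp add: q_def)
      moreover have "\<bar>integral {c..a} L - integral {c..x} L\<bar> < 1/8" "\<bar>integral {c..b} L - integral {c..x} L\<bar> < 1/8"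
        using \<delta>(2)[of a] \<delta>(2)[of b] ab by auto
      ultimately have q: "q \<le> 1/4" by linarith
      have q0: "0 \<le> q" unfolding q_def using l(2) by (intro Henstock_Kurzweil_Integration.integral_nonneg set_lebesgue_integral_eq_integral(1)[OF lab]) auto
      have "continuous_on {a..b} D" using D(1) ab by (auto intro: continuous_on_subset)
      then obtain p where p: "p \<in> {a..b}" "\<And>s. s \<in> {a..b} \<Longrightarrow> D s \<le> D p"
        using continuous_attains_sup[of "{a..b}" D] ab by auto
      have inc: "\<bar>D s' - D s\<bar> \<le> q * D p" if "a \<le> s" "s \<le> s'" "s' \<le> b" for s s'
      proof -
        have lss: "L absolutely_integrable_on {s..s'}" using lsub ab that by auto
        have "\<bar>D s' - D s\<bar> \<le> integral {s..s'} (\<lambda>\<tau>. L \<tau> * D \<tau>)" using that ab by (intro diff) auto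
        also have "\<dots> \<le> integral {s..s'} (\<lambda>\<tau>. L \<tau> * D p)"
        proof (rule integral_le)
          show "(\<lambda>\<tau>. L \<tau> * D \<tau>) integrable_on {s..s'}" "(\<lambda>\<tau>. L \<tau> * D p) integrable_on {s..s'}"
            using that ab D(1) by (auto intro!: set_lebesgue_integral_eq_integral(1) absolutely_integrable_mult_continuous lss
              intro: continuous_on_subset)
        qed (use that l(2) p(2) in \<open>auto intro!: mult_left_mono\<close>)
        also have "\<dots> = integral {s..s'} L * D p" by simp
        also have "\<dots> \<le> q * D p"
        proof (rule mult_right_mono)
          show "integral {s..s'} L \<le> q" unfolding q_def
            by (rule integral_subset_le) (use that l(2) set_lebesgue_integral_eq_integral(1)[OF lss] set_lebesgue_integral_eq_integral(1)[OF lab] in auto)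
          show "0 \<le> D p" using D(2) p(1) ab by auto
        qed
        finally show ?thesis .
      qed
      have ends: "D u \<le> exp (2 * q) * D v" if "u \<in> {a..b}" "v \<in> {a..b}" "\<bar>D u - D v\<bar> \<le> q * D p" "\<bar>D p - D v\<bar> \<le> q * D p" for u v
      proof -
        have v0: "0 \<le> D v" "0 \<le> D p" using D(2) that p(1) ab by auto
        have "q * D p \<le> 1/4 * D p" using q v0 by (intro mult_right_mono) auto
        then have "D p \<le> 2 * D v" using that(4) v0 by linarith
        then have "q * D p \<le> q * (2 * D v)" using q0 by (rule mult_left_mono)
        then have "D u \<le> (1 + 2 * q) * D v" using that(3) by (simp add: algebra_simps)
        also have "\<dots> \<le> exp (2 * q) * D v" by (intro mult_right_mono v0 exp_ge_add_one_self)
        finally show ?thesis .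
      qed
      show "D b \<le> exp (2 * integral {a..b} L) * D a" "D a \<le> exp (2 * integral {a..b} L) * D b"
        unfolding q_def[symmetric]
        by (rule ends; use inc[of a b] inc[of a p] inc[of p b] p(1) ab in \<open>auto simp: abs_minus_commute\<close>)+
    qed
  qed
  then show "D d \<le> exp (2 * integral {c..d} L) * D c" "D c \<le> exp (2 * integral {c..d} L) * D d"
    using cd by auto
qed

lemma exp_increment_ge:
  fixes y :: real assumes "0 \<le> y" "y \<le> 1/4" shows "2 * y \<le> 1 - exp (- (4 * y))"
proof -
  have "1 + 4 * y \<le> exp (4 * y)" by (rule exp_ge_add_one_self)
  then have "exp (- (4 * y)) \<le> 1 / (1 + 4 * y)"
    using assms by (simp add: exp_minus inverse_eq_divide frac_le)
  also have "\<dots> \<le> 1 - 2 * y"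
  proof -
    have "2 * y * (4 * y) \<le> 2 * y * 1" using assms by (intro mult_left_mono) auto
    then have "1 \<le> (1 - 2 * y) * (1 + 4 * y)" by (simp add: algebra_simps)
    then show ?thesis using assms by (simp add: pos_divide_le_eq)
  qed
  finally show ?thesis by simp
qed

text \<open>This weight makes the Picard iteration a contraction by the factor one half, uniformly in time. The antiderivative of
  \<open>4 \<beta> exp (4 F)\<close> is \<open>exp (4 F)\<close>; giving away a factor two leaves room for a proof by bisection, in which \<open>F\<close> is
  only continuous. The sign \<open>\<sigma>\<close> serves the two directions of time.\<close>

lemma integral_exp_weight_le:
  fixes F \<beta> :: "real \<Rightarrow> real"
  assumes cd: "c \<le> d" and \<sigma>: "\<sigma> = 1 \<or> \<sigma> = - 1"
    and \<beta>: "\<beta> absolutely_integrable_on {c..d}" "\<And>s. 0 \<le> \<beta> s"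
    and F: "continuous_on {c..d} F" "\<And>s s'. c \<le> s \<Longrightarrow> s \<le> s' \<Longrightarrow> s' \<le> d \<Longrightarrow> F s' - F s = integral {s..s'} \<beta>"
  shows "integral {c..d} (\<lambda>\<tau>. \<beta> \<tau> * exp (4 * (\<sigma> * F \<tau>))) \<le> \<sigma> * (exp (4 * (\<sigma> * F d)) - exp (4 * (\<sigma> * F c))) / 2"
proof -
  let ?E = "\<lambda>\<tau>. exp (4 * (\<sigma> * F \<tau>))" and ?g = "\<lambda>\<tau>. \<beta> \<tau> * exp (4 * (\<sigma> * F \<tau>))"
  let ?P = "\<lambda>a b. c \<le> a \<and> b \<le> d \<and> a \<le> b \<longrightarrow> integral {a..b} ?g \<le> \<sigma> * (?E b - ?E a) / 2"
  have g: "?g absolutely_integrable_on {c..d}"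
    using F(1) by (intro absolutely_integrable_mult_continuous \<beta> continuous_intros)
  have gsub: "?g absolutely_integrable_on {a..b}" if "c \<le> a" "b \<le> d" for a b
    by (rule absolutely_integrable_on_subinterval[OF g]) (use that in auto)
  have "?P c d"
  proof (rule Bolzano[OF cd, where P = ?P])
    fix a b e assume P: "?P a b" "?P b e" and ord: "a \<le> b" "b \<le> e"
    show "?P a e"
    proof
      assume ae: "c \<le> a \<and> e \<le> d \<and> a \<le> e"
      have "integral {a..e} ?g = integral {a..b} ?g + integral {b..e} ?g"
        using integral_combine_diff(1)[OF gsub[of a e] ord] ae by simp
      also have "\<dots> \<le> \<sigma> * (?E b - ?E a) / 2 + \<sigma> * (?E e - ?E b) / 2"
        using P ord ae by (intro add_mono) auto
      finally show "integral {a..e} ?g \<le> \<sigma> * (?E e - ?E a) / 2" by (simp add: algebra_simps flip: add_divide_distrib)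
    qed
  next
    fix x assume x: "c \<le> x" "x \<le> d"
    obtain \<delta> where \<delta>: "0 < \<delta>" "\<And>s. s \<in> {c..d} \<Longrightarrow> \<bar>s - x\<bar> < \<delta> \<Longrightarrow> \<bar>F s - F x\<bar> < 1/8"
      using x F(1) unfolding continuous_on_iff by (metis atLeastAtMost_iff dist_real_def zero_less_divide_1_iff zero_less_numeral)
    show "\<exists>\<delta>>0. \<forall>a b. a \<le> x \<and> x \<le> b \<and> b - a < \<delta> \<longrightarrow> ?P a b"
    proof (intro exI[of _ \<delta>] conjI \<delta>(1) allI impI)
      fix a b assume ab: "a \<le> x \<and> x \<le> b \<and> b - a < \<delta>" "c \<le> a \<and> b \<le> d \<and> a \<le> b"
      have \<beta>ss: "\<beta> absolutely_integrable_on {s..s'}" if "a \<le> s" "s' \<le> b" for s s'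
        by (rule absolutely_integrable_on_subinterval[OF \<beta>(1)]) (use that ab in auto)
      have mono: "F s \<le> F s'" if "a \<le> s" "s \<le> s'" "s' \<le> b" for s s'
      proof -
        have "0 \<le> integral {s..s'} \<beta>"
          using \<beta>(2) by (intro Henstock_Kurzweil_Integration.integral_nonneg set_lebesgue_integral_eq_integral(1)[OF \<beta>ss]) (use that in auto)
        then show ?thesis using F(2)[of s s'] that ab by auto
      qed
      define q where "q = F b - F a"
      have "\<bar>F a - F x\<bar> < 1/8" "\<bar>F b - F x\<bar> < 1/8" using \<delta>(2)[of a] \<delta>(2)[of b] ab by auto
      then have q: "0 \<le> q" "q \<le> 1/4" using mono[of a b] ab unfolding q_def by (auto, linarith)
      define M where "M = (if \<sigma> = 1 then ?E b else ?E a)"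
      have "integral {a..b} ?g \<le> integral {a..b} (\<lambda>\<tau>. \<beta> \<tau> * M)"
      proof (rule integral_le)
        show "?g integrable_on {a..b}" using gsub ab by (intro set_lebesgue_integral_eq_integral(1)) auto
        show "(\<lambda>\<tau>. \<beta> \<tau> * M) integrable_on {a..b}"
          by (intro set_lebesgue_integral_eq_integral(1) absolutely_integrable_mult_continuous \<beta>ss) auto
        show "?g \<tau> \<le> \<beta> \<tau> * M" if "\<tau> \<in> {a..b}" for \<tau>
          using \<sigma> mono[of a \<tau>] mono[of \<tau> b] that \<beta>(2) by (intro mult_left_mono) (auto simp: M_def)
      qed
      also have "\<dots> = q * M" using F(2)[of a b] ab by (simp add: q_def)
      also have "\<dots> \<le> M * (1 - exp (- (4 * q))) / 2"
      proof -
        have "0 \<le> M" by (simp add: M_def)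
        from mult_left_mono[OF exp_increment_ge[OF q] this] show ?thesis by (simp add: mult_ac)
      qed
      also have "M * (1 - exp (- (4 * q))) = \<sigma> * (?E b - ?E a)"
        using \<sigma> by (auto simp: M_def q_def algebra_simps exp_add[symmetric])
      finally show "integral {a..b} ?g \<le> \<sigma> * (?E b - ?E a) / 2" .
    qed
  qed
  then show ?thesis using cd by auto
qed

text \<open>Increments between ordered times, instead of oriented integrals from a base point, treat the past and the future of
  the base point alike.\<close>

definition solves_on :: "real set \<Rightarrow> (real \<Rightarrow> 'a::euclidean_space \<Rightarrow> 'a) \<Rightarrow> (real \<Rightarrow> 'a) \<Rightarrow> bool" where
  "solves_on I b \<gamma> \<longleftrightarrow> (\<forall>c d. c \<in> I \<and> d \<in> I \<and> c \<le> d \<longrightarrow>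
     (\<lambda>\<tau>. b \<tau> (\<gamma> \<tau>)) absolutely_integrable_on {c..d} \<and> \<gamma> d - \<gamma> c = integral {c..d} (\<lambda>\<tau>. b \<tau> (\<gamma> \<tau>)))"

text \<open>The estimates are required at every time. A field that satisfies them at almost every time is first changed on a
  Borel null set of times.\<close>

locale caratheodory_field =
  fixes I :: "real set" and b :: "real \<Rightarrow> 'a::euclidean_space \<Rightarrow> 'a" and L :: "real \<Rightarrow> real"
  assumes open_time: "open I" and interval_time: "is_interval I"
    and b_measurable: "(\<lambda>(t, x). b t x) \<in> borel_measurable borel"
    and b_lipschitz: "norm (b t x - b t y) \<le> L t * norm (x - y)"
    and l_nonneg: "0 \<le> L t"
    and l_integrable: "c \<in> I \<Longrightarrow> d \<in> I \<Longrightarrow> L absolutely_integrable_on {c..d}"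
    and b_integrable: "c \<in> I \<Longrightarrow> d \<in> I \<Longrightarrow> (\<lambda>t. b t 0) absolutely_integrable_on {c..d}"
begin

lemma time_subset: "c \<in> I \<Longrightarrow> d \<in> I \<Longrightarrow> {c..d} \<subseteq> I"
  using interval_time by (meson atLeastAtMost_iff mem_is_interval_1_I subsetI)

lemma continuous_on_time:
  assumes "\<And>c d. c \<in> I \<Longrightarrow> d \<in> I \<Longrightarrow> continuous_on {c..d} f"
  shows "continuous_on I f"
proof -
  have "isCont f s" if s: "s \<in> I" for s
  proof -
    obtain e where e: "0 < e" "cball s e \<subseteq> I" using open_time s open_contains_cball by blast
    then have "s - e \<in> I" "s + e \<in> I" by (auto simp: subset_iff dist_real_def)
    then have "continuous_on {s - e..s + e} f" by (rule assms)
    then show ?thesis using e(1) by (intro continuous_on_interior[of "{s - e..s + e}"]) auto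
  qed
  then show ?thesis by (simp add: continuous_at_imp_continuous_on)
qed

lemma composition_measurable:
  assumes "continuous_on {c..d} \<gamma>"
  shows "(\<lambda>\<tau>. b \<tau> (\<gamma> \<tau>)) \<in> borel_measurable (lebesgue_on {c..d})"
proof -
  have "\<gamma> \<in> borel_measurable (lebesgue_on {c..d})"
    using assms by (intro continuous_imp_measurable_on_sets_lebesgue) auto
  moreover have "(\<lambda>\<tau>. \<tau>) \<in> borel_measurable (lebesgue_on {c..d})"
    by (simp add: measurable_completion measurable_restrict_space1)
  ultimately have "(\<lambda>\<tau>. (\<tau>, \<gamma> \<tau>)) \<in> borel_measurable (lebesgue_on {c..d})"
    by (intro borel_measurable_Pair)
  from measurable_compose[OF this b_measurable] show ?thesis by simp
qed

lemma integrable_of_bound: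
  assumes "continuous_on {c..d} \<gamma>" "g absolutely_integrable_on {c..d}"
    and "\<And>\<tau>. \<tau> \<in> {c..d} \<Longrightarrow> norm (b \<tau> (\<gamma> \<tau>)) \<le> g \<tau>"
  shows "(\<lambda>\<tau>. b \<tau> (\<gamma> \<tau>)) absolutely_integrable_on {c..d}"
  by (rule measurable_bounded_by_integrable_imp_absolutely_integrable[OF composition_measurable[OF assms(1)] _
      set_lebesgue_integral_eq_integral(1)[OF assms(2)] assms(3)]) auto

lemma solution_continuous:
  assumes "solves_on I b \<gamma>" shows "continuous_on I \<gamma>"
proof (rule continuous_on_time)
  fix c d assume cd: "c \<in> I" "d \<in> I"
  show "continuous_on {c..d} \<gamma>"
  proof (cases "c \<le> d")
    case True
    then have "(\<lambda>\<tau>. b \<tau> (\<gamma> \<tau>)) integrable_on {c..d}"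
      using assms cd by (auto simp: solves_on_def set_lebesgue_integral_eq_integral(1))
    then have "continuous_on {c..d} (\<lambda>s. \<gamma> c + integral {c..s} (\<lambda>\<tau>. b \<tau> (\<gamma> \<tau>)))"
      by (intro continuous_intros indefinite_integral_continuous_1)
    moreover have "\<gamma> c + integral {c..s} (\<lambda>\<tau>. b \<tau> (\<gamma> \<tau>)) = \<gamma> s" if "s \<in> {c..d}" for s
    proof -
      have "\<gamma> s - \<gamma> c = integral {c..s} (\<lambda>\<tau>. b \<tau> (\<gamma> \<tau>))"
        using assms that cd time_subset[OF cd] unfolding solves_on_def by auto
      then show ?thesis by (simp add: algebra_simps)
    qed
    ultimately show ?thesis by (rule continuous_on_eq)
  qed auto
qed

text \<open>Applied to solutions through different points, this is uniqueness and continuous dependence at once, since \<open>s'\<close> may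
  be any time at which the two solutions are known to be close.\<close>

lemma solutions_stable:
  assumes \<gamma>: "solves_on I b \<gamma>\<^sub>1" "solves_on I b \<gamma>\<^sub>2" and cd: "c \<in> I" "d \<in> I" and s: "s \<in> {c..d}" "s' \<in> {c..d}"
  shows "norm (\<gamma>\<^sub>1 s - \<gamma>\<^sub>2 s) \<le> exp (2 * integral {c..d} L) * norm (\<gamma>\<^sub>1 s' - \<gamma>\<^sub>2 s')"
proof -
  define D where "D s = norm (\<gamma>\<^sub>1 s - \<gamma>\<^sub>2 s)" for s
  have cont: "continuous_on I \<gamma>\<^sub>1" "continuous_on I \<gamma>\<^sub>2" using solution_continuous \<gamma> by auto
  have key: "D v \<le> exp (2 * integral {u..v} L) * D u \<and> D u \<le> exp (2 * integral {u..v} L) * D v"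
    if uv: "u \<in> I" "v \<in> I" "u \<le> v" for u v
  proof -
    have sub: "{u..v} \<subseteq> I" using time_subset uv by auto
    have Dc: "continuous_on {u..v} D" unfolding D_def
      using cont sub by (intro continuous_intros) (auto intro: continuous_on_subset)
    have diff: "\<bar>D q - D p\<bar> \<le> integral {p..q} (\<lambda>\<tau>. L \<tau> * D \<tau>)"
      if pq: "u \<le> p" "p \<le> q" "q \<le> v" for p q
    proof -
    from pq have pqI: "p \<in> I" "q \<in> I" using sub by auto
    let ?f = "\<lambda>i \<tau>. b \<tau> (i \<tau>)"
    have i: "?f \<gamma>\<^sub>1 absolutely_integrable_on {p..q}" "?f \<gamma>\<^sub>2 absolutely_integrable_on {p..q}"
      and e: "\<gamma>\<^sub>1 q - \<gamma>\<^sub>1 p = integral {p..q} (?f \<gamma>\<^sub>1)" "\<gamma>\<^sub>2 q - \<gamma>\<^sub>2 p = integral {p..q} (?f \<gamma>\<^sub>2)"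
      using \<gamma> pqI pq(2) unfolding solves_on_def by auto
    have "\<bar>D q - D p\<bar> \<le> norm ((\<gamma>\<^sub>1 q - \<gamma>\<^sub>2 q) - (\<gamma>\<^sub>1 p - \<gamma>\<^sub>2 p))"
      unfolding D_def by (rule norm_triangle_ineq3)
    also have "(\<gamma>\<^sub>1 q - \<gamma>\<^sub>2 q) - (\<gamma>\<^sub>1 p - \<gamma>\<^sub>2 p) = integral {p..q} (\<lambda>\<tau>. b \<tau> (\<gamma>\<^sub>1 \<tau>) - b \<tau> (\<gamma>\<^sub>2 \<tau>))"
      using e Henstock_Kurzweil_Integration.integral_diff[OF set_lebesgue_integral_eq_integral(1)[OF i(1)] set_lebesgue_integral_eq_integral(1)[OF i(2)]]
      by (simp add: algebra_simps)
    also have "norm \<dots> \<le> integral {p..q} (\<lambda>\<tau>. L \<tau> * D \<tau>)"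
    proof (rule integral_norm_bound_integral)
      show "(\<lambda>\<tau>. b \<tau> (\<gamma>\<^sub>1 \<tau>) - b \<tau> (\<gamma>\<^sub>2 \<tau>)) integrable_on {p..q}"
        using i by (intro integrable_diff set_lebesgue_integral_eq_integral(1))
      show "(\<lambda>\<tau>. L \<tau> * D \<tau>) integrable_on {p..q}"
        using pq by (intro set_lebesgue_integral_eq_integral(1) absolutely_integrable_mult_continuous l_integrable pqI)
          (auto intro: continuous_on_subset[OF Dc])
    qed (simp add: D_def b_lipschitz)
    finally show ?thesis .
    qed
    have "0 \<le> D s" for s by (simp add: D_def)
    from gronwall_two_sided[OF uv(3) Dc this l_integrable[OF uv(1,2)] l_nonneg diff] show ?thesis by blast
  qed
  have le: "integral {u..v} L \<le> integral {c..d} L" if "c \<le> u" "u \<le> v" "v \<le> d" for u v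
    using that l_nonneg time_subset[OF cd] cd
    by (intro integral_subset_le set_lebesgue_integral_eq_integral(1) l_integrable) auto
  have sI: "s \<in> I" "s' \<in> I" using time_subset[OF cd] s by auto
  have "D s \<le> exp (2 * integral {min s s'..max s s'} L) * D s'"
    using key[of s s'] key[of s' s] sI by (cases "s \<le> s'") (auto simp: min_def max_def)
  also have "\<dots> \<le> exp (2 * integral {c..d} L) * D s'"
    using le[of "min s s'" "max s s'"] s by (intro mult_right_mono) (auto simp: D_def)
  finally show ?thesis by (simp add: D_def)
qed

end


definition oriented_integral :: "real \<Rightarrow> (real \<Rightarrow> 'a::euclidean_space) \<Rightarrow> real \<Rightarrow> 'a" where
  "oriented_integral t f s = (if t \<le> s then integral {t..s} f else - integral {s..t} f)"

lemma oriented_integral_diff: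
  fixes f :: "real \<Rightarrow> 'a::euclidean_space"
  assumes "f absolutely_integrable_on {min t c..max t d}" "c \<le> d"
  shows "oriented_integral t f d - oriented_integral t f c = integral {c..d} f"
proof -
  have sub: "f absolutely_integrable_on {u..v}" if "min t c \<le> u" "v \<le> max t d" for u v
    by (rule absolutely_integrable_on_subinterval[OF assms(1)]) (use that in auto)
  have comb: "integral {u..v} f + integral {v..w} f = integral {u..w} f"
    if "min t c \<le> u" "u \<le> v" "v \<le> w" "w \<le> max t d" for u v w
    using integral_combine_diff(1)[OF sub[of u w] that(2,3)] that by simp
  consider "t \<le> c" | "c < t" "t \<le> d" | "d < t" using assms(2) by linarith
  then show ?thesis
  proof cases
    case 1
    then show ?thesis using comb[of t c d] assms(2) by (simp add: oriented_integral_def algebra_simps)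
  next
    case 2
    then show ?thesis using comb[of c t d] assms(2) by (simp add: oriented_integral_def algebra_simps)
  next
    case 3
    then show ?thesis using comb[of c d t] assms(2) by (simp add: oriented_integral_def algebra_simps)
  qed
qed

lemma oriented_integral_self [simp]: "oriented_integral t f t = 0"
  by (simp add: oriented_integral_def)

lemma interval_integral_lebesgue:
  fixes f :: "real \<Rightarrow> 'a::euclidean_space"
  shows "interval_lebesgue_integrable lebesgue (ereal t) (ereal s) f \<longleftrightarrow> f absolutely_integrable_on {min t s..max t s}"
    and "f absolutely_integrable_on {min t s..max t s} \<Longrightarrow>
      interval_lebesgue_integral lebesgue (ereal t) (ereal s) f = oriented_integral t f s"
proof -
  have open_iff: "f absolutely_integrable_on {c<..<d} \<longleftrightarrow> f absolutely_integrable_on {c..d}" for c d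
    using absolutely_integrable_on_open_interval[of c d f] by (simp add: box_real)
  have open_int: "(LINT x:{c<..<d}|lebesgue. f x) = integral {c..d} f" if "f absolutely_integrable_on {c..d}" for c d
  proof -
    have "(LINT x:{c<..<d}|lebesgue. f x) = integral {c<..<d} f"
      using that open_iff by (intro set_lebesgue_integral_eq_integral(2)) simp
    also have "\<dots> = integral {c..d} f" using integral_open_interval[of c d f] by (simp add: box_real)
    finally show ?thesis .
  qed
  show "interval_lebesgue_integrable lebesgue (ereal t) (ereal s) f \<longleftrightarrow> f absolutely_integrable_on {min t s..max t s}"
    by (cases "t \<le> s") (simp_all add: interval_lebesgue_integrable_def einterval_eq open_iff)
  show "interval_lebesgue_integral lebesgue (ereal t) (ereal s) f = oriented_integral t f s"
    if "f absolutely_integrable_on {min t s..max t s}"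
    using that by (cases "t \<le> s") (simp_all add: interval_lebesgue_integral_def einterval_eq open_int oriented_integral_def)
qed

lemma einterval_facts: "open (einterval S T)" "is_interval (einterval S T)"
proof -
  show "open (einterval S T)" by (rule open_einterval)
  show "is_interval (einterval S T)"
    unfolding is_interval_1 einterval_def
    by (auto intro: less_le_trans[of S] le_less_trans[of "ereal _" "ereal _" T])
qed

lemma einterval_min_max: "t \<in> einterval S T \<Longrightarrow> s \<in> einterval S T \<Longrightarrow> min t s \<in> einterval S T \<and> max t s \<in> einterval S T"
  by (simp add: min_def max_def)

lemma ode_solution_iff_solves_on:
  assumes t: "t \<in> einterval S T"
  shows "ode_solution S T b t x \<gamma> \<longleftrightarrow> \<gamma> t = x \<and> solves_on (einterval S T) b \<gamma>"
proof
  let ?f = "\<lambda>\<tau>. b \<tau> (\<gamma> \<tau>)" and ?I = "einterval S T"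
  assume ode: "ode_solution S T b t x \<gamma>"
  have int: "?f absolutely_integrable_on {min t s..max t s}" and val: "\<gamma> s = x + oriented_integral t ?f s" if "s \<in> ?I" for s
    using ode that interval_integral_lebesgue[of t s ?f] unfolding ode_solution_def by auto
  have "solves_on ?I b \<gamma>"
    unfolding solves_on_def
  proof (intro allI impI, elim conjE)
    fix c d assume cd: "c \<in> ?I" "d \<in> ?I" "c \<le> d"
    have "?f absolutely_integrable_on {min t c..max t c} \<union> {min t d..max t d}"
      by (rule set_integrable_Un[OF int[OF cd(1)] int[OF cd(2)]]) auto
    moreover have "{min t c..max t d} \<subseteq> {min t c..max t c} \<union> {min t d..max t d}"
      by (auto simp: min_def max_def)
    ultimately have i: "?f absolutely_integrable_on {min t c..max t d}"
      by (rule absolutely_integrable_on_subinterval)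
    have "?f absolutely_integrable_on {c..d}"
      by (rule absolutely_integrable_on_subinterval[OF i]) auto
    moreover have "\<gamma> d - \<gamma> c = integral {c..d} ?f"
      using oriented_integral_diff[OF i cd(3)] val[OF cd(1)] val[OF cd(2)] by simp
    ultimately show "?f absolutely_integrable_on {c..d} \<and> \<gamma> d - \<gamma> c = integral {c..d} ?f" ..
  qed
  then show "\<gamma> t = x \<and> solves_on ?I b \<gamma>" using val[OF t] by simp
next
  let ?f = "\<lambda>\<tau>. b \<tau> (\<gamma> \<tau>)" and ?I = "einterval S T"
  assume sol: "\<gamma> t = x \<and> solves_on ?I b \<gamma>"
  show "ode_solution S T b t x \<gamma>"
    unfolding ode_solution_def
  proof (intro ballI)
    fix s assume s: "s \<in> ?I"
    have i: "?f absolutely_integrable_on {min t s..max t s}"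
      using sol einterval_min_max[OF t s] by (auto simp: solves_on_def)
    have "\<gamma> s = x + oriented_integral t ?f s"
    proof (cases "t \<le> s")
      case True
      then have "\<gamma> s - \<gamma> t = integral {t..s} ?f" using sol t s by (auto simp: solves_on_def)
      then show ?thesis using True sol by (simp add: oriented_integral_def algebra_simps)
    next
      case False
      then have "\<gamma> t - \<gamma> s = integral {s..t} ?f" using sol t s by (auto simp: solves_on_def)
      then show ?thesis using False sol by (simp add: oriented_integral_def algebra_simps)
    qed
    then show "interval_lebesgue_integrable lebesgue (ereal t) (ereal s) ?f \<and>
        \<gamma> s = x + interval_lebesgue_integral lebesgue (ereal t) (ereal s) ?f"
      using i interval_integral_lebesgue[of t s ?f] by simp
  qed
qed

lemma solves_on_cong_AE:
  assumes "negligible N" "\<And>t x. t \<in> I - N \<Longrightarrow> b t x = b' t x" "is_interval I"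
  shows "solves_on I b \<gamma> \<longleftrightarrow> solves_on I b' \<gamma>"
proof -
  have "(\<lambda>\<tau>. b \<tau> (\<gamma> \<tau>)) absolutely_integrable_on {c..d} \<longleftrightarrow> (\<lambda>\<tau>. b' \<tau> (\<gamma> \<tau>)) absolutely_integrable_on {c..d}"
    "integral {c..d} (\<lambda>\<tau>. b \<tau> (\<gamma> \<tau>)) = integral {c..d} (\<lambda>\<tau>. b' \<tau> (\<gamma> \<tau>))" if "c \<in> I" "d \<in> I" for c d
  proof -
    have "{c..d} \<subseteq> I" using assms(3) that by (meson atLeastAtMost_iff mem_is_interval_1_I subsetI)
    then have eq: "b \<tau> (\<gamma> \<tau>) = b' \<tau> (\<gamma> \<tau>)" if "\<tau> \<in> {c..d} - N" for \<tau> using assms(2) that by auto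
    show "(\<lambda>\<tau>. b \<tau> (\<gamma> \<tau>)) absolutely_integrable_on {c..d} \<longleftrightarrow> (\<lambda>\<tau>. b' \<tau> (\<gamma> \<tau>)) absolutely_integrable_on {c..d}"
      by (rule absolutely_integrable_spike_eq[OF assms(1)]) (simp add: eq)
    show "integral {c..d} (\<lambda>\<tau>. b \<tau> (\<gamma> \<tau>)) = integral {c..d} (\<lambda>\<tau>. b' \<tau> (\<gamma> \<tau>))"
      by (rule integral_spike[OF assms(1)]) (simp add: eq)
  qed
  then show ?thesis unfolding solves_on_def by metis
qed

context caratheodory_field
begin

lemma field_at_point_integrable:
  assumes "c \<in> I" "d \<in> I"
  shows "(\<lambda>\<tau>. norm (b \<tau> x) + L \<tau>) absolutely_integrable_on {c..d}"
proof -
  have "(\<lambda>\<tau>. norm (b \<tau> 0) + L \<tau> * norm x) absolutely_integrable_on {c..d}"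
    using absolutely_integrable_norm[OF b_integrable[OF assms]] l_integrable[OF assms]
    by (intro set_integral_add absolutely_integrable_mult_continuous) (auto simp: comp_def)
  then have "(\<lambda>\<tau>. b \<tau> x) absolutely_integrable_on {c..d}"
  proof (rule integrable_of_bound[where \<gamma> = "\<lambda>_. x", rotated])
    show "norm (b \<tau> x) \<le> norm (b \<tau> 0) + L \<tau> * norm x" for \<tau>
      using b_lipschitz[of \<tau> x 0] norm_triangle_ineq2[of "b \<tau> x" "b \<tau> 0"] by simp
  qed auto
  then show ?thesis
    using absolutely_integrable_norm l_integrable[OF assms] by (intro set_integral_add) (auto simp: comp_def)
qed

text \<open>Picard iteration, measured with the weight \<open>exp (4 \<bar>F\<bar>)\<close> where \<open>F\<close> is the oriented integral of
  \<open>\<bar>b(\<cdot>, x)\<bar> + L\<close>. The weight may be unbounded near the ends of the time interval, but consecutive iterates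
  differ by at most \<open>2\<close> to the power \<open>- n\<close> times the weight, so the iteration converges at every time of the open
  interval.\<close>

lemma solution_exists:
  assumes t: "t \<in> I"
  shows "\<exists>\<gamma>. \<gamma> t = x \<and> solves_on I b \<gamma>"
proof -
  define \<beta> where "\<beta> \<tau> = norm (b \<tau> x) + L \<tau>" for \<tau>
  have \<beta>i: "\<beta> absolutely_integrable_on {c..d}" if "c \<in> I" "d \<in> I" for c d
    using field_at_point_integrable[OF that] by (simp add: \<beta>_def[abs_def])
  have \<beta>0: "0 \<le> \<beta> \<tau>" for \<tau> using l_nonneg by (simp add: \<beta>_def)
  have mm: "min t c \<in> I" "max t c \<in> I" if "c \<in> I" for c using that t by (simp_all add: min_def max_def)
  have J_diff: "oriented_integral t f d - oriented_integral t f c = integral {c..d} f"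
    if "\<And>c d. c \<in> I \<Longrightarrow> d \<in> I \<Longrightarrow> f absolutely_integrable_on {c..d}" "c \<in> I" "d \<in> I" "c \<le> d"
    for c d and f :: "real \<Rightarrow> 'z::euclidean_space"
    using that mm by (intro oriented_integral_diff) auto
  have J_cont: "continuous_on I (oriented_integral t f)"
    if f: "\<And>c d. c \<in> I \<Longrightarrow> d \<in> I \<Longrightarrow> f absolutely_integrable_on {c..d}" for f :: "real \<Rightarrow> 'z::euclidean_space"
  proof (rule continuous_on_time)
    fix c d assume cd: "c \<in> I" "d \<in> I"
    have "continuous_on {c..d} (\<lambda>s. oriented_integral t f c + integral {c..s} f)"
      using f[OF cd] by (intro continuous_intros indefinite_integral_continuous_1 set_lebesgue_integral_eq_integral(1))
    moreover have "oriented_integral t f c + integral {c..s} f = oriented_integral t f s" if "s \<in> {c..d}" for s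
      using J_diff[OF f cd(1), of s] that time_subset[OF cd] by (auto simp: algebra_simps)
    ultimately show "continuous_on {c..d} (oriented_integral t f)" by (rule continuous_on_eq)
  qed
  define F where "F = oriented_integral t \<beta>"
  have Fc: "continuous_on I F" unfolding F_def by (rule J_cont[OF \<beta>i])
  have Fd: "F d - F c = integral {c..d} \<beta>" if "c \<in> I" "d \<in> I" "c \<le> d" for c d
    unfolding F_def using J_diff[OF \<beta>i that] .
  have F_pos: "0 \<le> F s" if "s \<in> I" "t \<le> s" for s
    using that \<beta>0 set_lebesgue_integral_eq_integral(1)[OF \<beta>i[OF t that(1)]]
    by (auto simp: F_def oriented_integral_def intro!: Henstock_Kurzweil_Integration.integral_nonneg)
  have F_neg: "F s \<le> 0" if "s \<in> I" "s \<le> t" for s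
    using that \<beta>0 set_lebesgue_integral_eq_integral(1)[OF \<beta>i[OF that(1) t]]
    by (auto simp: F_def oriented_integral_def intro!: Henstock_Kurzweil_Integration.integral_nonneg)
  define E where "E s = exp (4 * \<bar>F s\<bar>)" for s
  have E1: "1 \<le> E s" for s by (simp add: E_def)
  have Ec: "continuous_on I E" unfolding E_def using Fc by (intro continuous_intros)
  have cont_sub: "continuous_on {c..d} h" if "continuous_on I h" "c \<in> I" "d \<in> I" for h :: "real \<Rightarrow> 'z::topological_space" and c d
    using that time_subset continuous_on_subset by blast
  have \<beta>E: "(\<lambda>\<tau>. \<beta> \<tau> * E \<tau>) absolutely_integrable_on {c..d}" if "c \<in> I" "d \<in> I" for c d
    by (intro absolutely_integrable_mult_continuous \<beta>i cont_sub Ec that)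
  have J_bound: "norm (oriented_integral t f s) \<le> K * E s / 2"
    if f: "\<And>c d. c \<in> I \<Longrightarrow> d \<in> I \<Longrightarrow> f absolutely_integrable_on {c..d}" and K: "0 \<le> K"
      and fb: "\<And>\<tau>. \<tau> \<in> I \<Longrightarrow> norm (f \<tau>) \<le> K * (\<beta> \<tau> * E \<tau>)" and s: "s \<in> I" for f :: "real \<Rightarrow> 'a" and K s
  proof -
    have main: "norm (integral {c..d} f) \<le> K * (\<sigma> * (exp (4 * (\<sigma> * F d)) - exp (4 * (\<sigma> * F c))) / 2)"
      if cd: "c \<in> I" "d \<in> I" "c \<le> d" and \<sigma>: "\<sigma> = 1 \<or> \<sigma> = -1" and ab: "\<And>\<tau>. \<tau> \<in> {c..d} \<Longrightarrow> \<bar>F \<tau>\<bar> = \<sigma> * F \<tau>" for c d \<sigma>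
    proof -
      have sub: "{c..d} \<subseteq> I" using time_subset cd by auto
      have "norm (integral {c..d} f) \<le> integral {c..d} (\<lambda>\<tau>. K * (\<beta> \<tau> * E \<tau>))"
        by (intro integral_norm_bound_integral set_lebesgue_integral_eq_integral(1) f cd)
          (use fb sub \<beta>E[OF cd(1,2)] in \<open>auto intro!: set_integrable_mult_right\<close>)
      also have "\<dots> = K * integral {c..d} (\<lambda>\<tau>. \<beta> \<tau> * E \<tau>)" by simp
      also have "integral {c..d} (\<lambda>\<tau>. \<beta> \<tau> * E \<tau>) = integral {c..d} (\<lambda>\<tau>. \<beta> \<tau> * exp (4 * (\<sigma> * F \<tau>)))"
        by (intro Henstock_Kurzweil_Integration.integral_cong) (simp add: E_def ab)
      also have "K * \<dots> \<le> K * (\<sigma> * (exp (4 * (\<sigma> * F d)) - exp (4 * (\<sigma> * F c))) / 2)"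
        using sub by (intro mult_left_mono K integral_exp_weight_le cd \<sigma> \<beta>i \<beta>0 cont_sub Fc Fd) auto
      finally show ?thesis .
    qed
    show ?thesis
    proof (cases "t \<le> s")
      case True
      have "norm (integral {t..s} f) \<le> K * (1 * (exp (4 * (1 * F s)) - exp (4 * (1 * F t))) / 2)"
        using True F_pos time_subset[OF t s] by (intro main t s) auto
      also have "\<dots> \<le> K * (E s / 2)"
        using True F_pos[OF s] by (intro mult_left_mono K) (simp add: E_def)
      finally show ?thesis using True by (simp add: oriented_integral_def)
    next
      case False
      have "norm (integral {s..t} f) \<le> K * (-1 * (exp (4 * (-1 * F t)) - exp (4 * (-1 * F s))) / 2)"
        using False F_neg time_subset[OF s t] by (intro main t s) auto
      also have "\<dots> \<le> K * (E s / 2)"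
        using False F_neg[OF s] by (intro mult_left_mono K) (simp add: E_def)
      finally show ?thesis using False by (simp add: oriented_integral_def)
    qed
  qed
  define G where "G = rec_nat (\<lambda>_. x) (\<lambda>_ g s. x + oriented_integral t (\<lambda>\<tau>. b \<tau> (g \<tau>)) s)"
  have G0: "G 0 = (\<lambda>_. x)" and GS: "G (Suc n) s = x + oriented_integral t (\<lambda>\<tau>. b \<tau> (G n \<tau>)) s" for n s
    by (simp_all add: G_def)
  have growth: "norm (b \<tau> y) \<le> 2 * (\<beta> \<tau> * E \<tau>)" if "norm (y - x) \<le> E \<tau>" for \<tau> y
  proof -
    have "norm (b \<tau> y) \<le> norm (b \<tau> x) + L \<tau> * norm (y - x)"
      using b_lipschitz[of \<tau> y x] norm_triangle_ineq2[of "b \<tau> y" "b \<tau> x"] by simp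
    also have "\<dots> \<le> norm (b \<tau> x) * E \<tau> + L \<tau> * E \<tau>"
      using E1[of \<tau>] l_nonneg[of \<tau>] that
      by (intro add_mono mult_left_mono) (auto simp: mult_le_cancel_left1)
    also have "\<dots> \<le> 2 * (\<beta> \<tau> * E \<tau>)"
      using \<beta>0[of \<tau>] E1[of \<tau>] by (simp add: \<beta>_def distrib_right[symmetric])
    finally show ?thesis .
  qed
  have inv: "continuous_on I (G n) \<and> (\<forall>s\<in>I. norm (G n s - x) \<le> E s)" for n
  proof (induction n)
    case 0
    then show ?case using E1 by (auto simp: G0 intro: order_trans[OF _ E1])
  next
    case (Suc n)
    have i: "(\<lambda>\<tau>. b \<tau> (G n \<tau>)) absolutely_integrable_on {c..d}" if "c \<in> I" "d \<in> I" for c d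
    proof (rule integrable_of_bound[where g = "\<lambda>\<tau>. 2 * (\<beta> \<tau> * E \<tau>)"])
      show "(\<lambda>\<tau>. 2 * (\<beta> \<tau> * E \<tau>)) absolutely_integrable_on {c..d}" using \<beta>E[OF that] by (rule set_integrable_mult_right)
      show "continuous_on {c..d} (G n)" using Suc cont_sub[OF _ that] by blast
    qed (use Suc growth time_subset[OF that] in auto)
    have "norm (G (Suc n) s - x) \<le> E s" if "s \<in> I" for s
      using J_bound[OF i, of 2 s] growth Suc that by (simp add: GS)
    moreover have "continuous_on I (\<lambda>s. x + oriented_integral t (\<lambda>\<tau>. b \<tau> (G n \<tau>)) s)"
      by (intro continuous_intros J_cont i)
    ultimately show ?case by (simp add: GS[abs_def])
  qed
  have fi: "(\<lambda>\<tau>. b \<tau> (G n \<tau>)) absolutely_integrable_on {c..d}" if "c \<in> I" "d \<in> I" for c d n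
  proof (rule integrable_of_bound[where g = "\<lambda>\<tau>. 2 * (\<beta> \<tau> * E \<tau>)"])
    show "(\<lambda>\<tau>. 2 * (\<beta> \<tau> * E \<tau>)) absolutely_integrable_on {c..d}" using \<beta>E[OF that] by (rule set_integrable_mult_right)
    show "continuous_on {c..d} (G n)" using inv cont_sub[OF _ that] by blast
  qed (use inv growth time_subset[OF that] in auto)
  have step: "\<forall>s\<in>I. norm (G (Suc n) s - G n s) \<le> (1/2) ^ n * E s" for n
  proof (induction n)
    case 0
    then show ?case using inv[of 1] by (simp add: G0)
  next
    case (Suc n)
    show ?case
    proof
      fix s assume s: "s \<in> I"
      let ?h = "\<lambda>\<tau>. b \<tau> (G (Suc n) \<tau>) - b \<tau> (G n \<tau>)"
      have lin: "oriented_integral t (\<lambda>\<tau>. b \<tau> (G (Suc n) \<tau>)) s - oriented_integral t (\<lambda>\<tau>. b \<tau> (G n \<tau>)) s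
          = oriented_integral t ?h s"
        using set_lebesgue_integral_eq_integral(1)[OF fi[OF t s]] set_lebesgue_integral_eq_integral(1)[OF fi[OF s t]]
        by (simp add: oriented_integral_def Henstock_Kurzweil_Integration.integral_diff)
      have "norm (oriented_integral t ?h s) \<le> (1/2) ^ n * E s / 2"
      proof (rule J_bound)
        show "?h absolutely_integrable_on {c..d}" if "c \<in> I" "d \<in> I" for c d
          by (intro set_integral_diff fi that)
        fix \<tau> assume \<tau>: "\<tau> \<in> I"
        have "norm (?h \<tau>) \<le> L \<tau> * norm (G (Suc n) \<tau> - G n \<tau>)" by (rule b_lipschitz)
        also have "\<dots> \<le> \<beta> \<tau> * ((1/2) ^ n * E \<tau>)"
          using Suc \<tau> l_nonneg[of \<tau>] by (intro mult_mono) (auto simp: \<beta>_def)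
        finally show "norm (?h \<tau>) \<le> (1/2) ^ n * (\<beta> \<tau> * E \<tau>)" by (simp add: mult_ac)
      qed (use s in auto)
      then show "norm (G (Suc (Suc n)) s - G (Suc n) s) \<le> (1/2) ^ Suc n * E s"
        using lin by (simp add: GS)
    qed
  qed
  define \<gamma> where "\<gamma> s = lim (\<lambda>n. G n s)" for s
  have conv: "(\<lambda>n. G n s) \<longlonglongrightarrow> \<gamma> s" if s: "s \<in> I" for s
  proof -
    have "summable (\<lambda>n. (1/2) ^ n * E s)"
      by (intro summable_mult2 summable_geometric) simp
    then have "summable (\<lambda>n. G (Suc n) s - G n s)"
      by (rule summable_comparison_test'[where N = 0]) (use step s in auto)
    then have "convergent (\<lambda>n. \<Sum>k<n. G (Suc k) s - G k s)" by (simp add: summable_iff_convergent)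
    then have "convergent (\<lambda>n. (\<Sum>k<n. G (Suc k) s - G k s) + G 0 s)"
      by (intro convergent_add convergent_const)
    then have "convergent (\<lambda>n. G n s)"
      using sum_lessThan_telescope[of "\<lambda>k. G k s"] by (simp del: sum_subtractf)
    then show ?thesis by (simp add: \<gamma>_def convergent_LIMSEQ_iff)
  qed
  have "solves_on I b \<gamma>"
    unfolding solves_on_def
  proof (intro allI impI, elim conjE)
    fix c d assume cd: "c \<in> I" "d \<in> I" "c \<le> d"
    let ?f = "\<lambda>n \<tau>. b \<tau> (G n \<tau>)" and ?g = "\<lambda>\<tau>. 2 * (\<beta> \<tau> * E \<tau>)"
    have sub: "{c..d} \<subseteq> I" using time_subset cd by auto
    have g: "?g integrable_on {c..d}"
      using \<beta>E[OF cd(1,2)] by (intro integrable_on_mult_right set_lebesgue_integral_eq_integral(1))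
    have fn: "?f n integrable_on {c..d}" for n by (intro set_lebesgue_integral_eq_integral(1) fi cd)
    have fle: "norm (?f n \<tau>) \<le> ?g \<tau>" if "\<tau> \<in> {c..d}" for n \<tau>
      using growth inv[of n] sub that by auto
    have flim: "(\<lambda>n. ?f n \<tau>) \<longlonglongrightarrow> b \<tau> (\<gamma> \<tau>)" if "\<tau> \<in> {c..d}" for \<tau>
    proof -
      have "(\<lambda>n. L \<tau> * norm (G n \<tau> - \<gamma> \<tau>)) \<longlonglongrightarrow> L \<tau> * 0"
        using conv[of \<tau>] sub that by (intro tendsto_mult tendsto_const tendsto_norm_zero LIM_zero) auto
      then have null: "(\<lambda>n. L \<tau> * norm (G n \<tau> - \<gamma> \<tau>)) \<longlonglongrightarrow> 0" by simp
      have "\<forall>\<^sub>F n in sequentially. norm (?f n \<tau> - b \<tau> (\<gamma> \<tau>)) \<le> L \<tau> * norm (G n \<tau> - \<gamma> \<tau>)"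
        using b_lipschitz by simp
      from LIM_zero_cancel[OF Lim_null_comparison[OF this null]] show ?thesis .
    qed
    note dc = dominated_convergence[OF fn g fle flim]
    have "norm (b \<tau> (\<gamma> \<tau>)) \<le> ?g \<tau>" if "\<tau> \<in> {c..d}" for \<tau>
      using Lim_bounded[OF tendsto_norm[OF flim[OF that]], of 0] fle[OF that] by auto
    then have "(\<lambda>\<tau>. b \<tau> (\<gamma> \<tau>)) absolutely_integrable_on {c..d}"
      by (rule absolutely_integrable_integrable_bound[OF _ dc(1) g])
    moreover have "G (Suc n) d - G (Suc n) c = integral {c..d} (?f n)" for n
      using J_diff[OF fi cd, of n] by (simp add: GS)
    then have "(\<lambda>n. G (Suc n) d - G (Suc n) c) \<longlonglongrightarrow> integral {c..d} (\<lambda>\<tau>. b \<tau> (\<gamma> \<tau>))"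
      using dc(2) by simp
    moreover have "(\<lambda>n. G (Suc n) d - G (Suc n) c) \<longlonglongrightarrow> \<gamma> d - \<gamma> c"
      using conv cd by (intro tendsto_diff LIMSEQ_Suc) auto
    ultimately show "(\<lambda>\<tau>. b \<tau> (\<gamma> \<tau>)) absolutely_integrable_on {c..d} \<and> \<gamma> d - \<gamma> c = integral {c..d} (\<lambda>\<tau>. b \<tau> (\<gamma> \<tau>))"
      using LIMSEQ_unique by blast
  qed
  moreover have "G n t = x" for n by (cases n) (simp_all add: G0 GS)
  then have "\<gamma> t = x" by (simp add: \<gamma>_def)
  ultimately show ?thesis by blast
qed

end


section \<open>Mollified Sobolev fields are integrable in time and Lipschitz in space\<close>

text \<open>For finite exponents this is Young's inequality in the form \<open>x \<le> N + N\<^sup>1\<^sup>-\<^sup>r x\<^sup>r\<close>, integrated with \<open>N\<close> the norm of \<open>g\<close>. As a crude form of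
  Hoelder's inequality it gives local integrability, with one bound for all exponents.\<close>

lemma nn_integral_le_Lp_norm:
  fixes g :: "'a \<Rightarrow> ennreal"
  assumes p: "1 \<le> p" and g: "g \<in> borel_measurable M" and A: "A \<in> sets M"
  shows "(\<integral>\<^sup>+ z\<in>A. g z \<partial>M) \<le> (emeasure M A + 1) * Lp_norm p M g"
proof (cases "p = \<infinity>")
  case True
  have "(\<integral>\<^sup>+ z\<in>A. g z \<partial>M) \<le> (\<integral>\<^sup>+ z. esssup M g * indicator A z \<partial>M)"
    by (rule nn_integral_mono_AE) (use esssup_AE[of g M] in \<open>auto simp: indicator_def\<close>)
  also have "\<dots> = esssup M g * emeasure M A" using A by (rule nn_integral_cmult_indicator)
  also have "\<dots> \<le> (emeasure M A + 1) * esssup M g"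
    by (subst mult.commute, rule mult_right_mono) auto
  finally show ?thesis using True by (simp add: Lp_norm_def)
next
  case False
  define r where "r = enn2real p"
  have r: "1 \<le> r" using p False unfolding r_def
    by (metis enn2real_1 enn2real_mono infinity_ennreal_def top.not_eq_extremum)
  let ?I = "\<integral>\<^sup>+ z. ennreal_powr (g z) r \<partial>M"
  have gr: "(\<lambda>z. ennreal_powr (g z) r) \<in> borel_measurable M"
    unfolding ennreal_powr_def using g by measurable
  have Lp: "Lp_norm p M g = ennreal_powr ?I (1 / r)" using False by (simp add: Lp_norm_def r_def)
  consider "?I = \<infinity>" | "?I = 0" | "?I \<noteq> \<infinity>" "?I \<noteq> 0" by blast
  then show ?thesis
  proof cases
    case 1
    then have "Lp_norm p M g = \<infinity>" unfolding Lp by (simp add: ennreal_powr_def)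
    then show ?thesis by (simp add: ennreal_mult_top)
  next
    case 2
    then have "AE z in M. ennreal_powr (g z) r = 0" using nn_integral_0_iff_AE[OF gr] by simp
    moreover have "x = 0" if "ennreal_powr x r = 0" for x
      using that by (cases x) (auto simp: ennreal_powr_def ennreal_eq_0_iff split: if_splits simp flip: not_less)
    ultimately have "AE z in M. g z * indicator A z = 0" by (auto elim!: eventually_mono)
    then have "(\<integral>\<^sup>+ z\<in>A. g z \<partial>M) = (\<integral>\<^sup>+ z. 0 \<partial>M)" by (intro nn_integral_cong_AE) auto
    then show ?thesis by simp
  next
    case 3
    then obtain i where i: "?I = ennreal i" "0 < i"
      by (cases ?I) (auto simp: less_le)
    define N where "N = i powr (1 / r)"
    have N: "0 < N" "N powr r = i" using i r by (auto simp: N_def powr_powr)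
    have LpN: "Lp_norm p M g = ennreal N" unfolding Lp i(1) using i by (simp add: ennreal_powr_def N_def)
    have young: "x \<le> ennreal N + ennreal (N powr (1 - r)) * ennreal_powr x r" for x
    proof (cases x)
      case (real a)
      have "a \<le> N + N powr (1 - r) * a powr r"
      proof (cases "a \<le> N")
        case True then show ?thesis by (simp add: add_increasing2)
      next
        case False
        then have "(a / N) powr 1 \<le> (a / N) powr r" using N r by (intro powr_mono) auto
        then have "a \<le> N * (a / N) powr r" using N False by (simp add: field_simps)
        also have "\<dots> = N powr (1 - r) * a powr r"
          using N False by (simp add: powr_divide powr_diff)
        finally show ?thesis using N by simp
      qed
      then show ?thesis using real N
        by (simp add: ennreal_powr_def ennreal_mult'[symmetric] ennreal_plus[symmetric] del: ennreal_plus)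
    next
      case top
      then show ?thesis using N by (simp add: ennreal_powr_def ennreal_mult_top)
    qed
    have "(\<integral>\<^sup>+ z\<in>A. g z \<partial>M)
        \<le> (\<integral>\<^sup>+ z. ennreal N * indicator A z + ennreal (N powr (1 - r)) * ennreal_powr (g z) r \<partial>M)"
      by (rule nn_integral_mono) (use young in \<open>auto simp: indicator_def\<close>)
    also have "\<dots> = ennreal N * emeasure M A + ennreal (N powr (1 - r)) * ?I"
      using A gr by (simp add: nn_integral_add nn_integral_cmult nn_integral_cmult_indicator)
    also have "ennreal (N powr (1 - r)) * ?I = ennreal N"
      unfolding i(1) using N i(2) by (simp add: ennreal_mult'[symmetric] powr_diff)
    finally show ?thesis unfolding LpN by (simp add: distrib_left mult.commute)
  qed
qed

lemma lebesgue_ex_borel_measurable: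
  fixes f :: "'a::euclidean_space \<Rightarrow> 'b::euclidean_space"
  assumes "f \<in> borel_measurable lebesgue"
  shows "\<exists>g\<in>borel_measurable borel. AE z in lborel. f z = g z"
proof -
  have "\<exists>g\<in>borel_measurable lborel. AE z in lborel. f z \<bullet> i = g z" for i
    using assms by (intro completion_ex_borel_measurable_real borel_measurable_inner) auto
  then obtain g where g: "\<And>i. g i \<in> borel_measurable lborel" "\<And>i. AE z in lborel. f z \<bullet> i = g i z" by metis
  show ?thesis
  proof
    show "(\<lambda>z. \<Sum>i\<in>Basis. g i z *\<^sub>R i) \<in> borel_measurable borel" using g(1) by simp
    have "AE z in lborel. \<forall>i\<in>Basis. f z \<bullet> i = g i z" using g(2) by (intro AE_finite_allI) auto
    then show "AE z in lborel. f z = (\<Sum>i\<in>Basis. g i z *\<^sub>R i)"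
      by eventually_elim (metis (no_types, lifting) euclidean_representation sum.cong)
  qed
qed

lemma AE_lborel_pair:
  fixes P :: "'a::euclidean_space \<times> 'b::euclidean_space \<Rightarrow> bool"
  assumes "AE z in lborel. P z"
  shows "AE t in lborel. AE x in lborel. P (t, x)"
  by (rule lborel_pair.AE_pair) (use assms in \<open>simp only: lborel_prod\<close>)

text \<open>The difference quotients are bounded by the averages of \<open>A\<close> over balls of the fixed radius \<open>\<epsilon>\<close>, and these by the
  norm of \<open>A\<close>. With \<open>K\<close> independent of the field, this makes the Lipschitz constant integrable in time.\<close>

lemma convolve_lipschitz_Lp:
  fixes \<phi> :: "real^'n \<Rightarrow> real"
  assumes \<phi>: "mollifier \<phi>" and B: "0 \<le> B" "\<And>x. \<phi> x \<le> B" and \<epsilon>: "0 < \<epsilon>" and p: "1 \<le> p"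
  obtains K where "0 < K" "\<And>v A x y. weak_gradient v A \<Longrightarrow>
    ennreal (norm (convolve \<phi> v \<epsilon> x - convolve \<phi> v \<epsilon> y) / norm (x - y)) \<le>
      ennreal K * Lp_norm p lebesgue (\<lambda>x. ennreal (norm (A x)))"
proof
  let ?\<omega> = "measure lborel (ball (0::real^'n) 1)"
  define c where "c = CARD('n) * B * ?\<omega>"
  define d where "d = ?\<omega> * \<epsilon> ^ CARD('n)"
  have d: "0 < d" using unit_ball_pos[where 'a = "real^'n"] \<epsilon> by (simp add: d_def)
  have c: "0 \<le> c" using B(1) by (simp add: c_def)
  show "0 < (c + 1) * ((d + 1) / d)" using c d by simp
  fix v :: "real^'n \<Rightarrow> real^'n" and A and x y :: "real^'n" assume wg: "weak_gradient v A"
  let ?g = "\<lambda>x. ennreal (norm (A x))"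
  let ?L = "Lp_norm p lebesgue ?g"
  have gm: "?g \<in> borel_measurable lebesgue"
    using borel_measurable_loc_integrable[of A] wg by (simp add: weak_gradient_def)
  have avg: "average (ball z \<epsilon>) ?g \<le> ennreal ((d + 1) / d) * ?L" for z :: "real^'n"
  proof -
    have "average (ball z \<epsilon>) ?g \<le> (ennreal d + 1) * ?L / ennreal d"
      using nn_integral_le_Lp_norm[OF p gm, of "ball z \<epsilon>"] emeasure_ball_scale[of \<epsilon> z] \<epsilon>
      by (auto simp: average_def d_def intro!: divide_right_mono_ennreal)
    also have "(ennreal d + 1) = ennreal (d + 1)" using d by (simp add: ennreal_plus[symmetric] del: ennreal_plus flip: ennreal_1)
    also have "ennreal (d + 1) * ?L / ennreal d = ennreal ((d + 1) / d) * ?L"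
      using d by (simp add: divide_ennreal[symmetric] ennreal_divide_times ennreal_times_divide)
    finally show ?thesis .
  qed
  show "ennreal (norm (convolve \<phi> v \<epsilon> x - convolve \<phi> v \<epsilon> y) / norm (x - y)) \<le> ennreal ((c + 1) * ((d + 1) / d)) * ?L"
  proof (cases ?L)
    case (real l)
    have m: "average (ball z \<epsilon>) ?g \<le> ennreal ((d + 1) / d * l)" for z :: "real^'n"
      using avg[of z] unfolding real(2) ennreal_mult''[OF real(1), symmetric] .
    have "norm (convolve \<phi> v \<epsilon> x - convolve \<phi> v \<epsilon> y) \<le> c * (norm (x - y) + \<bar>\<epsilon> - \<epsilon>\<bar>) * ((d + 1) / d * l)"
      unfolding c_def using m d real by (intro convolve_diff_le[OF \<phi> B wg \<epsilon> \<epsilon>]) auto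
    then have "norm (convolve \<phi> v \<epsilon> x - convolve \<phi> v \<epsilon> y) / norm (x - y) \<le> c * ((d + 1) / d * l)"
      using c d real by (cases "x = y") (auto simp: divide_le_eq mult_ac)
    also have "\<dots> \<le> (c + 1) * ((d + 1) / d * l)"
      using d real by (intro mult_right_mono) auto
    also have "\<dots> = (c + 1) * ((d + 1) / d) * l" by simp
    finally have "ennreal (norm (convolve \<phi> v \<epsilon> x - convolve \<phi> v \<epsilon> y) / norm (x - y)) \<le> ennreal ((c + 1) * ((d + 1) / d) * l)"
      by (rule ennreal_leI)
    then show ?thesis unfolding real(2) ennreal_mult''[OF real(1), symmetric] .
  next
    case top
    have "0 < (c + 1) * ((d + 1) / d)" using c d by simp
    then have "ennreal ((c + 1) * ((d + 1) / d)) \<noteq> 0" by (simp only: ennreal_eq_0_iff not_le)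
    then show ?thesis unfolding top by (simp only: ennreal_mult_top if_False top_greatest)
  qed
qed

lemma convolve_continuous:
  fixes \<phi> :: "real^'n \<Rightarrow> real"
  assumes \<phi>: "mollifier \<phi>" and \<epsilon>: "0 < \<epsilon>" and wg: "weak_gradient v A"
  shows "continuous_on UNIV (convolve \<phi> v \<epsilon>)"
proof -
  obtain B where B: "0 \<le> B" "\<And>x. \<phi> x \<le> B" using mollifier_bounded[OF \<phi>] by blast
  let ?\<omega> = "measure lborel (ball (0::real^'n) 1)"
  have "isCont (convolve \<phi> v \<epsilon>) x" for x
  proof -
    let ?g = "\<lambda>y. ennreal (norm (A y))"
    have "A absolutely_integrable_on cball x (\<epsilon> + 1)"
      using wg by (simp add: weak_gradient_def loc_integrable_def)
    then have "(\<integral>\<^sup>+ y. ennreal (norm (indicator (cball x (\<epsilon> + 1)) y *\<^sub>R A y)) \<partial>lebesgue) < \<infinity>"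
      unfolding set_integrable_def integrable_iff_bounded by simp
    then obtain a where a: "0 \<le> a" "(\<integral>\<^sup>+ y. ennreal (norm (indicator (cball x (\<epsilon> + 1)) y *\<^sub>R A y)) \<partial>lebesgue) = ennreal a"
      using less_top_ennreal by auto
    define d where "d = ?\<omega> * \<epsilon> ^ CARD('n)"
    have d: "0 < d" using unit_ball_pos[where 'a = "real^'n"] \<epsilon> by (simp add: d_def)
    have avg: "average (ball z \<epsilon>) ?g \<le> ennreal (a / d)" if "norm (z - x) \<le> 1" for z :: "real^'n"
    proof -
      have "(\<integral>\<^sup>+ y\<in>ball z \<epsilon>. ?g y \<partial>lebesgue) \<le> ennreal a"
        unfolding a(2)[symmetric]
      proof (rule nn_integral_mono)
        fix y
        have "y \<in> cball x (\<epsilon> + 1)" if "y \<in> ball z \<epsilon>"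
          using that \<open>norm (z - x) \<le> 1\<close> dist_triangle[of x y z] by (simp add: dist_norm norm_minus_commute)
        then show "?g y * indicator (ball z \<epsilon>) y \<le> ennreal (norm (indicator (cball x (\<epsilon> + 1)) y *\<^sub>R A y))"
          by (auto simp: indicator_def)
      qed
      then have "average (ball z \<epsilon>) ?g \<le> ennreal a / ennreal d"
        using emeasure_ball_scale[of \<epsilon> z] \<epsilon> by (simp add: average_def d_def divide_right_mono_ennreal)
      then show ?thesis by (simp add: divide_ennreal[OF a(1) d])
    qed
    have bound: "norm (convolve \<phi> v \<epsilon> y - convolve \<phi> v \<epsilon> x) \<le> CARD('n) * B * ?\<omega> * (a / d) * norm (y - x)"
      if y: "norm (y - x) \<le> 1" for y
    proof -
      have "norm (convolve \<phi> v \<epsilon> y - convolve \<phi> v \<epsilon> x) \<le> CARD('n) * B * ?\<omega> * (norm (y - x) + \<bar>\<epsilon> - \<epsilon>\<bar>) * (a / d)"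
      proof (rule convolve_diff_le[OF \<phi> B wg \<epsilon> \<epsilon>])
        fix \<theta> :: real assume "0 \<le> \<theta>" "\<theta> \<le> 1"
        then have "\<theta> * norm (y - x) \<le> 1 * 1" using y by (intro mult_mono) auto
        then show "average (ball (x + \<theta> *\<^sub>R (y - x)) (\<epsilon> + \<theta> * (\<epsilon> - \<epsilon>))) ?g \<le> ennreal (a / d)"
          using avg[of "x + \<theta> *\<^sub>R (y - x)"] \<open>0 \<le> \<theta>\<close> by simp
      qed (use a d in auto)
      then show ?thesis by (simp add: mult_ac)
    qed
    have "((\<lambda>y. convolve \<phi> v \<epsilon> y - convolve \<phi> v \<epsilon> x) \<longlongrightarrow> 0) (at x)"
    proof (rule Lim_null_comparison)
      have "\<forall>\<^sub>F y in at x. dist y x < 1" by (rule eventually_at_ball'[THEN eventually_mono]) (auto simp: dist_commute)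
      then show "\<forall>\<^sub>F y in at x. norm (convolve \<phi> v \<epsilon> y - convolve \<phi> v \<epsilon> x)
          \<le> CARD('n) * B * ?\<omega> * (a / d) * norm (y - x)"
        by eventually_elim (rule bound, simp add: dist_norm)
      show "((\<lambda>y. CARD('n) * B * ?\<omega> * (a / d) * norm (y - x)) \<longlongrightarrow> 0) (at x)"
        by (intro tendsto_mult_right_zero tendsto_norm_zero LIM_zero) (rule tendsto_ident_at)
    qed
    then show ?thesis by (simp add: isCont_def LIM_zero_cancel)
  qed
  then show ?thesis by (simp add: continuous_at_imp_continuous_on)
qed


lemma ex_null_set_of_AE:
  assumes "AE t in lborel. P t"
  obtains N where "N \<in> null_sets lborel" "\<And>t. t \<notin> N \<Longrightarrow> P t"
  using assms by (auto simp: eventually_ae_filter)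

text \<open>Mollification in space removes null sets: a Borel representative of \<open>u\<close> on space-time agrees with \<open>u t\<close> almost
  everywhere for almost every \<open>t\<close>, and then its mollification agrees with that of \<open>u t\<close> everywhere.\<close>

lemma mollified_field_representative:
  fixes \<phi> :: "real^'n \<Rightarrow> real" and u :: "real \<Rightarrow> real^'n \<Rightarrow> real^'n"
  assumes \<phi>: "mollifier \<phi>" and \<epsilon>: "0 < \<epsilon>" and Su: "L1loc_W1p S T p u G"
  obtains b where "(\<lambda>(t, x). b t x) \<in> borel_measurable borel"
    and "AE t in lborel. t \<in> einterval S T \<longrightarrow>
      weak_gradient (u t) (G t) \<and> b t = mollify \<phi> u \<epsilon> t \<and> b t = convolve \<phi> (u t) \<epsilon>"
    and "\<And>c d. {c..d} \<subseteq> einterval S T \<Longrightarrow> (\<integral>\<^sup>+ t\<in>{c..d}. ennreal (norm (b t 0)) \<partial>lborel) < \<infinity>"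
proof -
  let ?I = "einterval S T"
  have uloc: "loc_integrable (spacetime S T) (\<lambda>(t, x). u t x)"
    and wgAE: "AE t in lebesgue_on ?I. weak_gradient (u t) (G t)"
    using Su by (auto simp: L1loc_W1p_def)
  let ?f = "\<lambda>z. indicator (spacetime S T) z *\<^sub>R (case z of (t, x) \<Rightarrow> u t x)"
  have "open (spacetime S T)" by (intro open_Times einterval_facts) simp
  then have "?f \<in> borel_measurable lebesgue" by (rule borel_measurable_loc_integrable_on[OF uloc])
  then obtain g where g[measurable]: "g \<in> borel_measurable borel" and fg: "AE z in lborel. ?f z = g z"
    using lebesgue_ex_borel_measurable by blast
  have "AE t in lborel. AE x in lborel. ?f (t, x) = g (t, x)" by (rule AE_lborel_pair[OF fg])
  moreover have "AE t in lborel. t \<in> ?I \<longrightarrow> weak_gradient (u t) (G t)"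
  proof -
    have "AE t in lebesgue. t \<in> ?I \<longrightarrow> weak_gradient (u t) (G t)"
      using wgAE by (subst (asm) AE_restrict_space_iff) (auto simp: lmeasurable_open einterval_facts)
    then show ?thesis by (simp add: AE_completion_iff)
  qed
  ultimately have good: "AE t in lborel. t \<in> ?I \<longrightarrow> weak_gradient (u t) (G t) \<and> (AE x in lborel. u t x = g (t, x))"
    by eventually_elim (auto simp: indicator_def)
  define b where "b t x = (LINT y|lborel. rescale \<phi> \<epsilon> (x - y) *\<^sub>R g (t, y))" for t x
  have kcont: "continuous_on UNIV \<phi>" using mollifier_C_k[OF \<phi>, of 0] by simp
  have \<phi>m[measurable]: "\<phi> \<in> borel_measurable borel" using kcont by (rule borel_measurable_continuous_onI)
  have res[measurable]: "rescale \<phi> \<epsilon> \<in> borel_measurable borel" unfolding rescale_def[abs_def] by measurable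
  have bm: "(\<lambda>(t, x). b t x) \<in> borel_measurable borel"
  proof -
    have "(\<lambda>(z, y). rescale \<phi> \<epsilon> (snd z - y) *\<^sub>R g (fst z, y)) \<in> borel_measurable (borel \<Otimes>\<^sub>M lborel)"
      unfolding borel_prod[symmetric] by measurable
    from lborel.borel_measurable_lebesgue_integral[OF this]
    show ?thesis by (simp add: b_def split_def)
  qed
  have bconv: "b t = mollify \<phi> u \<epsilon> t \<and> b t = convolve \<phi> (u t) \<epsilon>"
    if "weak_gradient (u t) (G t)" "AE x in lborel. u t x = g (t, x)" for t
  proof -
    have um: "u t \<in> borel_measurable lebesgue"
      using that(1) borel_measurable_loc_integrable by (auto simp: weak_gradient_def)
    have "b t x = convolve \<phi> (u t) \<epsilon> x" for x
    proof -
      have gm: "(\<lambda>y. rescale \<phi> \<epsilon> (x - y) *\<^sub>R g (t, y)) \<in> borel_measurable lborel" by measurable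
      have "b t x = (LINT y|lebesgue. rescale \<phi> \<epsilon> (x - y) *\<^sub>R g (t, y))"
        unfolding b_def by (rule integral_completion[OF gm, symmetric])
      also have "\<dots> = convolve \<phi> (u t) \<epsilon> x"
        unfolding convolve_def
      proof (rule integral_cong_AE)
        show "(\<lambda>y. rescale \<phi> \<epsilon> (x - y) *\<^sub>R g (t, y)) \<in> borel_measurable lebesgue"
          using gm by (simp add: measurable_completion)
        have "(\<lambda>y. rescale \<phi> \<epsilon> (x - y)) \<in> borel_measurable lborel" by measurable
        then show "(\<lambda>y. rescale \<phi> \<epsilon> (x - y) *\<^sub>R u t y) \<in> borel_measurable lebesgue"
          using um by (rule borel_measurable_scaleR[OF measurable_completion])
        show "AE y in lebesgue. rescale \<phi> \<epsilon> (x - y) *\<^sub>R g (t, y) = rescale \<phi> \<epsilon> (x - y) *\<^sub>R u t y"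
          using AE_completion[OF that(2)] by eventually_elim simp
      qed
      finally show ?thesis .
    qed
    then show ?thesis using mollify_eq_convolve[OF \<phi>, of u t, OF um] by (simp add: fun_eq_iff)
  qed
  have bAE: "AE t in lborel. t \<in> ?I \<longrightarrow> weak_gradient (u t) (G t) \<and> b t = mollify \<phi> u \<epsilon> t \<and> b t = convolve \<phi> (u t) \<epsilon>"
    using good by eventually_elim (use bconv in blast)
  obtain B where B: "0 \<le> B" "\<And>x. \<phi> x \<le> B" using mollifier_bounded[OF \<phi>] by blast
  have b0: "(\<integral>\<^sup>+ t\<in>{c..d}. ennreal (norm (b t 0)) \<partial>lborel) < \<infinity>" if cd: "{c..d} \<subseteq> ?I" for c d
  proof -
    let ?K = "{c..d} \<times> cball (0::real^'n) \<epsilon>"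
    let ?k = "(1 / \<epsilon>) ^ CARD('n) * B"
    have k0: "0 \<le> ?k" using B \<epsilon> by simp
    have [measurable]: "cball (0::real^'n) \<epsilon> \<in> sets borel" by simp
    have "ennreal (norm (b t 0)) \<le> ennreal ?k * (\<integral>\<^sup>+ y. ennreal (norm (g (t, y))) * indicator (cball 0 \<epsilon>) y \<partial>lborel)" for t
    proof -
      have "ennreal (norm (b t 0)) \<le> (\<integral>\<^sup>+ y. ennreal (norm (rescale \<phi> \<epsilon> (0 - y) *\<^sub>R g (t, y))) \<partial>lborel)"
        unfolding b_def
      proof (cases "integrable lborel (\<lambda>y. rescale \<phi> \<epsilon> (0 - y) *\<^sub>R g (t, y))")
        case True
        then show "ennreal (norm (LINT y|lborel. rescale \<phi> \<epsilon> (0 - y) *\<^sub>R g (t, y)))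
            \<le> (\<integral>\<^sup>+ y. ennreal (norm (rescale \<phi> \<epsilon> (0 - y) *\<^sub>R g (t, y))) \<partial>lborel)"
          by (rule integral_norm_bound_ennreal)
      next
        case False
        then show "ennreal (norm (LINT y|lborel. rescale \<phi> \<epsilon> (0 - y) *\<^sub>R g (t, y)))
            \<le> (\<integral>\<^sup>+ y. ennreal (norm (rescale \<phi> \<epsilon> (0 - y) *\<^sub>R g (t, y))) \<partial>lborel)"
          using not_integrable_integral_eq[OF False] by (simp only: norm_zero ennreal_0 zero_le)
      qed
      also have "\<dots> \<le> (\<integral>\<^sup>+ y. ennreal ?k * (ennreal (norm (g (t, y))) * indicator (cball 0 \<epsilon>) y) \<partial>lborel)"
      proof (rule nn_integral_mono)
        fix y
        show "ennreal (norm (rescale \<phi> \<epsilon> (0 - y) *\<^sub>R g (t, y))) \<le> ennreal ?k * (ennreal (norm (g (t, y))) * indicator (cball 0 \<epsilon>) y)"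
        proof (cases "norm y \<le> \<epsilon>")
          case True
          have "rescale \<phi> \<epsilon> (0 - y) \<le> ?k" unfolding rescale_def using B(2) \<epsilon> by (intro mult_left_mono) auto
          then have "norm (rescale \<phi> \<epsilon> (0 - y) *\<^sub>R g (t, y)) \<le> ?k * norm (g (t, y))"
            using rescale_nonneg[OF \<phi> \<epsilon>, of "0 - y"] by (simp add: mult_right_mono)
          then have "ennreal (norm (rescale \<phi> \<epsilon> (0 - y) *\<^sub>R g (t, y))) \<le> ennreal (?k * norm (g (t, y)))" by (rule ennreal_leI)
          then show ?thesis using True k0 by (simp add: ennreal_mult'' dist_norm)
        next
          case False
          then show ?thesis using rescale_support[OF \<phi> \<epsilon>, of "0 - y"] by simp
        qed
      qed
      also have "\<dots> = ennreal ?k * (\<integral>\<^sup>+ y. ennreal (norm (g (t, y))) * indicator (cball 0 \<epsilon>) y \<partial>lborel)"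
        by (rule nn_integral_cmult) measurable
      finally show ?thesis .
    qed
    then have "(\<integral>\<^sup>+ t\<in>{c..d}. ennreal (norm (b t 0)) \<partial>lborel)
        \<le> (\<integral>\<^sup>+ t. ennreal ?k * (\<integral>\<^sup>+ y. ennreal (norm (g (t, y))) * indicator ?K (t, y) \<partial>lborel) \<partial>lborel)"
      by (intro nn_integral_mono) (auto simp: indicator_def)
    also have "\<dots> = ennreal ?k * (\<integral>\<^sup>+ t. (\<integral>\<^sup>+ y. ennreal (norm (g (t, y))) * indicator ?K (t, y) \<partial>lborel) \<partial>lborel)"
    proof (rule nn_integral_cmult, rule lborel.borel_measurable_nn_integral)
      have "?K \<in> sets borel" by (intro borel_closed closed_Times) auto
      then have "(\<lambda>z. ennreal (norm (g z)) * indicator ?K z) \<in> borel_measurable borel" by measurable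
      then show "(\<lambda>(t, y). ennreal (norm (g (t, y))) * indicator ?K (t, y)) \<in> borel_measurable (lborel \<Otimes>\<^sub>M lborel)"
        by (simp add: lborel_prod split_def)
    qed
    also have "(\<integral>\<^sup>+ t. (\<integral>\<^sup>+ y. ennreal (norm (g (t, y))) * indicator ?K (t, y) \<partial>lborel) \<partial>lborel)
        = (\<integral>\<^sup>+ z. ennreal (norm (g z)) * indicator ?K z \<partial>lborel)"
    proof -
      have "?K \<in> sets borel" by (intro borel_closed closed_Times) auto
      then have "(\<lambda>z. ennreal (norm (g z)) * indicator ?K z) \<in> borel_measurable (lborel \<Otimes>\<^sub>M lborel)"
        by (simp add: lborel_prod)
      from lborel.nn_integral_fst[OF this] show ?thesis by (simp add: lborel_prod)
    qed
    also have "\<dots> = (\<integral>\<^sup>+ z. ennreal (norm (indicator ?K z *\<^sub>R (case z of (t, x) \<Rightarrow> u t x))) \<partial>lebesgue)"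
    proof -
      have "(\<integral>\<^sup>+ z. ennreal (norm (g z)) * indicator ?K z \<partial>lborel) = (\<integral>\<^sup>+ z. ennreal (norm (g z)) * indicator ?K z \<partial>lebesgue)"
        by (rule nn_integral_completion[symmetric])
      also have "\<dots> = (\<integral>\<^sup>+ z. ennreal (norm (indicator ?K z *\<^sub>R (case z of (t, x) \<Rightarrow> u t x))) \<partial>lebesgue)"
      proof (rule nn_integral_cong_AE)
        show "AE z in lebesgue. ennreal (norm (g z)) * indicator ?K z = ennreal (norm (indicator ?K z *\<^sub>R (case z of (t, x) \<Rightarrow> u t x)))"
          using AE_completion[OF fg]
        proof eventually_elim
          case (elim z)
          show ?case using elim[symmetric] cd by (auto simp: indicator_def split: prod.splits)
        qed
      qed
      finally show ?thesis .
    qed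
    also have "ennreal ?k * \<dots> < \<infinity>"
    proof -
      have "compact ?K" by (intro compact_Times) auto
      moreover have "?K \<subseteq> spacetime S T" using cd by auto
      ultimately have "(\<lambda>(t, x). u t x) absolutely_integrable_on ?K"
        using uloc by (simp add: loc_integrable_def)
      then show ?thesis
        unfolding set_integrable_def integrable_iff_bounded by (simp add: ennreal_mult_less_top)
    qed
    finally show ?thesis .
  qed
  show thesis by (rule that[OF bm bAE b0])
qed

lemma compact_interval_of_ends:
  "c \<in> einterval S T \<Longrightarrow> d \<in> einterval S T \<Longrightarrow> {c..d} \<subseteq> einterval S T"
  using einterval_facts(2) by (meson atLeastAtMost_iff mem_is_interval_1_I subsetI)

lemma mollified_field_caratheodory:
  fixes \<phi> :: "real^'n \<Rightarrow> real" and u :: "real \<Rightarrow> real^'n \<Rightarrow> real^'n"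
  assumes \<phi>: "mollifier \<phi>" and \<epsilon>: "0 < \<epsilon>" and p: "1 \<le> p" and Su: "L1loc_W1p S T p u G"
  obtains b L N where "caratheodory_field (einterval S T) b L" "negligible N"
    and "\<And>t x. t \<in> einterval S T - N \<Longrightarrow> mollify \<phi> u \<epsilon> t x = b t x"
proof -
  let ?I = "einterval S T"
  obtain b where bm[measurable]: "(\<lambda>(t, x). b t x) \<in> borel_measurable borel"
    and bAE: "AE t in lborel. t \<in> ?I \<longrightarrow> weak_gradient (u t) (G t) \<and> b t = mollify \<phi> u \<epsilon> t \<and> b t = convolve \<phi> (u t) \<epsilon>"
    and b0: "\<And>c d. {c..d} \<subseteq> ?I \<Longrightarrow> (\<integral>\<^sup>+ t\<in>{c..d}. ennreal (norm (b t 0)) \<partial>lborel) < \<infinity>"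
    using mollified_field_representative[OF \<phi> \<epsilon> Su] by blast
  have b_pt: "(\<lambda>t. b t x) \<in> borel_measurable borel" for x
    using measurable_compose[OF _ bm, of "\<lambda>t. (t, x)" borel] by (simp add: borel_measurable_Pair)
  obtain B where B: "0 \<le> B" "\<And>x. \<phi> x \<le> B" using mollifier_bounded[OF \<phi>] by blast
  obtain D :: "((real^'n) \<times> (real^'n)) set" where D: "countable D" "\<And>X. open X \<Longrightarrow> X \<noteq> {} \<Longrightarrow> \<exists>d\<in>D. d \<in> X"
    using countable_dense_exists by blast
  \<comment> \<open>The Lipschitz constant, as a supremum over a countable dense set of pairs in order that it be measurable in time.\<close>
  define q where "q t = (SUP z\<in>D. ennreal (norm (b t (fst z) - b t (snd z)) / norm (fst z - snd z)))" for t
  have qm[measurable]: "q \<in> borel_measurable borel"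
    unfolding q_def[abs_def] using b_pt
    by (intro borel_measurable_SUP D(1) measurable_compose[OF _ measurable_ennreal] borel_measurable_divide
        borel_measurable_norm borel_measurable_diff) auto
  obtain K where K: "0 < K" and qK: "\<And>v A x y. weak_gradient v A \<Longrightarrow>
      ennreal (norm (convolve \<phi> v \<epsilon> x - convolve \<phi> v \<epsilon> y) / norm (x - y)) \<le>
      ennreal K * Lp_norm p lebesgue (\<lambda>x. ennreal (norm (A x)))"
    using convolve_lipschitz_Lp[OF \<phi> B \<epsilon> p] by blast
  have q_le: "AE t in lborel. t \<in> ?I \<longrightarrow> q t \<le> ennreal K * Lp_norm p lebesgue (\<lambda>x. ennreal (norm (G t x)))"
    using bAE
  proof eventually_elim
    case (elim t)
    show ?case
    proof
      assume "t \<in> ?I"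
      then have wg: "weak_gradient (u t) (G t)" and bc: "b t = convolve \<phi> (u t) \<epsilon>" using elim by auto
      show "q t \<le> ennreal K * Lp_norm p lebesgue (\<lambda>x. ennreal (norm (G t x)))"
        unfolding q_def bc by (rule SUP_least) (rule qK[OF wg])
    qed
  qed
  have q_fin: "(\<integral>\<^sup>+ t\<in>C. q t \<partial>lborel) < \<infinity>" if C: "compact C" "C \<subseteq> ?I" for C
  proof -
    have Cm[measurable]: "C \<in> sets borel" using C(1) by (simp add: borel_compact)
    have fin: "(\<integral>\<^sup>+ t\<in>C. Lp_norm p lebesgue (\<lambda>x. ennreal (norm (G t x))) \<partial>lebesgue) < \<infinity>"
      using Su C by (auto simp: L1loc_W1p_def)
    have "AE t in lebesgue. t \<in> ?I \<longrightarrow> q t \<le> ennreal K * Lp_norm p lebesgue (\<lambda>x. ennreal (norm (G t x)))"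
      by (rule AE_completion[OF q_le])
    \<comment> \<open>The factor \<open>K\<close> is moved to the left because the norm of the gradient enters through a lower integral, of which
      only the monotonicity is used.\<close>
    then have "AE t in lebesgue. ennreal (1 / K) * (q t * indicator C t) \<le> Lp_norm p lebesgue (\<lambda>x. ennreal (norm (G t x))) * indicator C t"
    proof eventually_elim
      case (elim t)
      have 1: "ennreal (1 / K) * ennreal K = 1" using K by (simp add: ennreal_mult'[symmetric])
      show ?case
      proof (cases "t \<in> C")
        case True
        then have "ennreal (1 / K) * q t \<le> ennreal (1 / K) * (ennreal K * Lp_norm p lebesgue (\<lambda>x. ennreal (norm (G t x))))"
          using elim C(2) by (intro mult_left_mono) auto
        also have "\<dots> = Lp_norm p lebesgue (\<lambda>x. ennreal (norm (G t x)))"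
          unfolding mult.assoc[symmetric] 1 by simp
        finally show ?thesis using True by simp
      qed simp
    qed
    from nn_integral_mono_AE[OF this] fin
    have "(\<integral>\<^sup>+ t. ennreal (1 / K) * (q t * indicator C t) \<partial>lebesgue) < \<infinity>" by (rule le_less_trans)
    also have "(\<integral>\<^sup>+ t. ennreal (1 / K) * (q t * indicator C t) \<partial>lebesgue) = (\<integral>\<^sup>+ t. ennreal (1 / K) * (q t * indicator C t) \<partial>lborel)"
      by (rule nn_integral_completion)
    also have "\<dots> = ennreal (1 / K) * (\<integral>\<^sup>+ t\<in>C. q t \<partial>lborel)"
      by (rule nn_integral_cmult) measurable
    finally show ?thesis using K by (auto simp: ennreal_mult_less_top ennreal_eq_0_iff)
  qed
  have q_AE: "AE t in lborel. t \<in> ?I \<longrightarrow> q t < \<infinity>"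
  proof -
    obtain C where C: "\<And>n. compact (C n)" "\<And>n. C n \<subseteq> ?I" "incseq C" "(\<Union>n. C n) = ?I"
      using open_compact_exhaustion[OF einterval_facts(1)] by blast
    have "AE t in lborel. q t * indicator (C n) t \<noteq> \<infinity>" for n
    proof (rule nn_integral_PInf_AE)
      have "C n \<in> sets borel" using C(1) by (simp add: borel_compact)
      then show "(\<lambda>t. q t * indicator (C n) t) \<in> borel_measurable lborel" by measurable
      show "(\<integral>\<^sup>+ t\<in>C n. q t \<partial>lborel) \<noteq> \<infinity>" using q_fin[OF C(1,2)] by (metis less_irrefl)
    qed
    then have "AE t in lborel. \<forall>n. q t * indicator (C n) t \<noteq> \<infinity>" by (simp add: AE_all_countable)
    then show ?thesis
    proof eventually_elim
      case (elim t)
      show ?case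
      proof
        assume "t \<in> ?I"
        then obtain n where "t \<in> C n" using C(4) by blast
        then show "q t < \<infinity>" using elim[rule_format, of n] by (simp add: less_top)
      qed
    qed
  qed
  have "AE t in lborel. t \<in> ?I \<longrightarrow> weak_gradient (u t) (G t) \<and> b t = mollify \<phi> u \<epsilon> t \<and> b t = convolve \<phi> (u t) \<epsilon> \<and> q t < \<infinity>"
    using bAE q_AE by eventually_elim blast
  then obtain N where N: "N \<in> null_sets lborel"
    and good: "\<And>t. t \<notin> N \<Longrightarrow> t \<in> ?I \<longrightarrow> weak_gradient (u t) (G t) \<and> b t = mollify \<phi> u \<epsilon> t \<and> b t = convolve \<phi> (u t) \<epsilon> \<and> q t < \<infinity>"
    using ex_null_set_of_AE by blast
  have Nm: "N \<in> sets borel" using N by auto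
  have Im: "?I \<in> sets borel" by (rule borel_open[OF einterval_facts(1)])
  then have INm[measurable]: "?I - N \<in> sets borel" using Nm by (rule sets.Diff)
  define b' where "b' t x = (if t \<in> ?I - N then b t x else 0)" for t x
  define L where "L t = (if t \<in> ?I - N then enn2real (q t) else 0)" for t
  have lip: "norm (b t x - b t y) \<le> enn2real (q t) * norm (x - y)" if t: "t \<in> ?I - N" for t x y
  proof -
    have wg: "weak_gradient (u t) (G t)" and bc: "b t = convolve \<phi> (u t) \<epsilon>" and fin: "q t < \<infinity>"
      using good[of t] t by auto
    have cont: "continuous_on UNIV (b t)" unfolding bc by (rule convolve_continuous[OF \<phi> \<epsilon> wg])
    let ?Z = "{z :: (real^'n) \<times> (real^'n). norm (b t (fst z) - b t (snd z)) \<le> enn2real (q t) * norm (fst z - snd z)}"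
    have "closed ?Z"
      by (intro closed_Collect_le continuous_intros continuous_on_compose2[OF cont]) auto
    moreover have "D \<subseteq> ?Z"
    proof
      fix z assume z: "z \<in> D"
      have "ennreal (norm (b t (fst z) - b t (snd z)) / norm (fst z - snd z)) \<le> q t"
        unfolding q_def by (rule SUP_upper[OF z])
      then have le: "norm (b t (fst z) - b t (snd z)) / norm (fst z - snd z) \<le> enn2real (q t)"
        using fin by (cases "q t") (auto simp: ennreal_le_iff)
      show "z \<in> ?Z"
      proof (cases "fst z = snd z")
        case False
        then show ?thesis using le by (simp add: divide_le_eq)
      qed simp
    qed
    ultimately have "- ?Z = {}" using D(2)[of "- ?Z"] by blast
    then have "(x, y) \<in> ?Z" by blast
    then show ?thesis by simp
  qed
  have car: "caratheodory_field ?I b' L"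
  proof
    show "open ?I" "is_interval ?I" by (rule einterval_facts)+
    have "(\<lambda>z. if fst z \<in> ?I - N then b (fst z) (snd z) else 0) \<in> borel_measurable (borel \<Otimes>\<^sub>M borel)"
      using bm unfolding split_def borel_prod[symmetric] by measurable
    then show "(\<lambda>(t, x). b' t x) \<in> borel_measurable borel" by (simp add: b'_def split_def borel_prod)
    show "norm (b' t x - b' t y) \<le> L t * norm (x - y)" for t x y
      using lip[of t x y] by (auto simp: b'_def L_def)
    show "0 \<le> L t" for t by (simp add: L_def)
    fix c d assume cd: "c \<in> ?I" "d \<in> ?I"
    have sub: "{c..d} \<subseteq> ?I" by (rule compact_interval_of_ends[OF cd])
    have "(\<lambda>t. indicator {c..d} t *\<^sub>R L t) \<in> borel_measurable lborel"
      unfolding L_def[abs_def] by measurable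
    moreover have "(\<integral>\<^sup>+ t. ennreal (norm (indicator {c..d} t *\<^sub>R L t)) \<partial>lborel) \<le> (\<integral>\<^sup>+ t\<in>{c..d}. q t \<partial>lborel)"
      using good by (intro nn_integral_mono) (auto simp: L_def indicator_def ennreal_enn2real)
    then have "(\<integral>\<^sup>+ t. ennreal (norm (indicator {c..d} t *\<^sub>R L t)) \<partial>lborel) < \<infinity>"
      using q_fin[of "{c..d}"] sub by (auto intro: le_less_trans)
    ultimately have i: "integrable lborel (\<lambda>t. indicator {c..d} t *\<^sub>R L t)" by (rule integrableI_bounded)
    then show "L absolutely_integrable_on {c..d}"
      unfolding set_integrable_def using integrable_completion[OF borel_measurable_integrable[OF i]] i by simp
    have "(\<lambda>t. b' t 0) \<in> borel_measurable borel"
      unfolding b'_def[abs_def] using b_pt by measurable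
    then have "(\<lambda>t. indicator {c..d} t *\<^sub>R b' t 0) \<in> borel_measurable lborel" by measurable
    moreover have "(\<integral>\<^sup>+ t. ennreal (norm (indicator {c..d} t *\<^sub>R b' t 0)) \<partial>lborel) \<le> (\<integral>\<^sup>+ t\<in>{c..d}. ennreal (norm (b t 0)) \<partial>lborel)"
      by (intro nn_integral_mono) (auto simp: b'_def indicator_def)
    then have "(\<integral>\<^sup>+ t. ennreal (norm (indicator {c..d} t *\<^sub>R b' t 0)) \<partial>lborel) < \<infinity>"
      using b0[OF sub] by (rule le_less_trans)
    ultimately have i: "integrable lborel (\<lambda>t. indicator {c..d} t *\<^sub>R b' t 0)" by (rule integrableI_bounded)
    then show "(\<lambda>t. b' t 0) absolutely_integrable_on {c..d}"
      unfolding set_integrable_def using integrable_completion[OF borel_measurable_integrable[OF i]] i by simp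
  qed
  have "negligible N" using N by (simp add: negligible_iff_null_sets null_sets_completionI)
  moreover have "mollify \<phi> u \<epsilon> t x = b' t x" if "t \<in> ?I - N" for t x
    using good[of t] that by (simp add: b'_def)
  ultimately show thesis using that car by blast
qed


section \<open>Tubes around trajectories\<close>

definition tube :: "real set \<Rightarrow> (real \<Rightarrow> 'a::euclidean_space) \<Rightarrow> real \<Rightarrow> (real \<times> 'a) set" where
  "tube J \<gamma> \<rho> = {(s, y). s \<in> J \<and> norm (y - \<gamma> s) < \<rho>}"

lemma open_tube:
  assumes J: "open J" and \<gamma>: "continuous_on J \<gamma>"
  shows "open (tube J \<gamma> \<rho>)"
proof -
  have "open {z \<in> J \<times> UNIV. norm (snd z - \<gamma> (fst z)) < \<rho>}"
  proof -
    have c: "continuous_on (J \<times> UNIV) (\<lambda>z. norm (snd z - \<gamma> (fst z)))"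
      by (intro continuous_intros continuous_on_compose2[OF \<gamma>]) auto
    have "open (J \<times> (UNIV :: 'a set))" using J by (intro open_Times) auto
    from continuous_open_preimage[OF c this open_lessThan[of \<rho>]]
    show ?thesis by (simp add: vimage_def Int_def)
  qed
  also have "{z \<in> J \<times> UNIV. norm (snd z - \<gamma> (fst z)) < \<rho>} = tube J \<gamma> \<rho>" by (auto simp: tube_def)
  finally show ?thesis .
qed

text \<open>By Tonelli's theorem, since every cross section is a ball of the same volume.\<close>

lemma nn_integral_tube:
  fixes \<gamma> :: "real \<Rightarrow> 'a::euclidean_space"
  assumes J: "open J" and \<gamma>: "continuous_on J \<gamma>" and \<rho>: "0 \<le> \<rho>" and m: "m \<in> borel_measurable borel"
  shows "(\<integral>\<^sup>+ z\<in>tube J \<gamma> \<rho>. m (fst z) \<partial>lebesgue)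
    = ennreal (measure lborel (ball (0::'a) 1) * \<rho> ^ DIM('a)) * (\<integral>\<^sup>+ s\<in>J. m s \<partial>lborel)"
proof -
  have [measurable]: "m \<in> borel_measurable borel" by fact
  have Jm[measurable]: "J \<in> sets borel" using J by (rule borel_open)
  have "tube J \<gamma> \<rho> \<in> sets (borel :: (real \<times> 'a) measure)" by (intro borel_open open_tube J \<gamma>)
  then have tm[measurable]: "tube J \<gamma> \<rho> \<in> sets (borel \<Otimes>\<^sub>M borel)" unfolding borel_prod .
  have "(\<lambda>z. m (fst z) * indicator (tube J \<gamma> \<rho>) z) \<in> borel_measurable (borel \<Otimes>\<^sub>M borel)" by measurable
  then have meas: "(\<lambda>z. m (fst z) * indicator (tube J \<gamma> \<rho>) z) \<in> borel_measurable (lborel \<Otimes>\<^sub>M lborel)"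
    by (simp add: lborel_prod borel_prod)
  have "(\<integral>\<^sup>+ z\<in>tube J \<gamma> \<rho>. m (fst z) \<partial>lebesgue) = (\<integral>\<^sup>+ z. m (fst z) * indicator (tube J \<gamma> \<rho>) z \<partial>(lborel \<Otimes>\<^sub>M lborel))"
    by (simp add: nn_integral_completion lborel_prod)
  also have "\<dots> = (\<integral>\<^sup>+ s. \<integral>\<^sup>+ y. m s * indicator (tube J \<gamma> \<rho>) (s, y) \<partial>lborel \<partial>lborel)"
    by (simp add: lborel.nn_integral_fst[OF meas, symmetric])
  also have "\<dots> = (\<integral>\<^sup>+ s. ennreal (measure lborel (ball (0::'a) 1) * \<rho> ^ DIM('a)) * (m s * indicator J s) \<partial>lborel)"
  proof (rule nn_integral_cong)
    fix s
    have "(\<integral>\<^sup>+ y. m s * indicator (tube J \<gamma> \<rho>) (s, y) \<partial>lborel) = (\<integral>\<^sup>+ y. (m s * indicator J s) * indicator (ball (\<gamma> s) \<rho>) y \<partial>lborel)"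
      by (intro nn_integral_cong) (auto simp: tube_def indicator_def dist_norm norm_minus_commute)
    also have "\<dots> = m s * indicator J s * emeasure lborel (ball (\<gamma> s) \<rho>)"
      by (rule nn_integral_cmult_indicator) simp
    finally show "(\<integral>\<^sup>+ y. m s * indicator (tube J \<gamma> \<rho>) (s, y) \<partial>lborel)
        = ennreal (measure lborel (ball (0::'a) 1) * \<rho> ^ DIM('a)) * (m s * indicator J s)"
      using emeasure_ball_scale[OF \<rho>, of "\<gamma> s"] by (simp add: mult.commute)
  qed
  also have "\<dots> = ennreal (measure lborel (ball (0::'a) 1) * \<rho> ^ DIM('a)) * (\<integral>\<^sup>+ s\<in>J. m s \<partial>lborel)"
    by (rule nn_integral_cmult) measurable
  finally show ?thesis .
qed

lemma emeasure_tube: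
  fixes \<gamma> :: "real \<Rightarrow> 'a::euclidean_space"
  assumes J: "open J" and \<gamma>: "continuous_on J \<gamma>" and \<rho>: "0 \<le> \<rho>"
  shows "emeasure lebesgue (tube J \<gamma> \<rho>) = ennreal (measure lborel (ball (0::'a) 1) * \<rho> ^ DIM('a)) * emeasure lborel J"
proof -
  have "tube J \<gamma> \<rho> \<in> sets lebesgue" using open_tube[OF J \<gamma>] by (simp add: lmeasurable_open)
  then have "emeasure lebesgue (tube J \<gamma> \<rho>) = (\<integral>\<^sup>+ z\<in>tube J \<gamma> \<rho>. 1 \<partial>lebesgue)" by simp
  also have "\<dots> = ennreal (measure lborel (ball (0::'a) 1) * \<rho> ^ DIM('a)) * (\<integral>\<^sup>+ s\<in>J. 1 \<partial>lborel)"
    by (rule nn_integral_tube[OF J \<gamma> \<rho>]) simp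
  also have "(\<integral>\<^sup>+ s\<in>J. 1 \<partial>lborel) = emeasure lborel J" using J by simp
  finally show ?thesis .
qed

lemma tube_boundary_null:
  fixes \<gamma> :: "real \<Rightarrow> 'a::euclidean_space"
  assumes J: "open J" and \<gamma>: "continuous_on J \<gamma>"
  shows "{(s, y). s \<in> J \<and> norm (y - \<gamma> s) = \<rho>} \<in> null_sets lebesgue" (is "?B \<in> _")
proof -
  have c: "continuous_on (J \<times> UNIV) (\<lambda>z. norm (snd z - \<gamma> (fst z)))"
    by (intro continuous_intros continuous_on_compose2[OF \<gamma>]) auto
  have JU: "open (J \<times> (UNIV :: 'a set))" using J by (intro open_Times) auto
  have "?B = {z \<in> J \<times> UNIV. norm (snd z - \<gamma> (fst z)) = \<rho>}" by auto
  also have "\<dots> \<in> sets borel"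
  proof -
    have "{z \<in> J \<times> UNIV. norm (snd z - \<gamma> (fst z)) = \<rho>} = J \<times> UNIV - {z \<in> J \<times> UNIV. norm (snd z - \<gamma> (fst z)) \<in> - {\<rho>}}"
      by auto
    moreover have "open {z \<in> J \<times> UNIV. norm (snd z - \<gamma> (fst z)) \<in> - {\<rho>}}"
      using continuous_open_preimage[OF c JU, of "- {\<rho>}"] by (simp add: vimage_def Int_def open_Compl)
    ultimately show ?thesis using JU by auto
  qed
  finally have Bm: "?B \<in> sets (lborel \<Otimes>\<^sub>M lborel)" unfolding lborel_prod by simp
  have "emeasure (lborel \<Otimes>\<^sub>M lborel) ?B = (\<integral>\<^sup>+ s. emeasure lborel (Pair s -` ?B) \<partial>lborel)"
    by (rule lborel.emeasure_pair_measure_alt[OF Bm])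
  also have "\<dots> = (\<integral>\<^sup>+ s. 0 \<partial>(lborel :: real measure))"
  proof (rule nn_integral_cong)
    fix s
    have "Pair s -` ?B \<subseteq> sphere (\<gamma> s) \<rho>" by (auto simp: dist_norm norm_minus_commute)
    moreover have "sphere (\<gamma> s) \<rho> \<in> null_sets lborel"
      using negligible_sphere[of "\<gamma> s" \<rho>] by (simp add: negligible_iff_null_sets null_sets_completion_iff)
    moreover have "Pair s -` ?B \<in> sets lborel" using Bm by (rule sets_Pair1)
    ultimately show "emeasure lborel (Pair s -` ?B) = 0" using null_sets_subset[of "sphere (\<gamma> s) \<rho>" lborel "Pair s -` ?B"] by auto
  qed
  finally have "?B \<in> null_sets (lborel \<Otimes>\<^sub>M lborel)" using Bm by auto
  then show ?thesis by (simp add: lborel_prod null_sets_completionI)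
qed

lemma time_slice_null: "{t} \<times> (UNIV :: 'a::euclidean_space set) \<in> null_sets lebesgue" for t :: real
proof -
  have Bm: "{t} \<times> (UNIV :: 'a set) \<in> sets (lborel \<Otimes>\<^sub>M lborel)" by simp
  have "emeasure (lborel \<Otimes>\<^sub>M lborel) ({t} \<times> (UNIV :: 'a set)) = emeasure lborel {t} * emeasure lborel (UNIV :: 'a set)"
    by (rule lborel.emeasure_pair_measure_Times) auto
  then have "{t} \<times> (UNIV :: 'a set) \<in> null_sets (lborel \<Otimes>\<^sub>M lborel)" using Bm by (intro null_setsI) auto
  then show ?thesis by (simp add: lborel_prod null_sets_completionI)
qed

lemma average_ball_le_maximal:
  fixes g :: "'a::euclidean_space \<Rightarrow> 'b::real_normed_vector"
  assumes r: "0 < r" and k: "0 < k" and sub: "ball a r \<subseteq> ball z (k * r)"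
  shows "average (ball a r) (\<lambda>y. ennreal (norm (g y))) \<le> ennreal (k ^ DIM('a)) * maximal g z"
proof -
  let ?\<omega> = "measure lborel (ball (0::'a) 1)" and ?g = "\<lambda>y. ennreal (norm (g y))"
  have \<omega>: "0 < ?\<omega>" by (rule unit_ball_pos)
  have kr: "0 < k * r" using r k by simp
  have "average (ball a r) ?g \<le> (\<integral>\<^sup>+ y\<in>ball z (k * r). ?g y \<partial>lebesgue) / emeasure lebesgue (ball a r)"
    unfolding average_def using sub
    by (intro divide_right_mono_ennreal nn_integral_mono) (auto simp: indicator_def)
  also have "\<dots> = ennreal (?\<omega> * (k * r) ^ DIM('a)) * average (ball z (k * r)) ?g / ennreal (?\<omega> * r ^ DIM('a))"
    unfolding nn_integral_ball_eq_average[OF kr] emeasure_ball_scale[OF less_imp_le[OF r]] ..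
  also have "\<dots> = ennreal (?\<omega> * (k * r) ^ DIM('a)) / ennreal (?\<omega> * r ^ DIM('a)) * average (ball z (k * r)) ?g"
    by (simp add: ennreal_divide_times ennreal_times_divide)
  also have "ennreal (?\<omega> * (k * r) ^ DIM('a)) / ennreal (?\<omega> * r ^ DIM('a)) = ennreal (k ^ DIM('a))"
    using \<omega> r k by (subst divide_ennreal) (auto simp: power_mult_distrib)
  also have "ennreal (k ^ DIM('a)) * average (ball z (k * r)) ?g \<le> ennreal (k ^ DIM('a)) * maximal g z"
    unfolding maximal_def using kr by (intro mult_left_mono SUP_upper) auto
  finally show ?thesis .
qed

text \<open>Otherwise \<open>D\<close> would rise from below \<open>2 \<epsilon>\<close> to \<open>4 \<epsilon>\<close> up to the first time at which it reaches \<open>4 \<epsilon>\<close>, although it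
  can only move by \<open>\<epsilon>\<close> before that time.\<close>

lemma bootstrap_forward:
  fixes D :: "real \<Rightarrow> real"
  assumes ab: "a \<le> b" and D: "continuous_on {a..b} D" and a: "D a < 2 * \<epsilon>" and \<epsilon>: "0 < \<epsilon>"
    and step: "\<And>c d. a \<le> c \<Longrightarrow> c \<le> d \<Longrightarrow> d \<le> b \<Longrightarrow> (\<And>s. s \<in> {c..d} \<Longrightarrow> D s \<le> 4 * \<epsilon>) \<Longrightarrow> \<bar>D d - D c\<bar> \<le> \<epsilon>"
  shows "D b \<le> 4 * \<epsilon>"
proof (rule ccontr)
  assume "\<not> D b \<le> 4 * \<epsilon>"
  let ?Z = "{s \<in> {a..b}. 4 * \<epsilon> \<le> D s}"
  have "compact ?Z"
  proof -
    have "closed ?Z" using continuous_closed_preimage[OF D, of "{4 * \<epsilon>..}"] by (simp add: vimage_def Int_def)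
    moreover have "bounded ?Z" by (rule bounded_subset[of "{a..b}"]) auto
    ultimately show ?thesis by (simp add: compact_eq_bounded_closed)
  qed
  moreover have "b \<in> ?Z" using \<open>\<not> D b \<le> 4 * \<epsilon>\<close> ab by simp
  ultimately obtain c where c: "c \<in> ?Z" "\<And>s. s \<in> ?Z \<Longrightarrow> c \<le> s"
    using compact_attains_inf[of ?Z] by blast
  have below: "D s < 4 * \<epsilon>" if "s \<in> {a..<c}" for s using c that by force
  have "\<exists>s. a \<le> s \<and> s \<le> c \<and> D s = 4 * \<epsilon>"
    using c a \<epsilon> D by (intro IVT') (auto intro: continuous_on_subset)
  then obtain s where s: "a \<le> s" "s \<le> c" "D s = 4 * \<epsilon>" by blast
  then have "s = c" using c below[of s] by force
  then have "\<bar>D c - D a\<bar> \<le> \<epsilon>"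
    using s c below by (intro step) (auto simp: le_less)
  moreover have "D c = 4 * \<epsilon>" using s(3) \<open>s = c\<close> by simp
  ultimately show False using a \<epsilon> by linarith
qed

lemma bootstrap:
  fixes D :: "real \<Rightarrow> real"
  assumes J: "is_interval J" and D: "continuous_on J D" and a: "a \<in> J" "D a < 2 * \<epsilon>" and \<epsilon>: "0 < \<epsilon>"
    and step: "\<And>c d. c \<in> J \<Longrightarrow> d \<in> J \<Longrightarrow> c \<le> d \<Longrightarrow> (\<And>s. s \<in> {c..d} \<Longrightarrow> D s \<le> 4 * \<epsilon>) \<Longrightarrow> \<bar>D d - D c\<bar> \<le> \<epsilon>"
    and b: "b \<in> J"
  shows "D b \<le> 4 * \<epsilon>"
proof (cases "a \<le> b")
  case True
  have sub: "{a..b} \<subseteq> J" using J a b by (meson atLeastAtMost_iff mem_is_interval_1_I subsetI)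
  show ?thesis
    by (rule bootstrap_forward[OF True continuous_on_subset[OF D sub] a(2) \<epsilon>])
      (use sub in \<open>auto intro!: step\<close>)
next
  case False
  have sub: "{b..a} \<subseteq> J" using J a b by (meson atLeastAtMost_iff mem_is_interval_1_I subsetI)
  have c: "continuous_on {- a..- b} (\<lambda>s. D (- s))"
    using sub by (intro continuous_on_compose2[OF D] continuous_intros) auto
  have "D (- (- b)) \<le> 4 * \<epsilon>"
  proof (rule bootstrap_forward[OF _ c _ \<epsilon>])
    fix c d assume cd: "- a \<le> c" "c \<le> d" "d \<le> - b" and le: "\<And>s. s \<in> {c..d} \<Longrightarrow> D (- s) \<le> 4 * \<epsilon>"
    have "\<bar>D (- c) - D (- d)\<bar> \<le> \<epsilon>"
    proof (rule step)
      show "- d \<in> J" "- c \<in> J" using cd sub by auto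
      show "D s \<le> 4 * \<epsilon>" if "s \<in> {- d..- c}" for s using le[of "- s"] that by auto
    qed (use cd in auto)
    then show "\<bar>D (- d) - D (- c)\<bar> \<le> \<epsilon>" by (simp add: abs_minus_commute)
  qed (use False a in auto)
  then show ?thesis by simp
qed


section \<open>Geometry of skewed cylinders\<close>

locale sobolev_flow =
  fixes S T :: ereal and \<phi> :: "real^'n \<Rightarrow> real" and u :: "real \<Rightarrow> real^'n \<Rightarrow> real^'n"
    and G :: "real \<Rightarrow> real^'n \<Rightarrow> real^'n^'n" and p\<^sub>0 :: ennreal
  assumes mollifier_\<phi>: "mollifier \<phi>" and exponent: "1 \<le> p\<^sub>0" and sobolev: "L1loc_W1p S T p\<^sub>0 u G"
begin

abbreviation "I \<equiv> einterval S T"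
abbreviation "X \<equiv> flow S T \<phi> u"
abbreviation "Q \<equiv> cylinder S T \<phi> u"

lemma mollified_field:
  assumes "0 < \<epsilon>"
  obtains b L where "caratheodory_field I b L" "\<And>\<gamma>. solves_on I (mollify \<phi> u \<epsilon>) \<gamma> \<longleftrightarrow> solves_on I b \<gamma>"
  using mollified_field_caratheodory[OF mollifier_\<phi> assms exponent sobolev] solves_on_cong_AE einterval_facts(2)
  by metis

lemma flow_solves:
  assumes "0 < \<epsilon>" "t \<in> I"
  shows "X \<epsilon> t x t = x" "solves_on I (mollify \<phi> u \<epsilon>) (X \<epsilon> t x)"
proof -
  obtain b L where b: "caratheodory_field I b L" "\<And>\<gamma>. solves_on I (mollify \<phi> u \<epsilon>) \<gamma> \<longleftrightarrow> solves_on I b \<gamma>"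
    using mollified_field[OF assms(1)] by blast
  have "\<exists>\<gamma>. ode_solution S T (mollify \<phi> u \<epsilon>) t x \<gamma>"
    unfolding ode_solution_iff_solves_on[OF assms(2)] b(2)
    by (rule caratheodory_field.solution_exists[OF b(1) assms(2)])
  then have "ode_solution S T (mollify \<phi> u \<epsilon>) t x (X \<epsilon> t x)" unfolding flow_def by (rule someI_ex)
  then show "X \<epsilon> t x t = x" "solves_on I (mollify \<phi> u \<epsilon>) (X \<epsilon> t x)"
    unfolding ode_solution_iff_solves_on[OF assms(2)] by auto
qed

lemma flow_continuous:
  assumes "0 < \<epsilon>" "t \<in> I" shows "continuous_on I (X \<epsilon> t x)"
proof -
  obtain b L where b: "caratheodory_field I b L" "\<And>\<gamma>. solves_on I (mollify \<phi> u \<epsilon>) \<gamma> \<longleftrightarrow> solves_on I b \<gamma>"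
    using mollified_field[OF assms(1)] by blast
  show ?thesis
    using caratheodory_field.solution_continuous[OF b(1)] flow_solves(2)[OF assms, of x] b(2) by blast
qed

lemma flow_stable:
  assumes "0 < \<epsilon>" "c \<in> I" "d \<in> I"
  obtains K where "0 \<le> K" "\<And>t x t' x' s s'. t \<in> I \<Longrightarrow> t' \<in> I \<Longrightarrow> s \<in> {c..d} \<Longrightarrow> s' \<in> {c..d} \<Longrightarrow>
    norm (X \<epsilon> t x s - X \<epsilon> t' x' s) \<le> K * norm (X \<epsilon> t x s' - X \<epsilon> t' x' s')"
proof -
  obtain b L where b: "caratheodory_field I b L" "\<And>\<gamma>. solves_on I (mollify \<phi> u \<epsilon>) \<gamma> \<longleftrightarrow> solves_on I b \<gamma>"
    using mollified_field[OF assms(1)] by blast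
  show thesis
  proof (rule that[of "exp (2 * integral {c..d} L)"])
    fix t x t' x' s s' assume *: "t \<in> I" "t' \<in> I" "s \<in> {c..d}" "s' \<in> {c..d}"
    show "norm (X \<epsilon> t x s - X \<epsilon> t' x' s) \<le> exp (2 * integral {c..d} L) * norm (X \<epsilon> t x s' - X \<epsilon> t' x' s')"
      by (rule caratheodory_field.solutions_stable[OF b(1) _ _ assms(2,3) *(3,4)])
        (use flow_solves(2)[OF assms(1)] *(1,2) b(2) in auto)
  qed simp
qed

definition centre_range :: "real \<Rightarrow> real set" where
  "centre_range \<epsilon> = {t. S + ereal (\<epsilon>\<^sup>2) < ereal t \<and> ereal t < T - ereal (\<epsilon>\<^sup>2)}"

lemma centre_range_iff: "t \<in> centre_range \<epsilon> \<longleftrightarrow> t - \<epsilon>\<^sup>2 \<in> I \<and> t + \<epsilon>\<^sup>2 \<in> I"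
proof -
  have "S + ereal (\<epsilon>\<^sup>2) < ereal t \<longleftrightarrow> S < ereal (t - \<epsilon>\<^sup>2)" by (cases S) auto
  moreover have "ereal t < T - ereal (\<epsilon>\<^sup>2) \<longleftrightarrow> ereal (t + \<epsilon>\<^sup>2) < T" by (cases T) auto
  moreover have "S < ereal (t - \<epsilon>\<^sup>2) \<Longrightarrow> S < ereal (t + \<epsilon>\<^sup>2)" by (cases S) (auto intro: less_le_trans[of _ "t - \<epsilon>\<^sup>2"])
  moreover have "ereal (t + \<epsilon>\<^sup>2) < T \<Longrightarrow> ereal (t - \<epsilon>\<^sup>2) < T" by (cases T) (auto intro: le_less_trans[of _ "t + \<epsilon>\<^sup>2"])
  ultimately show ?thesis by (auto simp: centre_range_def einterval_iff)
qed

lemma open_centre_range: "open (centre_range \<epsilon>)"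
proof -
  have "centre_range \<epsilon> = (\<lambda>t. t - \<epsilon>\<^sup>2) -` I \<inter> (\<lambda>t. t + \<epsilon>\<^sup>2) -` I" using centre_range_iff by auto
  then show ?thesis using einterval_facts(1)
    by (simp add: open_Int open_vimage continuous_on_diff continuous_on_add)
qed

lemma lifetime_subset:
  assumes "t \<in> centre_range \<epsilon>"
  shows "{t - \<epsilon>\<^sup>2..t + \<epsilon>\<^sup>2} \<subseteq> I" "{t - \<epsilon>\<^sup>2<..<t + \<epsilon>\<^sup>2} \<subseteq> I" "t \<in> I"
proof -
  show *: "{t - \<epsilon>\<^sup>2..t + \<epsilon>\<^sup>2} \<subseteq> I"
    using assms centre_range_iff compact_interval_of_ends by blast
  then show "{t - \<epsilon>\<^sup>2<..<t + \<epsilon>\<^sup>2} \<subseteq> I" by force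
  show "t \<in> I" using * by (rule subsetD) auto
qed

lemma cylinder_eq_tube: "Q \<epsilon> t x = tube {t - \<epsilon>\<^sup>2<..<t + \<epsilon>\<^sup>2} (X \<epsilon> t x) \<epsilon>"
  by (auto simp: cylinder_def tube_def abs_less_iff)

context
  fixes \<epsilon> t and x :: "real^'n"
  assumes \<epsilon>: "0 < \<epsilon>" and t: "t \<in> centre_range \<epsilon>"
begin

lemma flow_continuous_lifetime: "continuous_on {t - \<epsilon>\<^sup>2<..<t + \<epsilon>\<^sup>2} (X \<epsilon> t x)"
  by (rule continuous_on_subset[OF flow_continuous[OF \<epsilon> lifetime_subset(3)[OF t]] lifetime_subset(2)[OF t]])

lemma cylinder_open: "open (Q \<epsilon> t x)"
  unfolding cylinder_eq_tube by (rule open_tube[OF open_greaterThanLessThan flow_continuous_lifetime])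

lemma cylinder_subset: "Q \<epsilon> t x \<subseteq> spacetime S T"
  unfolding cylinder_eq_tube tube_def using lifetime_subset(2)[OF t] by auto

lemma centre_in_cylinder: "(t, x) \<in> Q \<epsilon> t x"
  using \<epsilon> flow_solves(1)[OF \<epsilon> lifetime_subset(3)[OF t]] by (simp add: cylinder_def)

lemma emeasure_cylinder:
  "emeasure lebesgue (Q \<epsilon> t x) = ennreal (measure lborel (ball (0::real^'n) 1) * \<epsilon> ^ CARD('n) * (2 * \<epsilon>\<^sup>2))"
proof -
  have "emeasure lebesgue (Q \<epsilon> t x)
      = ennreal (measure lborel (ball (0::real^'n) 1) * \<epsilon> ^ CARD('n)) * emeasure lborel {t - \<epsilon>\<^sup>2<..<t + \<epsilon>\<^sup>2}"
    unfolding cylinder_eq_tube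
    using emeasure_tube[OF open_greaterThanLessThan flow_continuous_lifetime] \<epsilon> by simp
  also have "emeasure lborel {t - \<epsilon>\<^sup>2<..<t + \<epsilon>\<^sup>2} = ennreal (2 * \<epsilon>\<^sup>2)" by simp
  finally show ?thesis using \<epsilon> by (simp add: ennreal_mult''[symmetric])
qed

lemma emeasure_cylinder_pos: "0 < emeasure lebesgue (Q \<epsilon> t x)" "emeasure lebesgue (Q \<epsilon> t x) < \<infinity>"
proof -
  have "0 < measure lborel (ball (0::real^'n) 1) * \<epsilon> ^ CARD('n) * (2 * \<epsilon>\<^sup>2)"
    using unit_ball_pos[where 'a = "real^'n"] \<epsilon> by simp
  then show "0 < emeasure lebesgue (Q \<epsilon> t x)" "emeasure lebesgue (Q \<epsilon> t x) < \<infinity>"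
    unfolding emeasure_cylinder by (simp_all add: ennreal_zero_less_top)
qed

lemma cylinder_measurable: "Q \<epsilon> t x \<in> sets lebesgue"
  using cylinder_open by (simp add: lmeasurable_open)

end

lemma admissibleD:
  assumes "admissible S T \<phi> u G \<eta> \<epsilon> t x"
  shows "0 < \<epsilon>" "t \<in> centre_range \<epsilon>" "ennreal (\<epsilon>\<^sup>2) * average (Q \<epsilon> t x) (grad_maximal G) < ennreal \<eta>"
  using assms by (auto simp: admissible_def centre_range_def)

lemma admissible_integral_le:
  assumes "admissible S T \<phi> u G \<eta> \<epsilon> t x" "0 \<le> \<eta>"
  shows "(\<integral>\<^sup>+ z\<in>Q \<epsilon> t x. grad_maximal G z \<partial>lebesgue)
    \<le> ennreal (measure lborel (ball (0::real^'n) 1) * \<epsilon> ^ CARD('n) * (2 * \<eta>))"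
proof -
  note adm = admissibleD[OF assms(1)]
  let ?\<omega> = "measure lborel (ball (0::real^'n) 1)"
  let ?J = "\<integral>\<^sup>+ z\<in>Q \<epsilon> t x. grad_maximal G z \<partial>lebesgue" and ?m = "?\<omega> * \<epsilon> ^ CARD('n) * (2 * \<epsilon>\<^sup>2)"
  have m: "0 < ?m" using unit_ball_pos[where 'a = "real^'n"] adm(1) by simp
  have lt: "ennreal (\<epsilon>\<^sup>2) * (?J / ennreal ?m) < ennreal \<eta>"
    using adm(3) unfolding average_def emeasure_cylinder[OF adm(1,2)] .
  have "?J \<noteq> top"
  proof
    assume "?J = top"
    then have "ennreal (\<epsilon>\<^sup>2) * (?J / ennreal ?m) = top"
      using adm(1) m by (simp add: ennreal_top_divide ennreal_mult_top)
    then show False using lt by simp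
  qed
  then obtain j where j: "?J = ennreal j" "0 \<le> j" by (cases ?J) auto
  have "ennreal (\<epsilon>\<^sup>2 * (j / ?m)) < ennreal \<eta>"
    unfolding ennreal_mult'[OF zero_le_power2] using lt unfolding j(1) divide_ennreal[OF j(2) m] .
  moreover have "0 \<le> \<epsilon>\<^sup>2 * (j / ?m)" using j m by (intro mult_nonneg_nonneg divide_nonneg_pos) auto
  ultimately have "\<epsilon>\<^sup>2 * (j / ?m) < \<eta>" by (simp only: ennreal_less_iff)
  then have "j \<le> ?\<omega> * \<epsilon> ^ CARD('n) * (2 * \<eta>)"
    using m adm(1) by (simp add: field_simps)
  then show ?thesis unfolding j(1) by (rule ennreal_leI)
qed

text \<open>A point of the ball \<open>\<theta>\<close> of the way from \<open>(a, \<delta>)\<close> to \<open>(b, \<epsilon>)\<close>, of radius \<open>r\<close>, is within \<open>r\<close> of its centre; the centre is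
  within \<open>4 \<theta> \<epsilon> \<le> 4 r\<close> of \<open>a\<close>; and \<open>a\<close> is within \<open>\<delta> \<le> r\<close> of \<open>z\<close>. Hence the ball lies in the ball of radius \<open>6 r\<close>
  about \<open>z\<close>. The factor \<open>5 \<epsilon>\<close> bounds the length of the segment, \<open>4 \<epsilon>\<close> in space and \<open>\<epsilon>\<close> in the radius.\<close>

lemma velocity_difference_le:
  fixes B K :: real
  assumes B: "0 \<le> B" "\<And>x. \<phi> x \<le> B" and \<delta>: "0 < \<delta>" "\<delta> \<le> \<epsilon>"
    and wg: "weak_gradient (u \<tau>) (G \<tau>)" and ab: "norm (a - b) \<le> 4 * \<epsilon>" and z: "norm (z - a) < \<delta>"
    and K: "CARD('n) * B * measure lborel (ball (0::real^'n) 1) * 6 ^ CARD('n) \<le> K" "0 < K"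
  shows "ennreal (norm (mollify \<phi> u \<delta> \<tau> a - mollify \<phi> u \<epsilon> \<tau> b) / (5 * \<epsilon> * K)) \<le> grad_maximal G (\<tau>, z)"
proof (cases "grad_maximal G (\<tau>, z)")
  case (real M)
  let ?c = "CARD('n) * B * measure lborel (ball (0::real^'n) 1)"
  have \<epsilon>: "0 < \<epsilon>" using \<delta> by simp
  have um: "u \<tau> \<in> borel_measurable lebesgue"
    using wg borel_measurable_loc_integrable by (auto simp: weak_gradient_def)
  have conv: "mollify \<phi> u r \<tau> y = convolve \<phi> (u \<tau>) r y" for r y
    by (rule mollify_eq_convolve[where u = u, OF mollifier_\<phi> um])
  have "norm (convolve \<phi> (u \<tau>) \<epsilon> b - convolve \<phi> (u \<tau>) \<delta> a) \<le> ?c * (norm (b - a) + \<bar>\<epsilon> - \<delta>\<bar>) * (6 ^ CARD('n) * M)"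
  proof (rule convolve_diff_le[OF mollifier_\<phi> B wg \<delta>(1) \<epsilon>])
    fix \<theta> :: real assume \<theta>: "0 \<le> \<theta>" "\<theta> \<le> 1"
    let ?x = "a + \<theta> *\<^sub>R (b - a)" and ?r = "\<delta> + \<theta> * (\<epsilon> - \<delta>)"
    have 1: "\<theta> * \<delta> \<le> \<delta>" using \<theta> \<delta> by (simp add: mult_left_le_one_le)
    have "0 \<le> \<theta> * (\<epsilon> - \<delta>)" using \<theta> \<delta> by simp
    moreover have "\<theta> * \<epsilon> \<le> ?r" using 1 by (simp add: algebra_simps)
    ultimately have 2: "\<delta> \<le> ?r" "\<theta> * \<epsilon> \<le> ?r" "0 < ?r" using \<delta> by linarith+
    have "ball ?x ?r \<subseteq> ball z (6 * ?r)"
    proof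
      fix w assume w: "w \<in> ball ?x ?r"
      have n1: "norm (w - ?x) < ?r" using w by (simp add: dist_norm norm_minus_commute)
      have n2: "norm (\<theta> *\<^sub>R (b - a)) \<le> 4 * ?r"
      proof -
        have "norm (\<theta> *\<^sub>R (b - a)) \<le> 4 * (\<theta> * \<epsilon>)"
          using \<theta> mult_left_mono[OF ab \<theta>(1)] by (simp add: norm_minus_commute)
        also have "\<dots> \<le> 4 * ?r" by (rule mult_left_mono[OF 2(2)]) simp
        finally show ?thesis .
      qed
      have n3: "norm (z - a) < ?r" using z 2(1) by (rule less_le_trans)
      have "norm (w - z) \<le> norm (w - ?x) + norm (\<theta> *\<^sub>R (b - a)) + norm (z - a)"
        using norm_triangle_ineq[of "w - ?x" "\<theta> *\<^sub>R (b - a)"] norm_triangle_ineq4[of "w - ?x + \<theta> *\<^sub>R (b - a)" "z - a"]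
        by (simp add: algebra_simps)
      also have "\<dots> < ?r + 4 * ?r + ?r" by (rule add_strict_mono[OF add_less_le_mono[OF n1 n2] n3])
      also have "\<dots> = 6 * ?r" by simp
      finally have "norm (w - z) < 6 * ?r" .
      then show "w \<in> ball z (6 * ?r)" by (simp add: dist_norm norm_minus_commute)
    qed
    from average_ball_le_maximal[OF 2(3) _ this, of "G \<tau>"]
    have "average (ball ?x ?r) (\<lambda>y. ennreal (norm (G \<tau> y))) \<le> ennreal (6 ^ CARD('n)) * maximal (G \<tau>) z" by simp
    also have "maximal (G \<tau>) z = ennreal M" using real by (simp add: grad_maximal_def)
    also have "ennreal (6 ^ CARD('n)) * ennreal M = ennreal (6 ^ CARD('n) * M)"
      using real by (simp add: ennreal_mult'')
    finally show "average (ball ?x ?r) (\<lambda>y. ennreal (norm (G \<tau> y))) \<le> ennreal (6 ^ CARD('n) * M)" .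
  qed (use real in auto)
  also have "\<dots> = (?c * 6 ^ CARD('n)) * ((norm (b - a) + \<bar>\<epsilon> - \<delta>\<bar>) * M)" by simp
  also have "\<dots> \<le> K * ((5 * \<epsilon>) * M)"
  proof (rule mult_mono[OF K(1)])
    show "(norm (b - a) + \<bar>\<epsilon> - \<delta>\<bar>) * M \<le> (5 * \<epsilon>) * M"
      using ab \<delta> real by (intro mult_right_mono) (auto simp: norm_minus_commute)
  qed (use K real in auto)
  finally have "norm (mollify \<phi> u \<delta> \<tau> a - mollify \<phi> u \<epsilon> \<tau> b) / (5 * \<epsilon> * K) \<le> M"
    using \<epsilon> K(2) unfolding conv by (simp add: divide_le_eq norm_minus_commute mult_ac)
  then show ?thesis unfolding real(2) by (rule ennreal_leI)
qed simp


text \<open>At each time the relative velocity is at most \<open>5 \<epsilon> K\<close> times \<open>\<M>(\<nabla>u)\<close> at \<open>every\<close> point of the cross section of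
  the smaller cylinder, hence at most \<open>5 \<epsilon> K\<close> times the average over the cross section. Admissibility bounds the time
  integral of that average by \<open>2 \<eta>\<close>, which gives \<open>10 \<epsilon> K \<eta>\<close> in total.\<close>

lemma flow_distance_step:
  fixes B K :: real
  assumes B: "0 \<le> B" "\<And>x. \<phi> x \<le> B"
    and K: "CARD('n) * B * measure lborel (ball (0::real^'n) 1) * 6 ^ CARD('n) \<le> K" "0 < K"
    and \<eta>: "0 \<le> \<eta>" "10 * K * \<eta> \<le> 1"
    and adm: "admissible S T \<phi> u G \<eta> \<delta> s y" and \<epsilon>: "\<delta> \<le> \<epsilon>" and t: "t \<in> I"
    and cd: "c \<in> {s - \<delta>\<^sup>2<..<s + \<delta>\<^sup>2}" "d \<in> {s - \<delta>\<^sup>2<..<s + \<delta>\<^sup>2}" "c \<le> d"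
    and near: "\<And>\<tau>. \<tau> \<in> {c..d} \<Longrightarrow> norm (X \<delta> s y \<tau> - X \<epsilon> t x \<tau>) \<le> 4 * \<epsilon>"
  shows "\<bar>norm (X \<delta> s y d - X \<epsilon> t x d) - norm (X \<delta> s y c - X \<epsilon> t x c)\<bar> \<le> \<epsilon>"
proof -
  let ?\<omega> = "measure lborel (ball (0::real^'n) 1)" and ?J = "{s - \<delta>\<^sup>2<..<s + \<delta>\<^sup>2}"
  note a = admissibleD[OF adm]
  note sJ = lifetime_subset[OF a(2)]
  have \<epsilon>0: "0 < \<epsilon>" using a(1) \<epsilon> by simp
  have cdI: "c \<in> I" "d \<in> I" using cd sJ(2) by auto
  have sub: "{c..d} \<subseteq> ?J" using cd by auto
  let ?v = "\<lambda>\<tau>. mollify \<phi> u \<delta> \<tau> (X \<delta> s y \<tau>) - mollify \<phi> u \<epsilon> \<tau> (X \<epsilon> t x \<tau>)"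
  have f1: "(\<lambda>\<tau>. mollify \<phi> u \<delta> \<tau> (X \<delta> s y \<tau>)) absolutely_integrable_on {c..d}"
    and e1: "X \<delta> s y d - X \<delta> s y c = integral {c..d} (\<lambda>\<tau>. mollify \<phi> u \<delta> \<tau> (X \<delta> s y \<tau>))"
    using flow_solves(2)[OF a(1) sJ(3), of y] cdI cd(3) by (auto simp: solves_on_def)
  have f2: "(\<lambda>\<tau>. mollify \<phi> u \<epsilon> \<tau> (X \<epsilon> t x \<tau>)) absolutely_integrable_on {c..d}"
    and e2: "X \<epsilon> t x d - X \<epsilon> t x c = integral {c..d} (\<lambda>\<tau>. mollify \<phi> u \<epsilon> \<tau> (X \<epsilon> t x \<tau>))"
    using flow_solves(2)[OF \<epsilon>0 t, of x] cdI cd(3) by (auto simp: solves_on_def)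
  have vi: "?v absolutely_integrable_on {c..d}" by (rule set_integral_diff(1)[OF f1 f2])
  have ev: "(X \<delta> s y d - X \<epsilon> t x d) - (X \<delta> s y c - X \<epsilon> t x c) = integral {c..d} ?v"
    using e1 e2 Henstock_Kurzweil_Integration.integral_diff[OF set_lebesgue_integral_eq_integral(1)[OF f1] set_lebesgue_integral_eq_integral(1)[OF f2]]
    by (simp add: algebra_simps)
  let ?w = "\<lambda>\<tau>. indicator {c..d} \<tau> * norm (?v \<tau>)"
  have ni: "(\<lambda>\<tau>. norm (?v \<tau>)) absolutely_integrable_on {c..d}"
    using absolutely_integrable_norm[OF vi] by (simp add: comp_def)
  then have wi: "integrable lebesgue ?w" by (simp add: set_integrable_def)
  then obtain g where g[measurable]: "g \<in> borel_measurable borel" and gw: "AE \<tau> in lborel. ?w \<tau> = g \<tau>"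
    using lebesgue_ex_borel_measurable[OF borel_measurable_integrable[OF wi]] by blast
  have "AE \<tau> in lebesgue. \<tau> \<in> I \<longrightarrow> weak_gradient (u \<tau>) (G \<tau>)"
    using sobolev unfolding L1loc_W1p_def
    by (subst (asm) AE_restrict_space_iff) (auto simp: lmeasurable_open einterval_facts)
  then have "AE \<tau> in lborel. \<tau> \<in> I \<longrightarrow> weak_gradient (u \<tau>) (G \<tau>)" by (simp add: AE_completion_iff)
  then have "AE \<tau> in lborel. ?w \<tau> = g \<tau> \<and> (\<tau> \<in> I \<longrightarrow> weak_gradient (u \<tau>) (G \<tau>))"
    using gw by eventually_elim simp
  then obtain N where N: "N \<in> null_sets lborel"
    and good: "\<And>\<tau>. \<tau> \<notin> N \<Longrightarrow> ?w \<tau> = g \<tau> \<and> (\<tau> \<in> I \<longrightarrow> weak_gradient (u \<tau>) (G \<tau>))"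
    using ex_null_set_of_AE by blast
  have Nm[measurable]: "N \<in> sets borel" using N by auto
  let ?k = "5 * \<epsilon> * K"
  have k: "0 < ?k" using \<epsilon>0 K by simp
  \<comment> \<open>A Borel function of time that minorizes the maximal function at all points of the cylinder; the exceptional null set
    of times is cut out so that the comparison holds everywhere.\<close>
  define m where "m \<tau> = ennreal (g \<tau> / ?k) * indicator (- N) \<tau>" for \<tau>
  have mm[measurable]: "m \<in> borel_measurable borel" unfolding m_def[abs_def] by measurable
  have m_le: "m \<tau> \<le> grad_maximal G (\<tau>, z)" if z: "(\<tau>, z) \<in> Q \<delta> s y" for \<tau> z
  proof (cases "\<tau> \<in> {c..d} - N")
    case True
    then have "\<tau> \<in> I" using sub sJ(2) by auto
    then have "ennreal (norm (?v \<tau>) / ?k) \<le> grad_maximal G (\<tau>, z)"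
      using True z good[of \<tau>] near[of \<tau>]
      by (intro velocity_difference_le[OF B a(1) \<epsilon> _ _ _ K]) (auto simp: cylinder_def)
    then show ?thesis using True good[of \<tau>] by (auto simp: m_def)
  next
    case False
    then have "m \<tau> = 0" using good[of \<tau>] by (auto simp: m_def indicator_def)
    then show ?thesis by simp
  qed
  let ?W = "ennreal (?\<omega> * \<delta> ^ CARD('n))"
  have "?W * (\<integral>\<^sup>+ \<tau>\<in>?J. m \<tau> \<partial>lborel) = (\<integral>\<^sup>+ z\<in>Q \<delta> s y. m (fst z) \<partial>lebesgue)"
    unfolding cylinder_eq_tube
    using nn_integral_tube[OF open_greaterThanLessThan flow_continuous_lifetime[OF a(1,2)] less_imp_le[OF a(1)] mm] by simp
  also have "\<dots> \<le> (\<integral>\<^sup>+ z\<in>Q \<delta> s y. grad_maximal G z \<partial>lebesgue)"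
    using m_le by (intro nn_integral_mono) (auto simp: indicator_def)
  also have "\<dots> \<le> ennreal (?\<omega> * \<delta> ^ CARD('n) * (2 * \<eta>))" by (rule admissible_integral_le[OF adm \<eta>(1)])
  also have "\<dots> = ?W * ennreal (2 * \<eta>)" using \<eta>(1) by (intro ennreal_mult'') simp
  finally have "?W * (\<integral>\<^sup>+ \<tau>\<in>?J. m \<tau> \<partial>lborel) \<le> ?W * ennreal (2 * \<eta>)" .
  moreover have "?W \<noteq> 0" "?W \<noteq> top"
    using unit_ball_pos[where 'a = "real^'n"] a(1) by (auto simp: ennreal_eq_0_iff not_le)
  ultimately have "(\<integral>\<^sup>+ \<tau>\<in>?J. m \<tau> \<partial>lborel) \<le> ennreal (2 * \<eta>)"
    by (simp add: ennreal_mult_le_mult_iff)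
  moreover have "(\<integral>\<^sup>+ \<tau>\<in>?J. m \<tau> \<partial>lborel) = ennreal (integral {c..d} (\<lambda>\<tau>. norm (?v \<tau>)) / ?k)"
  proof -
    have "(\<integral>\<^sup>+ \<tau>\<in>?J. m \<tau> \<partial>lborel) = (\<integral>\<^sup>+ \<tau>\<in>?J. m \<tau> \<partial>lebesgue)" by (rule nn_integral_completion[symmetric])
    also have "\<dots> = (\<integral>\<^sup>+ \<tau>. ennreal (?w \<tau> / ?k) \<partial>lebesgue)"
    proof (rule nn_integral_cong_AE)
      have "AE \<tau> in lebesgue. \<tau> \<notin> N" by (rule AE_completion[OF AE_not_in[OF N]])
      then show "AE \<tau> in lebesgue. m \<tau> * indicator ?J \<tau> = ennreal (?w \<tau> / ?k)"
      proof eventually_elim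
        case (elim \<tau>)
        have "m \<tau> = ennreal (g \<tau> / ?k)" using elim by (simp add: m_def)
        also have "g \<tau> = ?w \<tau>" using good[OF elim] by simp
        finally have m_eq: "m \<tau> = ennreal (?w \<tau> / ?k)" .
        show ?case
        proof (cases "\<tau> \<in> ?J")
          case True
          then show ?thesis unfolding m_eq by simp
        next
          case False
          then have "\<tau> \<notin> {c..d}" using sub by blast
          then show ?thesis unfolding m_eq by simp
        qed
      qed
    qed
    also have "\<dots> = ennreal (LINT \<tau>|lebesgue. ?w \<tau> / ?k)"
      using wi k by (intro nn_integral_eq_integral) auto
    also have "(LINT \<tau>|lebesgue. ?w \<tau> / ?k) = (LINT \<tau>:{c..d}|lebesgue. norm (?v \<tau>)) / ?k"
      by (simp add: set_lebesgue_integral_def)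
    also have "(LINT \<tau>:{c..d}|lebesgue. norm (?v \<tau>)) = integral {c..d} (\<lambda>\<tau>. norm (?v \<tau>))"
      by (rule set_lebesgue_integral_eq_integral(2)[OF ni])
    finally show ?thesis .
  qed
  ultimately have "integral {c..d} (\<lambda>\<tau>. norm (?v \<tau>)) / ?k \<le> 2 * \<eta>"
    using \<eta>(1) by (simp add: ennreal_le_iff)
  then have "integral {c..d} (\<lambda>\<tau>. norm (?v \<tau>)) \<le> \<epsilon> * (10 * K * \<eta>)"
    using k by (simp add: divide_le_eq mult_ac)
  also have "\<dots> \<le> \<epsilon> * 1" using \<eta>(2) \<epsilon>0 by (intro mult_left_mono) auto
  finally have int_le: "integral {c..d} (\<lambda>\<tau>. norm (?v \<tau>)) \<le> \<epsilon>" by simp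
  have "\<bar>norm (X \<delta> s y d - X \<epsilon> t x d) - norm (X \<delta> s y c - X \<epsilon> t x c)\<bar> \<le> norm (integral {c..d} ?v)"
    unfolding ev[symmetric] by (rule norm_triangle_ineq3)
  also have "\<dots> \<le> integral {c..d} (\<lambda>\<tau>. norm (?v \<tau>))"
    by (intro integral_norm_bound_integral set_lebesgue_integral_eq_integral(1) vi ni) simp
  finally show ?thesis using int_le by linarith
qed

text \<open>The smaller cylinder lasts for a time of at most \<open>2 \<delta>\<^sup>2 \<le> 2 \<epsilon>\<^sup>2\<close> beyond the larger one, and its points are within
  \<open>\<delta> \<le> \<epsilon>\<close> of a trajectory that stays within \<open>4 \<epsilon>\<close> of the axis.\<close>

definition enlarged_cylinder :: "real \<Rightarrow> real \<Rightarrow> real^'n \<Rightarrow> (real \<times> (real^'n)) set" where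
  "enlarged_cylinder \<epsilon> t x = tube ({t - 3 * \<epsilon>\<^sup>2<..<t + 3 * \<epsilon>\<^sup>2} \<inter> I) (X \<epsilon> t x) (5 * \<epsilon>)"

lemma enlarged_cylinder_facts:
  assumes \<epsilon>: "0 < \<epsilon>" and t: "t \<in> centre_range \<epsilon>"
  shows "enlarged_cylinder \<epsilon> t x \<in> sets lebesgue"
    and "emeasure lebesgue (enlarged_cylinder \<epsilon> t x) \<le> ennreal (3 * 5 ^ CARD('n)) * emeasure lebesgue (Q \<epsilon> t x)"
proof -
  let ?J = "{t - 3 * \<epsilon>\<^sup>2<..<t + 3 * \<epsilon>\<^sup>2} \<inter> I" and ?\<omega> = "measure lborel (ball (0::real^'n) 1)"
  have J: "open ?J" using einterval_facts(1) by auto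
  have c: "continuous_on ?J (X \<epsilon> t x)"
    by (rule continuous_on_subset[OF flow_continuous[OF \<epsilon> lifetime_subset(3)[OF t]]]) auto
  show "enlarged_cylinder \<epsilon> t x \<in> sets lebesgue"
    unfolding enlarged_cylinder_def using open_tube[OF J c] by (simp add: lmeasurable_open)
  have "emeasure lebesgue (enlarged_cylinder \<epsilon> t x) = ennreal (?\<omega> * (5 * \<epsilon>) ^ CARD('n)) * emeasure lborel ?J"
    unfolding enlarged_cylinder_def using emeasure_tube[OF J c, of "5 * \<epsilon>"] \<epsilon> by simp
  also have "emeasure lborel ?J \<le> emeasure lborel {t - 3 * \<epsilon>\<^sup>2<..<t + 3 * \<epsilon>\<^sup>2}" by (intro emeasure_mono) auto
  also have "\<dots> = ennreal (6 * \<epsilon>\<^sup>2)" by simp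
  also have "ennreal (?\<omega> * (5 * \<epsilon>) ^ CARD('n)) * ennreal (6 * \<epsilon>\<^sup>2) = ennreal (?\<omega> * (5 * \<epsilon>) ^ CARD('n) * (6 * \<epsilon>\<^sup>2))"
    by (rule ennreal_mult''[symmetric]) simp
  also have "?\<omega> * (5 * \<epsilon>) ^ CARD('n) * (6 * \<epsilon>\<^sup>2) = (3 * 5 ^ CARD('n)) * (?\<omega> * \<epsilon> ^ CARD('n) * (2 * \<epsilon>\<^sup>2))"
    by (simp add: power_mult_distrib)
  also have "ennreal \<dots> = ennreal (3 * 5 ^ CARD('n)) * emeasure lebesgue (Q \<epsilon> t x)"
    unfolding emeasure_cylinder[OF \<epsilon> t] using \<epsilon> by (intro ennreal_mult'') simp
  finally show "emeasure lebesgue (enlarged_cylinder \<epsilon> t x) \<le> ennreal (3 * 5 ^ CARD('n)) * emeasure lebesgue (Q \<epsilon> t x)"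
    by (simp add: mult_left_mono)
qed

text \<open>The trajectories are less than \<open>2 \<epsilon>\<close> apart at a common time and, by the preceding estimate, gain at most \<open>\<epsilon>\<close> as long as
  they are within \<open>4 \<epsilon>\<close>. The axis of the larger cylinder is followed beyond the lifetime of that cylinder.\<close>

lemma engulfing:
  fixes B K :: real
  assumes B: "0 \<le> B" "\<And>x. \<phi> x \<le> B"
    and K: "CARD('n) * B * measure lborel (ball (0::real^'n) 1) * 6 ^ CARD('n) \<le> K" "0 < K"
    and \<eta>: "0 \<le> \<eta>" "10 * K * \<eta> \<le> 1"
    and adm: "admissible S T \<phi> u G \<eta> \<delta> s y" and \<epsilon>: "\<delta> \<le> \<epsilon>" and t: "t \<in> I"
    and meet: "Q \<delta> s y \<inter> Q \<epsilon> t x \<noteq> {}"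
  shows "Q \<delta> s y \<subseteq> enlarged_cylinder \<epsilon> t x"
proof
  note a = admissibleD[OF adm]
  note sJ = lifetime_subset[OF a(2)]
  have \<epsilon>0: "0 < \<epsilon>" using a(1) \<epsilon> by simp
  let ?J = "{s - \<delta>\<^sup>2<..<s + \<delta>\<^sup>2}" and ?D = "\<lambda>\<tau>. norm (X \<delta> s y \<tau> - X \<epsilon> t x \<tau>)"
  obtain \<tau>\<^sub>0 z\<^sub>0 where z0: "(\<tau>\<^sub>0, z\<^sub>0) \<in> Q \<delta> s y" "(\<tau>\<^sub>0, z\<^sub>0) \<in> Q \<epsilon> t x" using meet by auto
  have "?D \<tau>\<^sub>0 < 2 * \<epsilon>"
    using z0 \<epsilon> norm_triangle_ineq4[of "z\<^sub>0 - X \<epsilon> t x \<tau>\<^sub>0" "z\<^sub>0 - X \<delta> s y \<tau>\<^sub>0"] by (auto simp: cylinder_def)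
  moreover have "\<tau>\<^sub>0 \<in> ?J" using z0 by (auto simp: cylinder_def abs_less_iff)
  moreover have "continuous_on ?J ?D"
    using flow_continuous[OF a(1) sJ(3), of y] flow_continuous[OF \<epsilon>0 t, of x] sJ(2)
    by (intro continuous_intros) (auto intro: continuous_on_subset)
  ultimately have near: "?D \<tau> \<le> 4 * \<epsilon>" if "\<tau> \<in> ?J" for \<tau>
    using flow_distance_step[OF B K \<eta> adm \<epsilon> t, of _ _ x] that \<epsilon>0
    by (intro bootstrap[of ?J ?D \<tau>\<^sub>0]) (auto simp: is_interval_1)
  fix z assume z: "z \<in> Q \<delta> s y"
  obtain \<tau> w where zw: "z = (\<tau>, w)" by fastforce
  have \<tau>: "\<tau> \<in> ?J" and w: "norm (w - X \<delta> s y \<tau>) < \<delta>" using z by (auto simp: zw cylinder_def abs_less_iff)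
  have "norm (w - X \<epsilon> t x \<tau>) < 5 * \<epsilon>"
    using norm_triangle_ineq[of "w - X \<delta> s y \<tau>" "X \<delta> s y \<tau> - X \<epsilon> t x \<tau>"] near[OF \<tau>] w \<epsilon> by simp
  moreover have "\<delta>\<^sup>2 \<le> \<epsilon>\<^sup>2" using \<epsilon> a(1) by (intro power_mono) auto
  then have "\<tau> \<in> {t - 3 * \<epsilon>\<^sup>2<..<t + 3 * \<epsilon>\<^sup>2}"
    using \<tau> z0 by (auto simp: cylinder_def abs_less_iff)
  moreover have "\<tau> \<in> I" using \<tau> sJ(2) by blast
  ultimately show "z \<in> enlarged_cylinder \<epsilon> t x" by (simp add: zw enlarged_cylinder_def tube_def)
qed

end


section \<open>Covering argument\<close>

text \<open>Greedy selection in the order of decreasing size.\<close>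

lemma vitali_finite_selection:
  fixes Q E :: "'i \<Rightarrow> 'a set" and r :: "'i \<Rightarrow> real" and K :: ennreal
  assumes "finite F"
    and "\<And>c. c \<in> F \<Longrightarrow> Q c \<in> sets M" "\<And>c. c \<in> F \<Longrightarrow> E c \<in> sets M"
    and "\<And>c. c \<in> F \<Longrightarrow> emeasure M (E c) \<le> K * emeasure M (Q c)"
    and "\<And>c c'. c \<in> F \<Longrightarrow> c' \<in> F \<Longrightarrow> r c' \<le> r c \<Longrightarrow> Q c' \<inter> Q c \<noteq> {} \<Longrightarrow> Q c' \<subseteq> E c"
  shows "\<exists>F'\<subseteq>F. disjoint_family_on Q F' \<and> emeasure M (\<Union>c\<in>F. Q c) \<le> K * (\<Sum>c\<in>F'. emeasure M (Q c))"
  using assms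
proof (induction F rule: finite_psubset_induct)
  case (psubset F)
  show ?case
  proof (cases "F = {}")
    case True
    then show ?thesis by (simp add: disjoint_family_on_def)
  next
    case False
    have "\<exists>c\<in>F. \<forall>c'\<in>F. r c' \<le> r c"
    proof -
      have "Max (r ` F) \<in> r ` F" using False psubset.hyps by (intro Max_in) auto
      then obtain c where "c \<in> F" "r c = Max (r ` F)" by auto
      then show ?thesis using psubset.hyps by (intro bexI[of _ c]) auto
    qed
    then obtain c where c: "c \<in> F" "\<And>c'. c' \<in> F \<Longrightarrow> r c' \<le> r c" by blast
    define F1 where "F1 = {c' \<in> F - {c}. Q c' \<inter> Q c = {}}"
    have F1: "F1 \<subset> F" using c(1) by (auto simp: F1_def)
    have "\<exists>F'\<subseteq>F1. disjoint_family_on Q F' \<and> emeasure M (\<Union>c\<in>F1. Q c) \<le> K * (\<Sum>c\<in>F'. emeasure M (Q c))"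
    proof (rule psubset.IH[OF F1])
      show "Q c \<in> sets M" "E c \<in> sets M" "emeasure M (E c) \<le> K * emeasure M (Q c)" if "c \<in> F1" for c
        using psubset.prems(1,2,3) that F1 by auto
      show "Q c' \<subseteq> E c" if "c \<in> F1" "c' \<in> F1" "r c' \<le> r c" "Q c' \<inter> Q c \<noteq> {}" for c c'
        using psubset.prems(4)[of c c'] that F1 by blast
    qed
    then obtain F' where F': "F' \<subseteq> F1" "disjoint_family_on Q F'"
      and le: "emeasure M (\<Union>c\<in>F1. Q c) \<le> K * (\<Sum>c\<in>F'. emeasure M (Q c))" by blast
    have fin: "finite F1" "finite F'" using finite_subset[of F1 F] finite_subset[of F' F1] F1 F'(1) psubset.hyps by auto
    have cF': "c \<notin> F'" using F'(1) by (auto simp: F1_def)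
    have sub: "(\<Union>c\<in>F. Q c) \<subseteq> E c \<union> (\<Union>c\<in>F1. Q c)"
    proof
      fix z assume "z \<in> (\<Union>c\<in>F. Q c)"
      then obtain c' where c': "c' \<in> F" "z \<in> Q c'" by blast
      show "z \<in> E c \<union> (\<Union>c\<in>F1. Q c)"
      proof (cases "c' \<in> F1")
        case True then show ?thesis using c' by blast
      next
        case False
        then have "Q c' \<inter> Q c \<noteq> {}" using c' by (auto simp: F1_def)
        then show ?thesis using psubset.prems(4)[OF c(1) c'(1) c(2)[OF c'(1)]] c'(2) by blast
      qed
    qed
    have m1: "(\<Union>c\<in>F1. Q c) \<in> sets M" using fin(1) F1 psubset.prems(1) by (intro sets.finite_UN) auto
    have "emeasure M (\<Union>c\<in>F. Q c) \<le> emeasure M (E c \<union> (\<Union>c\<in>F1. Q c))"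
      using sub psubset.prems(2)[OF c(1)] m1 by (intro emeasure_mono) auto
    also have "\<dots> \<le> emeasure M (E c) + emeasure M (\<Union>c\<in>F1. Q c)"
      by (rule emeasure_subadditive[OF psubset.prems(2)[OF c(1)] m1])
    also have "\<dots> \<le> K * emeasure M (Q c) + K * (\<Sum>c\<in>F'. emeasure M (Q c))"
      by (rule add_mono[OF psubset.prems(3)[OF c(1)] le])
    also have "\<dots> = K * (\<Sum>c\<in>insert c F'. emeasure M (Q c))"
      using fin(2) cF' by (simp add: distrib_left)
    finally have "emeasure M (\<Union>c\<in>F. Q c) \<le> K * (\<Sum>c\<in>insert c F'. emeasure M (Q c))" .
    moreover have "disjoint_family_on Q (insert c F')"
      using F' unfolding disjoint_family_on_def F1_def by blast
    moreover have "insert c F' \<subseteq> F" using c(1) F'(1) F1 by blast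
    ultimately show ?thesis by blast
  qed
qed

context sobolev_flow
begin

abbreviation "\<Omega> \<equiv> spacetime S T :: (real \<times> (real^'n)) set"

lemma open_\<Omega>: "open \<Omega>" by (intro open_Times einterval_facts) simp

lemma \<Omega>_measurable: "\<Omega> \<in> sets lebesgue" using open_\<Omega> by (simp add: lmeasurable_open)

text \<open>The property of \<open>L\<^sup>p\<close> functions that makes averages over cylinders continuous. It does not
  mention the exponent, and it passes to smaller measurable functions, in particular to truncations.\<close>

definition finite_on_finite :: "(real \<times> (real^'n) \<Rightarrow> ennreal) \<Rightarrow> bool" where
  "finite_on_finite g \<longleftrightarrow> g \<in> borel_measurable (lebesgue_on \<Omega>) \<and>
     (\<forall>A\<in>sets lebesgue. A \<subseteq> \<Omega> \<longrightarrow> emeasure lebesgue A < \<infinity> \<longrightarrow> (\<integral>\<^sup>+ z\<in>A. g z \<partial>lebesgue) < \<infinity>)"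

lemma finite_on_finite_measurable:
  assumes "finite_on_finite g"
  shows "(\<lambda>z. g z * indicator \<Omega> z) \<in> borel_measurable lebesgue"
  using assms borel_measurable_restrict_space_iff_ennreal[of \<Omega> lebesgue g] \<Omega>_measurable
  by (simp add: finite_on_finite_def)

lemma nn_integral_subset_\<Omega>:
  assumes "A \<in> sets lebesgue" "A \<subseteq> \<Omega>"
  shows "(\<integral>\<^sup>+ z\<in>A. g z \<partial>(lebesgue_on \<Omega>)) = (\<integral>\<^sup>+ z\<in>A. g z \<partial>lebesgue)"
proof -
  have "(\<integral>\<^sup>+ z\<in>A. g z \<partial>(lebesgue_on \<Omega>)) = (\<integral>\<^sup>+ z. g z * indicator A z * indicator \<Omega> z \<partial>lebesgue)"
    using \<Omega>_measurable by (subst nn_integral_restrict_space) auto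
  also have "\<dots> = (\<integral>\<^sup>+ z\<in>A. g z \<partial>lebesgue)"
    using assms(2) by (intro nn_integral_cong) (auto simp: indicator_def)
  finally show ?thesis .
qed

lemma finite_on_finite_Lp:
  assumes p: "1 \<le> p" and g: "g \<in> borel_measurable (lebesgue_on \<Omega>)" and Lp: "Lp_norm p (lebesgue_on \<Omega>) g < \<infinity>"
  shows "finite_on_finite g"
  unfolding finite_on_finite_def
proof (intro conjI ballI impI g)
  fix A :: "(real \<times> (real^'n)) set" assume A: "A \<in> sets lebesgue" "A \<subseteq> \<Omega>" "emeasure lebesgue A < \<infinity>"
  have A': "A \<in> sets (lebesgue_on \<Omega>)" using A \<Omega>_measurable by (simp add: sets_restrict_space_iff)
  have "emeasure (lebesgue_on \<Omega>) A = emeasure lebesgue A" using A \<Omega>_measurable by (intro emeasure_restrict_space) auto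
  then have "(\<integral>\<^sup>+ z\<in>A. g z \<partial>lebesgue) \<le> (emeasure lebesgue A + 1) * Lp_norm p (lebesgue_on \<Omega>) g"
    using nn_integral_le_Lp_norm[OF p g A'] nn_integral_subset_\<Omega>[OF A(1,2), of g] by simp
  also have "\<dots> < \<infinity>" using A(3) Lp by (simp add: ennreal_mult_less_top)
  finally show "(\<integral>\<^sup>+ z\<in>A. g z \<partial>lebesgue) < \<infinity>" .
qed

text \<open>By dominated convergence: the flow depends continuously on the centre, so a point off the boundary of the limit cylinder
  is eventually inside or eventually outside, and boundaries are null sets.\<close>

lemma cylinder_integral_continuous:
  assumes \<epsilon>: "0 < \<epsilon>" and g: "finite_on_finite g"
  shows "continuous_on (centre_range \<epsilon> \<times> UNIV) (\<lambda>c. \<integral>\<^sup>+ z\<in>Q \<epsilon> (fst c) (snd c). g z \<partial>lebesgue)"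
  unfolding continuous_on_sequentially
proof (intro allI ballI impI, elim conjE)
  fix s :: "nat \<Rightarrow> real \<times> (real^'n)" and c
  assume c: "c \<in> centre_range \<epsilon> \<times> UNIV" and sn: "\<forall>n. s n \<in> centre_range \<epsilon> \<times> UNIV" and lim: "s \<longlonglongrightarrow> c"
  obtain t x where tx: "c = (t, x)" by fastforce
  define t' x' where "t' n = fst (s n)" and "x' n = snd (s n)" for n
  have t: "t \<in> centre_range \<epsilon>" and t'r: "\<And>n. t' n \<in> centre_range \<epsilon>" using c sn by (auto simp: tx t'_def mem_Times_iff)
  have tlim: "t' \<longlonglongrightarrow> t" and xlim: "x' \<longlonglongrightarrow> x"
    using tendsto_fst[OF lim] tendsto_snd[OF lim] by (auto simp: tx t'_def[abs_def] x'_def[abs_def])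
  have tI: "t \<in> I" and t'I: "\<And>n. t' n \<in> I" using lifetime_subset(3) t t'r by auto
  define \<gamma> where "\<gamma> = X \<epsilon> t x"
  have \<gamma>c: "continuous_on I \<gamma>" unfolding \<gamma>_def by (rule flow_continuous[OF \<epsilon> tI])
  have ends: "t - \<epsilon>\<^sup>2 \<in> I" "t + \<epsilon>\<^sup>2 \<in> I" using t centre_range_iff by auto
  obtain h\<^sub>1 where h1: "0 < h\<^sub>1" "cball (t - \<epsilon>\<^sup>2) h\<^sub>1 \<subseteq> I" using einterval_facts(1) ends(1) open_contains_cball by blast
  obtain h\<^sub>2 where h2: "0 < h\<^sub>2" "cball (t + \<epsilon>\<^sup>2) h\<^sub>2 \<subseteq> I" using einterval_facts(1) ends(2) open_contains_cball by blast
  define h where "h = min h\<^sub>1 h\<^sub>2"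
  have h: "0 < h" using h1 h2 by (simp add: h_def)
  let ?c = "t - \<epsilon>\<^sup>2 - h" and ?d = "t + \<epsilon>\<^sup>2 + h"
  have cI: "?c \<in> I" by (rule subsetD[OF h1(2)]) (use h h1 in \<open>auto simp: dist_real_def h_def\<close>)
  have dI: "?d \<in> I" by (rule subsetD[OF h2(2)]) (use h h2 in \<open>auto simp: dist_real_def h_def\<close>)
  obtain K where K: "0 \<le> K" "\<And>t x t' x' s s'. t \<in> I \<Longrightarrow> t' \<in> I \<Longrightarrow> s \<in> {?c..?d} \<Longrightarrow> s' \<in> {?c..?d} \<Longrightarrow>
      norm (X \<epsilon> t x s - X \<epsilon> t' x' s) \<le> K * norm (X \<epsilon> t x s' - X \<epsilon> t' x' s')"
    using flow_stable[OF \<epsilon> cI dI] by blast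
  \<comment> \<open>At time \<open>t' n\<close> the perturbed trajectory sits at \<open>x' n\<close>, so stability is applied with that time as reference.\<close>
  define e where "e n = K * norm (x' n - \<gamma> (t' n))" for n
  have "(\<lambda>n. \<gamma> (t' n)) \<longlonglongrightarrow> \<gamma> t"
    using \<gamma>c tlim t'I tI unfolding continuous_on_sequentially by (auto simp: comp_def)
  moreover have "\<gamma> t = x" unfolding \<gamma>_def by (rule flow_solves(1)[OF \<epsilon> tI])
  ultimately have elim0: "e \<longlonglongrightarrow> 0"
    unfolding e_def[abs_def] using xlim by (intro tendsto_mult_right_zero tendsto_norm_zero) (auto intro: tendsto_eq_intros)
  have near_t: "\<forall>\<^sub>F n in sequentially. \<bar>t' n - t\<bar> < a" if "0 < a" for a
    using tendstoD[OF tlim that] by (simp add: dist_real_def)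
  have near_e: "\<forall>\<^sub>F n in sequentially. e n < a" if "0 < a" for a
    using order_tendstoD(2)[OF elim0 that] .
  have dist: "norm (X \<epsilon> (t' n) (x' n) \<tau> - \<gamma> \<tau>) \<le> e n" if "\<bar>t' n - t\<bar> < h" "\<tau> \<in> {?c..?d}" for n \<tau>
  proof -
    have "t' n \<in> {?c..?d}" using that(1) zero_le_power2[of \<epsilon>] unfolding abs_less_iff atLeastAtMost_iff by linarith
    from K(2)[OF t'I[of n] tI that(2) this, of "x' n" x] show ?thesis
      unfolding \<gamma>_def[symmetric] e_def using flow_solves(1)[OF \<epsilon> t'I] by simp
  qed
  define B where "B = tube {?c<..<?d} \<gamma> (\<epsilon> + 1)"
  have sub: "{?c..?d} \<subseteq> I" by (rule compact_interval_of_ends[OF cI dI])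
  have \<gamma>J: "continuous_on {?c<..<?d} \<gamma>" by (rule continuous_on_subset[OF \<gamma>c]) (use sub in force)
  have Bopen: "open B" unfolding B_def by (rule open_tube[OF open_greaterThanLessThan \<gamma>J])
  have B\<Omega>: "B \<subseteq> \<Omega>" using sub by (auto simp: B_def tube_def subset_iff)
  have Bfin: "emeasure lebesgue B < \<infinity>"
    unfolding B_def using emeasure_tube[OF open_greaterThanLessThan \<gamma>J, of "\<epsilon> + 1"] \<epsilon> h
    by (simp add: ennreal_mult_less_top)
  have QB: "\<forall>\<^sub>F n in sequentially. Q \<epsilon> (t' n) (x' n) \<subseteq> B"
    using near_t[OF h] near_e[OF zero_less_one]
  proof eventually_elim
    case (elim n)
    show ?case
    proof
      fix z assume z: "z \<in> Q \<epsilon> (t' n) (x' n)"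
      obtain \<tau> y where zy: "z = (\<tau>, y)" by fastforce
      have \<tau>: "\<tau> \<in> {?c<..<?d}" and y: "norm (y - X \<epsilon> (t' n) (x' n) \<tau>) < \<epsilon>"
        using z elim(1) by (auto simp: zy cylinder_def abs_less_iff)
      have "norm (X \<epsilon> (t' n) (x' n) \<tau> - \<gamma> \<tau>) \<le> e n" using \<tau> by (intro dist elim) auto
      then have "norm (y - \<gamma> \<tau>) < \<epsilon> + 1"
        using norm_triangle_ineq[of "y - X \<epsilon> (t' n) (x' n) \<tau>" "X \<epsilon> (t' n) (x' n) \<tau> - \<gamma> \<tau>"] y elim(2) by simp
      then show "z \<in> B" using \<tau> by (simp add: zy B_def tube_def)
    qed
  qed
  let ?g = "\<lambda>z. g z * indicator \<Omega> z"
  have gm[measurable]: "?g \<in> borel_measurable lebesgue" by (rule finite_on_finite_measurable[OF g])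
  have Bm[measurable]: "B \<in> sets lebesgue" using Bopen by (simp add: lmeasurable_open)
  have Qm[measurable]: "Q \<epsilon> (t' n) (x' n) \<in> sets lebesgue" for n by (rule cylinder_measurable[OF \<epsilon> t'r])
  have Qm0[measurable]: "Q \<epsilon> t x \<in> sets lebesgue" by (rule cylinder_measurable[OF \<epsilon> t])
  have off: "AE z in lebesgue. z \<notin> {t - \<epsilon>\<^sup>2} \<times> UNIV \<and> z \<notin> {t + \<epsilon>\<^sup>2} \<times> UNIV \<and> z \<notin> {(\<tau>, y). \<tau> \<in> {?c<..<?d} \<and> norm (y - \<gamma> \<tau>) = \<epsilon>}"
    using AE_not_in[OF time_slice_null[of "t - \<epsilon>\<^sup>2"]] AE_not_in[OF time_slice_null[of "t + \<epsilon>\<^sup>2"]]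
      AE_not_in[OF tube_boundary_null[OF open_greaterThanLessThan \<gamma>J, of \<epsilon>]]
    by eventually_elim blast
  have mem_iff: "\<forall>\<^sub>F n in sequentially. z \<in> Q \<epsilon> (t' n) (x' n) \<longleftrightarrow> z \<in> Q \<epsilon> t x"
    if zoff: "z \<notin> {t - \<epsilon>\<^sup>2} \<times> UNIV \<and> z \<notin> {t + \<epsilon>\<^sup>2} \<times> UNIV \<and> z \<notin> {(\<tau>, y). \<tau> \<in> {?c<..<?d} \<and> norm (y - \<gamma> \<tau>) = \<epsilon>}" for z
  proof -
    obtain \<tau> y where zy: "z = (\<tau>, y)" by fastforce
    consider "\<bar>\<tau> - t\<bar> > \<epsilon>\<^sup>2" | "\<bar>\<tau> - t\<bar> < \<epsilon>\<^sup>2" "norm (y - \<gamma> \<tau>) > \<epsilon>" | "\<bar>\<tau> - t\<bar> < \<epsilon>\<^sup>2" "norm (y - \<gamma> \<tau>) < \<epsilon>"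
    proof -
      have "\<tau> \<noteq> t - \<epsilon>\<^sup>2" "\<tau> \<noteq> t + \<epsilon>\<^sup>2" using zoff by (auto simp: zy)
      then have "\<bar>\<tau> - t\<bar> \<noteq> \<epsilon>\<^sup>2" by linarith
      moreover have "norm (y - \<gamma> \<tau>) \<noteq> \<epsilon>" if "\<bar>\<tau> - t\<bar> < \<epsilon>\<^sup>2"
      proof -
        have "\<tau> \<in> {?c<..<?d}" using that h by (auto simp: abs_less_iff)
        then show ?thesis using zoff by (simp add: zy)
      qed
      ultimately show thesis using that(1,2,3) by (metis linorder_neqE_linordered_idom)
    qed
    then show ?thesis
    proof cases
      case 1
      then have "z \<notin> Q \<epsilon> t x" by (simp add: zy cylinder_def)
      have "\<forall>\<^sub>F n in sequentially. \<bar>t' n - t\<bar> < \<bar>\<tau> - t\<bar> - \<epsilon>\<^sup>2" using 1 by (intro near_t) simp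
      then show ?thesis
        by eventually_elim (use \<open>z \<notin> Q \<epsilon> t x\<close> in \<open>auto simp: zy cylinder_def\<close>)
    next
      case 2
      then have no: "z \<notin> Q \<epsilon> t x" by (simp add: zy cylinder_def \<gamma>_def)
      have \<tau>: "\<tau> \<in> {?c..?d}" using 2(1) h by (auto simp: abs_less_iff)
      have "\<forall>\<^sub>F n in sequentially. e n < norm (y - \<gamma> \<tau>) - \<epsilon>" using 2 by (intro near_e) simp
      then show ?thesis using near_t[OF h]
      proof eventually_elim
        case (elim n)
        have "norm (y - \<gamma> \<tau>) \<le> norm (y - X \<epsilon> (t' n) (x' n) \<tau>) + e n"
          using norm_triangle_ineq[of "y - X \<epsilon> (t' n) (x' n) \<tau>" "X \<epsilon> (t' n) (x' n) \<tau> - \<gamma> \<tau>"] dist[OF elim(2) \<tau>] by simp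
        then show ?case using no elim(1) by (simp add: zy cylinder_def)
      qed
    next
      case 3
      then have yes: "z \<in> Q \<epsilon> t x" by (simp add: zy cylinder_def \<gamma>_def)
      have \<tau>: "\<tau> \<in> {?c..?d}" using 3(1) h by (auto simp: abs_less_iff)
      have "\<forall>\<^sub>F n in sequentially. e n < \<epsilon> - norm (y - \<gamma> \<tau>)" using 3 by (intro near_e) simp
      moreover have "\<forall>\<^sub>F n in sequentially. \<bar>t' n - t\<bar> < \<epsilon>\<^sup>2 - \<bar>\<tau> - t\<bar>" using 3 by (intro near_t) simp
      ultimately show ?thesis using near_t[OF h]
      proof eventually_elim
        case (elim n)
        have "norm (y - X \<epsilon> (t' n) (x' n) \<tau>) \<le> norm (y - \<gamma> \<tau>) + e n"
          using norm_triangle_ineq4[of "y - \<gamma> \<tau>" "X \<epsilon> (t' n) (x' n) \<tau> - \<gamma> \<tau>"] dist[OF elim(3) \<tau>] by simp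
        moreover have "\<bar>\<tau> - t' n\<bar> < \<epsilon>\<^sup>2" using elim(2) by linarith
        ultimately show ?case using yes elim(1) by (simp add: zy cylinder_def)
      qed
    qed
  qed
  have QBt: "Q \<epsilon> t x \<subseteq> B"
  proof
    fix z assume "z \<in> Q \<epsilon> t x"
    then show "z \<in> B" using h by (auto simp: cylinder_def B_def tube_def \<gamma>_def abs_less_iff)
  qed
  have "(\<lambda>n. \<integral>\<^sup>+ z. ?g z * indicator (Q \<epsilon> (t' n) (x' n) \<inter> B) z \<partial>lebesgue) \<longlonglongrightarrow> (\<integral>\<^sup>+ z. ?g z * indicator (Q \<epsilon> t x) z \<partial>lebesgue)"
  proof (rule nn_integral_dominated_convergence[where w = "\<lambda>z. ?g z * indicator B z"])
    show "(\<lambda>z. ?g z * indicator (Q \<epsilon> (t' n) (x' n) \<inter> B) z) \<in> borel_measurable lebesgue" for n by measurable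
    show "(\<lambda>z. ?g z * indicator (Q \<epsilon> t x) z) \<in> borel_measurable lebesgue" by measurable
    show "(\<lambda>z. ?g z * indicator B z) \<in> borel_measurable lebesgue" by measurable
    show "AE z in lebesgue. ?g z * indicator (Q \<epsilon> (t' n) (x' n) \<inter> B) z \<le> ?g z * indicator B z" for n
      by (simp add: indicator_def)
    have "(\<integral>\<^sup>+ z. ?g z * indicator B z \<partial>lebesgue) = (\<integral>\<^sup>+ z\<in>B. g z \<partial>lebesgue)"
      using B\<Omega> by (intro nn_integral_cong) (auto simp: indicator_def)
    also have "\<dots> < \<infinity>" using g B\<Omega> Bfin Bm by (auto simp: finite_on_finite_def)
    finally show "(\<integral>\<^sup>+ z. ?g z * indicator B z \<partial>lebesgue) < \<infinity>" .
    show "AE z in lebesgue. (\<lambda>n. ?g z * indicator (Q \<epsilon> (t' n) (x' n) \<inter> B) z) \<longlonglongrightarrow> ?g z * indicator (Q \<epsilon> t x) z"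
      using off
    proof eventually_elim
      case (elim z)
      have "\<forall>\<^sub>F n in sequentially. ?g z * indicator (Q \<epsilon> (t' n) (x' n) \<inter> B) z = ?g z * indicator (Q \<epsilon> t x) z"
        using mem_iff[OF elim] QB by eventually_elim (use QBt in \<open>auto simp: indicator_def\<close>)
      then show ?case by (rule tendsto_eventually)
    qed
  qed
  moreover have "\<forall>\<^sub>F n in sequentially. (\<integral>\<^sup>+ z. ?g z * indicator (Q \<epsilon> (t' n) (x' n) \<inter> B) z \<partial>lebesgue)
      = (\<integral>\<^sup>+ z\<in>Q \<epsilon> (t' n) (x' n). g z \<partial>lebesgue)"
    using QB
  proof eventually_elim
    case (elim n)
    then show ?case using B\<Omega> by (intro nn_integral_cong) (auto simp: indicator_def)
  qed
  moreover have "(\<integral>\<^sup>+ z. ?g z * indicator (Q \<epsilon> t x) z \<partial>lebesgue) = (\<integral>\<^sup>+ z\<in>Q \<epsilon> t x. g z \<partial>lebesgue)"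
    using cylinder_subset[OF \<epsilon> t] by (intro nn_integral_cong) (auto simp: indicator_def)
  ultimately have "(\<lambda>n. \<integral>\<^sup>+ z\<in>Q \<epsilon> (t' n) (x' n). g z \<partial>lebesgue) \<longlonglongrightarrow> (\<integral>\<^sup>+ z\<in>Q \<epsilon> t x. g z \<partial>lebesgue)"
    by (simp add: tendsto_cong)
  then show "((\<lambda>c. \<integral>\<^sup>+ z\<in>Q \<epsilon> (fst c) (snd c). g z \<partial>lebesgue) \<circ> s) \<longlonglongrightarrow> (\<integral>\<^sup>+ z\<in>Q \<epsilon> (fst c) (snd c). g z \<partial>lebesgue)"
    by (simp add: comp_def tx t'_def x'_def)
qed


text \<open>Accepting functions with values in \<open>[0, \<infinity>]\<close>, for use with truncations.\<close>

definition cyl_max :: "real \<Rightarrow> (real \<times> (real^'n) \<Rightarrow> ennreal) \<Rightarrow> real \<times> (real^'n) \<Rightarrow> ennreal" where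
  "cyl_max \<eta> g c = (SUP \<epsilon>\<in>{\<epsilon>. admissible S T \<phi> u G \<eta> \<epsilon> (fst c) (snd c)}. average (Q \<epsilon> (fst c) (snd c)) g)"

lemma cylinder_maximal_eq: "cylinder_maximal S T \<phi> u G \<eta> f = cyl_max \<eta> (\<lambda>z. ennreal \<bar>f z\<bar>)"
  by (auto simp: fun_eq_iff cylinder_maximal_def cyl_max_def)

lemma average_cylinder_continuous:
  assumes \<epsilon>: "0 < \<epsilon>" and g: "finite_on_finite g"
  shows "continuous_on (centre_range \<epsilon> \<times> UNIV) (\<lambda>c. average (Q \<epsilon> (fst c) (snd c)) g)"
proof -
  let ?m = "measure lborel (ball (0::real^'n) 1) * \<epsilon> ^ CARD('n) * (2 * \<epsilon>\<^sup>2)"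
  have "0 < ?m" using unit_ball_pos[where 'a = "real^'n"] \<epsilon> by simp
  then have "inverse (ennreal ?m) < top" by (simp only: ennreal_inverse_positive inverse_ennreal ennreal_less_top)
  then have "continuous_on (centre_range \<epsilon> \<times> UNIV)
      (\<lambda>c. inverse (ennreal ?m) * (\<integral>\<^sup>+ z\<in>Q \<epsilon> (fst c) (snd c). g z \<partial>lebesgue))"
    by (rule ennreal_continuous_on_cmult[OF _ cylinder_integral_continuous[OF \<epsilon> g]])
  moreover have "inverse (ennreal ?m) * (\<integral>\<^sup>+ z\<in>Q \<epsilon> (fst c) (snd c). g z \<partial>lebesgue) = average (Q \<epsilon> (fst c) (snd c)) g"
    if "c \<in> centre_range \<epsilon> \<times> UNIV" for c
    using that emeasure_cylinder[OF \<epsilon>, of "fst c" "snd c"]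
    by (auto simp: average_def divide_ennreal_def mult.commute)
  ultimately show ?thesis by (rule continuous_on_eq)
qed

text \<open>For a fixed radius, the average of \<open>g\<close> and the average of \<open>\<M>(\<nabla>u)\<close> that decides admissibility are both
  continuous in the centre, so each radius contributes an open set. This is where the integrability of \<open>\<M>(\<nabla>u)\<close> is used.\<close>

lemma open_level_set:
  assumes MG: "finite_on_finite (grad_maximal G)" and g: "finite_on_finite g"
  shows "open {c. \<alpha> < cyl_max \<eta> g c}"
proof -
  let ?U = "\<lambda>\<epsilon>. centre_range \<epsilon> \<times> (UNIV :: (real^'n) set)"
  let ?A = "\<lambda>\<epsilon>. {c \<in> ?U \<epsilon>. ennreal (\<epsilon>\<^sup>2) * average (Q \<epsilon> (fst c) (snd c)) (grad_maximal G) < ennreal \<eta>}"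
  let ?B = "\<lambda>\<epsilon>. {c \<in> ?U \<epsilon>. \<alpha> < average (Q \<epsilon> (fst c) (snd c)) g}"
  have "open (?A \<epsilon> \<inter> ?B \<epsilon>)" if \<epsilon>: "0 < \<epsilon>" for \<epsilon>
  proof -
    have U: "open (?U \<epsilon>)" using open_centre_range by (intro open_Times) auto
    have cA: "continuous_on (?U \<epsilon>) (\<lambda>c. ennreal (\<epsilon>\<^sup>2) * average (Q \<epsilon> (fst c) (snd c)) (grad_maximal G))"
      by (rule ennreal_continuous_on_cmult[OF _ average_cylinder_continuous[OF \<epsilon> MG]]) simp
    have "open (?A \<epsilon>)" using continuous_open_preimage[OF cA U open_lessThan[of "ennreal \<eta>"]] by (simp add: vimage_def Int_def)
    moreover have "open (?B \<epsilon>)"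
      using continuous_open_preimage[OF average_cylinder_continuous[OF \<epsilon> g] U open_greaterThan[of \<alpha>]] by (simp add: vimage_def Int_def)
    ultimately show ?thesis by (rule open_Int)
  qed
  then have "open (\<Union>\<epsilon>\<in>{0<..}. ?A \<epsilon> \<inter> ?B \<epsilon>)" by auto
  also have "(\<Union>\<epsilon>\<in>{0<..}. ?A \<epsilon> \<inter> ?B \<epsilon>) = {c. \<alpha> < cyl_max \<eta> g c}"
    by (auto simp: cyl_max_def less_SUP_iff admissible_def centre_range_def)
  finally show ?thesis .
qed

lemma cyl_max_measurable:
  assumes MG: "finite_on_finite (grad_maximal G)" and g: "finite_on_finite g"
  shows "cyl_max \<eta> g \<in> borel_measurable (lebesgue_on \<Omega>)"
proof (rule borel_measurableI_greater)
  fix \<alpha>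
  have "{c. \<alpha> < cyl_max \<eta> g c} \<in> sets lebesgue" using open_level_set[OF MG g] by (simp add: lmeasurable_open)
  then have "{c. \<alpha> < cyl_max \<eta> g c} \<inter> \<Omega> \<in> sets lebesgue" using \<Omega>_measurable by (rule sets.Int)
  moreover have "{c \<in> space (lebesgue_on \<Omega>). \<alpha> < cyl_max \<eta> g c} = {c. \<alpha> < cyl_max \<eta> g c} \<inter> \<Omega>"
    by (auto simp: space_restrict_space)
  ultimately show "{c \<in> space (lebesgue_on \<Omega>). \<alpha> < cyl_max \<eta> g c} \<in> sets (lebesgue_on \<Omega>)"
    using \<Omega>_measurable by (simp add: sets_restrict_space_iff)
qed

lemma cyl_max_le_esssup:
  assumes "g \<in> borel_measurable (lebesgue_on \<Omega>)"
  shows "cyl_max \<eta> g c \<le> esssup (lebesgue_on \<Omega>) g"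
  unfolding cyl_max_def
proof (rule SUP_least)
  fix \<epsilon> assume "\<epsilon> \<in> {\<epsilon>. admissible S T \<phi> u G \<eta> \<epsilon> (fst c) (snd c)}"
  then have a: "0 < \<epsilon>" "fst c \<in> centre_range \<epsilon>" using admissibleD by auto
  let ?Q = "Q \<epsilon> (fst c) (snd c)" and ?K = "esssup (lebesgue_on \<Omega>) g"
  have Qm: "?Q \<in> sets lebesgue" by (rule cylinder_measurable[OF a])
  have "AE z in lebesgue_on \<Omega>. g z \<le> ?K" by (rule esssup_AE)
  then have "AE z in lebesgue. z \<in> \<Omega> \<longrightarrow> g z \<le> ?K"
    using \<Omega>_measurable by (subst (asm) AE_restrict_space_iff) auto
  then have "(\<integral>\<^sup>+ z\<in>?Q. g z \<partial>lebesgue) \<le> (\<integral>\<^sup>+ z. ?K * indicator ?Q z \<partial>lebesgue)"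
    using cylinder_subset[OF a, of "snd c"]
    by (intro nn_integral_mono_AE) (auto elim!: eventually_mono simp: indicator_def)
  also have "\<dots> = ?K * emeasure lebesgue ?Q" using Qm by (rule nn_integral_cmult_indicator)
  finally have "average ?Q g \<le> ?K * emeasure lebesgue ?Q / emeasure lebesgue ?Q"
    unfolding average_def by (rule divide_right_mono_ennreal)
  also have "\<dots> = ?K"
    using emeasure_cylinder_pos[OF a, of "snd c"] by (intro ennreal_mult_divide_eq) auto
  finally show "average ?Q g \<le> ?K" .
qed

text \<open>A compact part of the level set is covered by finitely many admissible cylinders with average above \<open>\<alpha>\<close>. By the
  engulfing property the enlargements of disjoint ones among them cover as well, and an enlargement has \<open>3 \<cdot> 5\<^sup>n\<close> times
  the measure of the cylinder.\<close>

lemma cyl_max_weak_type: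
  fixes B K :: real
  assumes B: "0 \<le> B" "\<And>x. \<phi> x \<le> B"
    and K: "CARD('n) * B * measure lborel (ball (0::real^'n) 1) * 6 ^ CARD('n) \<le> K" "0 < K"
    and \<eta>: "0 \<le> \<eta>" "10 * K * \<eta> \<le> 1"
    and MG: "finite_on_finite (grad_maximal G)" and g: "finite_on_finite g" and \<alpha>: "0 < \<alpha>"
  shows "emeasure lebesgue {c \<in> \<Omega>. ennreal \<alpha> < cyl_max \<eta> g c}
    \<le> ennreal (3 * 5 ^ CARD('n) / \<alpha>) * (\<integral>\<^sup>+ z. g z \<partial>(lebesgue_on \<Omega>))"
proof -
  let ?L = "{c \<in> \<Omega>. ennreal \<alpha> < cyl_max \<eta> g c}" and ?k = "3 * 5 ^ CARD('n) :: real"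
  have "?L = \<Omega> \<inter> {c. ennreal \<alpha> < cyl_max \<eta> g c}" by blast
  then have L: "open ?L" using open_\<Omega> open_level_set[OF MG g] by (simp only: open_Int)
  have "\<forall>c\<in>?L. \<exists>\<epsilon>. admissible S T \<phi> u G \<eta> \<epsilon> (fst c) (snd c) \<and> ennreal \<alpha> < average (Q \<epsilon> (fst c) (snd c)) g"
    by (auto simp: cyl_max_def less_SUP_iff)
  from bchoice[OF this] obtain r where
    r': "\<forall>c\<in>?L. admissible S T \<phi> u G \<eta> (r c) (fst c) (snd c) \<and> ennreal \<alpha> < average (Q (r c) (fst c) (snd c)) g" ..
  have adm: "admissible S T \<phi> u G \<eta> (r c) (fst c) (snd c)"
    and avg: "ennreal \<alpha> < average (Q (r c) (fst c) (snd c)) g" if "c \<in> ?L" for c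
    using bspec[OF r' that] by auto
  define Qc where "Qc c = Q (r c) (fst c) (snd c)" for c
  have r: "0 < r c" "fst c \<in> centre_range (r c)" if "c \<in> ?L" for c
    using admissibleD(1,2)[OF adm[OF that]] .
  have small: "emeasure lebesgue (Qc c) \<le> ennreal (1 / \<alpha>) * (\<integral>\<^sup>+ z\<in>Qc c. g z \<partial>lebesgue)" if c: "c \<in> ?L" for c
  proof -
    have pos: "emeasure lebesgue (Qc c) \<noteq> 0" "emeasure lebesgue (Qc c) \<noteq> top"
      using emeasure_cylinder_pos[OF r[OF c], of "snd c"] by (auto simp: Qc_def)
    have "ennreal \<alpha> * emeasure lebesgue (Qc c) \<le> average (Qc c) g * emeasure lebesgue (Qc c)"
      using avg[OF c] by (intro mult_right_mono) (auto simp: Qc_def)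
    also have "\<dots> = (\<integral>\<^sup>+ z\<in>Qc c. g z \<partial>lebesgue)"
    proof -
      have "emeasure lebesgue (Qc c) / emeasure lebesgue (Qc c) = 1"
        by (rule ennreal_divide_self) (use pos in \<open>simp_all only: less_top not_False_eq_True\<close>)
      then show ?thesis unfolding average_def ennreal_divide_times by (simp only: mult_1_right)
    qed
    finally have "ennreal (1 / \<alpha>) * (ennreal \<alpha> * emeasure lebesgue (Qc c)) \<le> ennreal (1 / \<alpha>) * (\<integral>\<^sup>+ z\<in>Qc c. g z \<partial>lebesgue)"
      by (rule mult_left_mono) simp
    moreover have "ennreal (1 / \<alpha>) * ennreal \<alpha> = 1" using \<alpha> by (simp add: ennreal_mult''[symmetric])
    ultimately show ?thesis by (simp only: mult.assoc[symmetric] mult_1)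
  qed
  have compact_le: "emeasure lebesgue C \<le> ennreal (?k / \<alpha>) * (\<integral>\<^sup>+ z. g z \<partial>(lebesgue_on \<Omega>))"
    if C: "compact C" "C \<subseteq> ?L" for C
  proof -
    have "C \<subseteq> (\<Union>c\<in>C. Qc c)"
      using C(2) centre_in_cylinder[OF r] by (force simp: Qc_def)
    moreover have "open (Qc c)" if "c \<in> C" for c
      unfolding Qc_def using that C(2) by (intro cylinder_open r) auto
    ultimately obtain F where F: "F \<subseteq> C" "finite F" "C \<subseteq> (\<Union>c\<in>F. Qc c)"
      using compactE_image[OF C(1)] by metis
    have FL: "c \<in> ?L" if "c \<in> F" for c using that F(1) C(2) by blast
    have Qm: "Qc c \<in> sets lebesgue" if "c \<in> F" for c
      unfolding Qc_def by (rule cylinder_measurable[OF r[OF FL[OF that]]])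
    have "\<exists>F'\<subseteq>F. disjoint_family_on Qc F' \<and>
        emeasure lebesgue (\<Union>c\<in>F. Qc c) \<le> ennreal ?k * (\<Sum>c\<in>F'. emeasure lebesgue (Qc c))"
    proof (rule vitali_finite_selection[where r = r and E = "\<lambda>c. enlarged_cylinder (r c) (fst c) (snd c)", OF F(2) Qm])
      show "enlarged_cylinder (r c) (fst c) (snd c) \<in> sets lebesgue"
        "emeasure lebesgue (enlarged_cylinder (r c) (fst c) (snd c)) \<le> ennreal ?k * emeasure lebesgue (Qc c)" if "c \<in> F" for c
        unfolding Qc_def by (rule enlarged_cylinder_facts[OF r[OF FL[OF that]]])+
      show "Qc c' \<subseteq> enlarged_cylinder (r c) (fst c) (snd c)"
        if "c \<in> F" "c' \<in> F" "r c' \<le> r c" "Qc c' \<inter> Qc c \<noteq> {}" for c c'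
        unfolding Qc_def
        by (rule engulfing[OF B K \<eta> adm[OF FL[OF that(2)]] that(3) lifetime_subset(3)[OF r(2)[OF FL[OF that(1)]]] that(4)[unfolded Qc_def]])
    qed
    then obtain F' where F': "F' \<subseteq> F" "disjoint_family_on Qc F'"
      and le: "emeasure lebesgue (\<Union>c\<in>F. Qc c) \<le> ennreal ?k * (\<Sum>c\<in>F'. emeasure lebesgue (Qc c))" by blast
    have finF': "finite F'" using F'(1) F(2) by (rule finite_subset)
    have "emeasure lebesgue C \<le> emeasure lebesgue (\<Union>c\<in>F. Qc c)"
      using F(2,3) Qm by (intro emeasure_mono sets.finite_UN) auto
    also note le
    also have "(\<Sum>c\<in>F'. emeasure lebesgue (Qc c)) \<le> (\<Sum>c\<in>F'. ennreal (1 / \<alpha>) * (\<integral>\<^sup>+ z\<in>Qc c. g z \<partial>lebesgue))"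
      using F'(1) FL by (intro sum_mono small) auto
    also have "\<dots> = ennreal (1 / \<alpha>) * (\<Sum>c\<in>F'. \<integral>\<^sup>+ z. (g z * indicator \<Omega> z) * indicator (Qc c) z \<partial>lebesgue)"
    proof -
      have "(\<integral>\<^sup>+ z\<in>Qc c. g z \<partial>lebesgue) = (\<integral>\<^sup>+ z. (g z * indicator \<Omega> z) * indicator (Qc c) z \<partial>lebesgue)" if "c \<in> F'" for c
      proof (rule nn_integral_cong)
        have "c \<in> ?L" using FL F'(1) that by blast
        then have "Qc c \<subseteq> \<Omega>" unfolding Qc_def by (intro cylinder_subset r)
        then show "g z * indicator (Qc c) z = g z * indicator \<Omega> z * indicator (Qc c) z" for z
          by (auto simp: indicator_def)
      qed
      then show ?thesis by (simp add: sum_distrib_left)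
    qed
    also have "(\<Sum>c\<in>F'. \<integral>\<^sup>+ z. (g z * indicator \<Omega> z) * indicator (Qc c) z \<partial>lebesgue)
        = (\<integral>\<^sup>+ z. (\<Sum>c\<in>F'. (g z * indicator \<Omega> z) * indicator (Qc c) z) \<partial>lebesgue)"
      using F'(1) Qm
      by (intro nn_integral_sum[symmetric] borel_measurable_times_ennreal[OF finite_on_finite_measurable[OF g]] borel_measurable_indicator)
        blast
    also have "\<dots> \<le> (\<integral>\<^sup>+ z. g z * indicator \<Omega> z \<partial>lebesgue)"
    proof (rule nn_integral_mono)
      fix z
      have "(\<Sum>c\<in>F'. indicator (Qc c) z) = (indicator (\<Union>c\<in>F'. Qc c) z :: ennreal)"
        using F'(2) finF' by (intro indicator_UN_disjoint[symmetric]) auto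
      also have "\<dots> \<le> 1" by (simp add: indicator_def)
      finally have "(g z * indicator \<Omega> z) * (\<Sum>c\<in>F'. indicator (Qc c) z) \<le> (g z * indicator \<Omega> z) * 1"
        by (rule mult_left_mono) simp
      then show "(\<Sum>c\<in>F'. (g z * indicator \<Omega> z) * indicator (Qc c) z) \<le> g z * indicator \<Omega> z"
        by (simp add: sum_distrib_left)
    qed
    also have "(\<integral>\<^sup>+ z. g z * indicator \<Omega> z \<partial>lebesgue) = (\<integral>\<^sup>+ z. g z \<partial>(lebesgue_on \<Omega>))"
      using \<Omega>_measurable by (intro nn_integral_restrict_space[symmetric]) auto
    finally have "emeasure lebesgue C \<le> ennreal ?k * (ennreal (1 / \<alpha>) * (\<integral>\<^sup>+ z. g z \<partial>(lebesgue_on \<Omega>)))"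
      by (simp add: mult_left_mono)
    also have "\<dots> = ennreal (?k / \<alpha>) * (\<integral>\<^sup>+ z. g z \<partial>(lebesgue_on \<Omega>))"
      unfolding mult.assoc[symmetric] using \<alpha> by (simp add: ennreal_mult''[symmetric])
    finally show ?thesis .
  qed
  obtain C where C: "\<And>n. compact (C n)" "\<And>n. C n \<subseteq> ?L" "incseq C" "(\<Union>n. C n) = ?L"
    using open_compact_exhaustion[OF L] by blast
  have "range C \<subseteq> sets lebesgue" using C(1) by (auto simp: lmeasurable_compact fmeasurableD)
  then have "emeasure lebesgue ?L = (SUP n. emeasure lebesgue (C n))"
    using SUP_emeasure_incseq[of C lebesgue] C(3,4) by simp
  also have "\<dots> \<le> ennreal (?k / \<alpha>) * (\<integral>\<^sup>+ z. g z \<partial>(lebesgue_on \<Omega>))"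
    by (rule SUP_least) (rule compact_le[OF C(1,2)])
  finally show ?thesis .
qed

lemma cyl_max_mono:
  assumes "\<And>z. g z \<le> h z" shows "cyl_max \<eta> g c \<le> cyl_max \<eta> h c"
  unfolding cyl_max_def average_def using assms
  by (intro SUP_mono' divide_right_mono_ennreal nn_integral_mono mult_right_mono) auto

lemma cyl_max_add_const:
  assumes g: "g \<in> borel_measurable (lebesgue_on \<Omega>)"
  shows "cyl_max \<eta> (\<lambda>z. g z + k) c \<le> cyl_max \<eta> g c + k"
  unfolding cyl_max_def
proof (rule SUP_least)
  fix \<epsilon> assume e: "\<epsilon> \<in> {\<epsilon>. admissible S T \<phi> u G \<eta> \<epsilon> (fst c) (snd c)}"
  then have a: "0 < \<epsilon>" "fst c \<in> centre_range \<epsilon>" using admissibleD by auto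
  let ?Q = "Q \<epsilon> (fst c) (snd c)"
  have Qm: "?Q \<in> sets lebesgue" by (rule cylinder_measurable[OF a])
  have pos: "emeasure lebesgue ?Q \<noteq> 0" "emeasure lebesgue ?Q \<noteq> top"
    using emeasure_cylinder_pos[OF a, of "snd c"] by auto
  have gm: "(\<lambda>z. g z * indicator \<Omega> z) \<in> borel_measurable lebesgue"
    using g borel_measurable_restrict_space_iff_ennreal[of \<Omega> lebesgue g] \<Omega>_measurable by simp
  have eq: "(g z + k) * indicator ?Q z = (g z * indicator \<Omega> z) * indicator ?Q z + k * indicator ?Q z" for z
    using cylinder_subset[OF a, of "snd c"] by (auto simp: indicator_def)
  have "(\<integral>\<^sup>+ z\<in>?Q. (g z + k) \<partial>lebesgue) = (\<integral>\<^sup>+ z. (g z * indicator \<Omega> z) * indicator ?Q z \<partial>lebesgue) + k * emeasure lebesgue ?Q"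
    unfolding eq using gm Qm by (simp add: nn_integral_add nn_integral_cmult_indicator)
  also have "(\<integral>\<^sup>+ z. (g z * indicator \<Omega> z) * indicator ?Q z \<partial>lebesgue) = (\<integral>\<^sup>+ z\<in>?Q. g z \<partial>lebesgue)"
    using cylinder_subset[OF a, of "snd c"] by (intro nn_integral_cong) (auto simp: indicator_def)
  finally have "average ?Q (\<lambda>z. g z + k) = average ?Q g + k"
    unfolding average_def using ennreal_mult_divide_eq[OF pos, of k] by (simp add: add_divide_distrib_ennreal)
  also have "\<dots> \<le> (SUP \<epsilon>\<in>{\<epsilon>. admissible S T \<phi> u G \<eta> \<epsilon> (fst c) (snd c)}. average (Q \<epsilon> (fst c) (snd c)) g) + k"
    by (rule add_right_mono[OF SUP_upper[OF e]])
  finally show "average ?Q (\<lambda>z. g z + k) \<le> \<dots>" .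
qed

end


section \<open>Interpolation\<close>

lemma ennreal_powr_mono:
  assumes "a \<le> b" "0 \<le> r" shows "ennreal_powr a r \<le> ennreal_powr b r"
proof (cases "b = \<infinity>")
  case True
  then show ?thesis by (simp add: ennreal_powr_def)
next
  case False
  then have "a \<noteq> \<infinity>" using assms(1) by (auto simp: top_unique)
  moreover have "enn2real a \<le> enn2real b" using assms(1) False by (simp add: enn2real_mono less_top)
  ultimately show ?thesis using False assms(2) by (simp add: ennreal_powr_def ennreal_leI powr_mono2)
qed

lemma ennreal_powr_cmult:
  assumes "0 < c" "0 < r" shows "ennreal_powr (ennreal c * x) r = ennreal (c powr r) * ennreal_powr x r"
proof (cases x)
  case (real y)
  then show ?thesis using assms
    by (simp add: ennreal_powr_def ennreal_mult''[symmetric] ennreal_mult_less_top powr_mult)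
next
  case top
  have "ennreal c \<noteq> 0" "ennreal (c powr r) \<noteq> 0" using assms by (simp_all add: ennreal_eq_0_iff)
  then show ?thesis unfolding top by (simp add: ennreal_powr_def ennreal_mult_top)
qed

lemma nn_integral_powr_from_0:
  fixes p c :: real
  assumes p: "0 < p" and c: "0 \<le> c"
  shows "(\<integral>\<^sup>+ \<alpha>. ennreal (p * \<alpha> powr (p - 1)) * indicator {0..c} \<alpha> \<partial>lborel) = ennreal (c powr p)"
proof (rule nn_integral_has_integral_lebesgue')
  have "((\<lambda>\<alpha>. p * \<alpha> powr (p - 1)) has_integral p * (c powr ((p - 1) + 1) / ((p - 1) + 1))) {0..c}"
    using p c by (intro has_integral_mult_right has_integral_powr_from_0) auto
  then show "((\<lambda>\<alpha>. p * \<alpha> powr (p - 1)) has_integral c powr p) {0..c}" using p by simp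
qed (use p in auto)

text \<open>The layers under \<open>w\<close>, weighted so that they add up to \<open>w\<close> to the power \<open>p\<close>.\<close>

definition layer :: "real \<Rightarrow> ennreal \<Rightarrow> real \<Rightarrow> ennreal" where
  "layer p w \<alpha> = (if 0 \<le> \<alpha> \<and> ennreal \<alpha> < w then ennreal (p * \<alpha> powr (p - 1)) else 0)"

lemma layer_cake_pointwise:
  fixes p :: real
  assumes p: "0 < p"
  shows "(\<integral>\<^sup>+ \<alpha>. layer p w \<alpha> \<partial>lborel) = ennreal_powr w p"
    (is "?L w = _")
proof (cases w)
  case (real c)
  have "?L w = (\<integral>\<^sup>+ \<alpha>. ennreal (p * \<alpha> powr (p - 1)) * indicator {0..c} \<alpha> \<partial>lborel)"
  proof (rule nn_integral_cong_AE)
    have "AE \<alpha> in lborel. \<alpha> \<noteq> c" by (rule AE_lborel_singleton)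
    then show "AE \<alpha> in lborel. layer p w \<alpha>
        = ennreal (p * \<alpha> powr (p - 1)) * indicator {0..c} \<alpha>"
      by eventually_elim (use real in \<open>auto simp: layer_def indicator_def ennreal_less_iff\<close>)
  qed
  then show ?thesis using nn_integral_powr_from_0[OF p real(1)] real by (simp add: ennreal_powr_def)
next
  case top
  have le: "ennreal (c powr p) \<le> ?L w" if c: "0 \<le> c" for c
    unfolding nn_integral_powr_from_0[OF p c, symmetric] top
    by (intro nn_integral_mono) (auto simp: layer_def indicator_def)
  have ge: "ennreal x \<le> ?L w" if "0 \<le> x" for x
  proof -
    have "(x powr (1 / p)) powr p = x" using that p by (simp add: powr_powr)
    then show ?thesis using le[of "x powr (1 / p)"] by simp
  qed
  have "?L w = top"
  proof (rule ccontr)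
    assume "?L w \<noteq> top"
    then obtain x where x: "?L w = ennreal x" "0 \<le> x" by (cases "?L w") auto
    then show False using ge[of "x + 1"] by (simp add: ennreal_le_iff)
  qed
  then show ?thesis unfolding top by (simp add: ennreal_powr_def)
qed

text \<open>Marcinkiewicz interpolation. The assumption on level sets is what the weak type \<open>(1,1)\<close> bound yields for the part of
  \<open>F\<close> above \<open>\<alpha> / 2\<close>; the part below contributes at most \<open>\<alpha> / 2\<close> to \<open>W\<close>. Integrating against \<open>q \<alpha>\<^sup>q\<^sup>-\<^sup>1\<close> and exchanging the
  integrals leaves the layers of \<open>2 F\<close> with exponent \<open>q - 1\<close>.\<close>

lemma strong_type_of_level_sets:
  fixes W F :: "'a \<Rightarrow> ennreal" and A q :: real
  assumes M: "sigma_finite_measure M" and W[measurable]: "W \<in> borel_measurable M" and F[measurable]: "F \<in> borel_measurable M"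
    and q: "1 < q" and A: "0 \<le> A"
    and weak: "\<And>\<alpha>. 0 < \<alpha> \<Longrightarrow> emeasure M {z \<in> space M. ennreal \<alpha> < W z}
      \<le> ennreal (A / \<alpha>) * (\<integral>\<^sup>+ z. (if ennreal \<alpha> < 2 * F z then F z else 0) \<partial>M)"
  shows "(\<integral>\<^sup>+ z. ennreal_powr (W z) q \<partial>M)
    \<le> ennreal (A * q / (q - 1) * 2 powr (q - 1)) * (\<integral>\<^sup>+ z. ennreal_powr (F z) q \<partial>M)"
proof -
  interpret M: sigma_finite_measure M by (rule M)
  interpret P: pair_sigma_finite M "lborel :: real measure" ..
  have 1: "(\<lambda>(z, \<alpha>). layer q (W z) \<alpha>)
      \<in> borel_measurable (M \<Otimes>\<^sub>M lborel)" unfolding layer_def by measurable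
  have 2: "(\<lambda>(z, \<alpha>). F z * layer (q - 1) (2 * F z) \<alpha>)
      \<in> borel_measurable (M \<Otimes>\<^sub>M lborel)" unfolding layer_def by measurable
  let ?c = "A * q / (q - 1)"
  have c: "0 \<le> ?c" using A q by simp
  have "(\<integral>\<^sup>+ z. ennreal_powr (W z) q \<partial>M)
      = (\<integral>\<^sup>+ z. \<integral>\<^sup>+ \<alpha>. layer q (W z) \<alpha> \<partial>lborel \<partial>M)"
    using q by (simp add: layer_cake_pointwise)
  also have "\<dots> = (\<integral>\<^sup>+ \<alpha>. \<integral>\<^sup>+ z. layer q (W z) \<alpha> \<partial>M \<partial>lborel)"
    by (rule P.Fubini'[OF 1, symmetric])
  also have "\<dots> \<le> (\<integral>\<^sup>+ \<alpha>. ennreal ?c * (\<integral>\<^sup>+ z. F z * layer (q - 1) (2 * F z) \<alpha> \<partial>M) \<partial>lborel)"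
  proof (rule nn_integral_mono)
    fix \<alpha> :: real
    show "(\<integral>\<^sup>+ z. layer q (W z) \<alpha> \<partial>M)
      \<le> ennreal ?c * (\<integral>\<^sup>+ z. F z * layer (q - 1) (2 * F z) \<alpha> \<partial>M)"
    proof (cases "0 < \<alpha>")
      case True
      let ?w = "\<integral>\<^sup>+ z. (if ennreal \<alpha> < 2 * F z then F z else 0) \<partial>M"
      have "(\<integral>\<^sup>+ z. layer q (W z) \<alpha> \<partial>M)
          = (\<integral>\<^sup>+ z. ennreal (q * \<alpha> powr (q - 1)) * indicator {z \<in> space M. ennreal \<alpha> < W z} z \<partial>M)"
        using True by (intro nn_integral_cong) (auto simp: layer_def indicator_def)
      also have "\<dots> = ennreal (q * \<alpha> powr (q - 1)) * emeasure M {z \<in> space M. ennreal \<alpha> < W z}"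
        by (rule nn_integral_cmult_indicator) measurable
      also have "\<dots> \<le> ennreal (q * \<alpha> powr (q - 1)) * (ennreal (A / \<alpha>) * ?w)"
        by (intro mult_left_mono weak True) simp
      also have "\<dots> = ennreal (q * \<alpha> powr (q - 1) * (A / \<alpha>)) * ?w"
        unfolding mult.assoc[symmetric] using A True by (simp add: ennreal_mult''[symmetric])
      also have "q * \<alpha> powr (q - 1) * (A / \<alpha>) = ?c * ((q - 1) * \<alpha> powr (q - 1 - 1))"
      proof -
        define P where "P = \<alpha> powr (q - 1)"
        have "\<alpha> powr (q - 1 - 1) = P / \<alpha>" using powr_diff[of \<alpha> "q - 1" 1] True by (simp add: P_def)
        moreover have "q - 1 \<noteq> 0" using q by simp
        ultimately show ?thesis unfolding P_def[symmetric] by simp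
      qed
      also have "ennreal (?c * ((q - 1) * \<alpha> powr (q - 1 - 1))) = ennreal ?c * ennreal ((q - 1) * \<alpha> powr (q - 1 - 1))"
        using q by (intro ennreal_mult'') simp
      also have "\<dots> * ?w = ennreal ?c * (ennreal ((q - 1) * \<alpha> powr (q - 1 - 1)) * ?w)" by (rule mult.assoc)
      also have "ennreal ((q - 1) * \<alpha> powr (q - 1 - 1)) * ?w
          = (\<integral>\<^sup>+ z. ennreal ((q - 1) * \<alpha> powr (q - 1 - 1)) * (if ennreal \<alpha> < 2 * F z then F z else 0) \<partial>M)"
        by (rule nn_integral_cmult[symmetric]) measurable
      also have "\<dots> = (\<integral>\<^sup>+ z. F z * layer (q - 1) (2 * F z) \<alpha> \<partial>M)"
        using True by (intro nn_integral_cong) (auto simp: layer_def mult.commute)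
      finally show ?thesis .
    next
      case False
      then have "layer q (W z) \<alpha> = 0" for z by (auto simp: layer_def)
      then show ?thesis by simp
    qed
  qed
  also have "\<dots> = ennreal ?c * (\<integral>\<^sup>+ \<alpha>. \<integral>\<^sup>+ z. F z * layer (q - 1) (2 * F z) \<alpha> \<partial>M \<partial>lborel)"
  proof (rule nn_integral_cmult)
    have "(\<lambda>(\<alpha>, z). F z * layer (q - 1) (2 * F z) \<alpha>)
      \<in> borel_measurable (lborel \<Otimes>\<^sub>M M)" unfolding layer_def by measurable
    then show "(\<lambda>\<alpha>. \<integral>\<^sup>+ z. F z * layer (q - 1) (2 * F z) \<alpha> \<partial>M) \<in> borel_measurable lborel"
      by (rule M.borel_measurable_nn_integral)
  qed
  also have "(\<integral>\<^sup>+ \<alpha>. \<integral>\<^sup>+ z. F z * layer (q - 1) (2 * F z) \<alpha> \<partial>M \<partial>lborel)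
      = (\<integral>\<^sup>+ z. \<integral>\<^sup>+ \<alpha>. F z * layer (q - 1) (2 * F z) \<alpha> \<partial>lborel \<partial>M)"
    by (rule P.Fubini'[OF 2])
  also have "\<dots> = (\<integral>\<^sup>+ z. ennreal (2 powr (q - 1)) * ennreal_powr (F z) q \<partial>M)"
  proof (rule nn_integral_cong)
    fix z
    have "(\<integral>\<^sup>+ \<alpha>. F z * layer (q - 1) (2 * F z) \<alpha> \<partial>lborel)
        = F z * (\<integral>\<^sup>+ \<alpha>. layer (q - 1) (2 * F z) \<alpha> \<partial>lborel)"
      by (rule nn_integral_cmult) (unfold layer_def, measurable)
    also have "\<dots> = F z * ennreal_powr (2 * F z) (q - 1)"
      using q layer_cake_pointwise[of "q - 1" "2 * F z"] by simp
    also have "ennreal_powr (2 * F z) (q - 1) = ennreal (2 powr (q - 1)) * ennreal_powr (F z) (q - 1)"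
      using ennreal_powr_cmult[of 2 "q - 1" "F z"] q by simp
    also have "F z * \<dots> = ennreal (2 powr (q - 1)) * (F z * ennreal_powr (F z) (q - 1))" by (rule mult.left_commute)
    also have "F z * ennreal_powr (F z) (q - 1) = ennreal_powr (F z) q"
    proof (cases "F z")
      case (real x)
      have "x * x powr (q - 1) = x powr q"
        using real q by (cases "x = 0") (auto simp: powr_diff)
      then show ?thesis using real by (simp add: ennreal_powr_def ennreal_mult''[symmetric])
    next
      case top
      then show ?thesis by (simp add: ennreal_powr_def ennreal_top_mult)
    qed
    finally show "(\<integral>\<^sup>+ \<alpha>. F z * layer (q - 1) (2 * F z) \<alpha> \<partial>lborel)
        = ennreal (2 powr (q - 1)) * ennreal_powr (F z) q" .
  qed
  also have "\<dots> = ennreal (2 powr (q - 1)) * (\<integral>\<^sup>+ z. ennreal_powr (F z) q \<partial>M)"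
    by (rule nn_integral_cmult) (unfold ennreal_powr_def, measurable)
  also have "ennreal ?c * \<dots> = ennreal (?c * 2 powr (q - 1)) * (\<integral>\<^sup>+ z. ennreal_powr (F z) q \<partial>M)"
    unfolding mult.assoc[symmetric] by (simp add: ennreal_mult''[symmetric])
  finally show ?thesis .
qed

lemma sigma_finite_lebesgue: "sigma_finite_measure (lebesgue :: 'a::euclidean_space measure)"
proof
  show "\<exists>A. countable A \<and> A \<subseteq> sets (lebesgue :: 'a measure) \<and> \<Union> A = space lebesgue \<and> (\<forall>a\<in>A. emeasure lebesgue a \<noteq> \<infinity>)"
  proof (intro exI[of _ "range (\<lambda>n::nat. cball (0::'a) (real n))"] conjI ballI)
    show "\<Union> (range (\<lambda>n::nat. cball (0::'a) (real n))) = space lebesgue"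
      using real_arch_simple by auto
    show "emeasure lebesgue a \<noteq> \<infinity>" if "a \<in> range (\<lambda>n::nat. cball (0::'a) (real n))" for a
      using that emeasure_lborel_cball_finite[of "0::'a"] by (auto simp: less_top[symmetric])
  qed auto
qed

context sobolev_flow
begin

lemma sigma_finite_\<Omega>: "sigma_finite_measure (lebesgue_on \<Omega>)"
  by (rule sigma_finite_measure_restrict_space[OF sigma_finite_lebesgue \<Omega>_measurable])

lemma cyl_max_strong_type:
  fixes B K q :: real
  assumes B: "0 \<le> B" "\<And>x. \<phi> x \<le> B"
    and K: "CARD('n) * B * measure lborel (ball (0::real^'n) 1) * 6 ^ CARD('n) \<le> K" "0 < K"
    and \<eta>: "0 \<le> \<eta>" "10 * K * \<eta> \<le> 1"
    and MG: "finite_on_finite (grad_maximal G)" and F: "finite_on_finite F" and q: "1 < q"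
  shows "Lp_norm (ennreal q) (lebesgue_on \<Omega>) (cyl_max \<eta> F)
    \<le> ennreal ((6 * 5 ^ CARD('n) * q / (q - 1) * 2 powr (q - 1)) powr (1 / q)) * Lp_norm (ennreal q) (lebesgue_on \<Omega>) F"
proof -
  \<comment> \<open>Twice the constant of the weak type bound, which is applied at the level \<open>\<alpha> / 2\<close>.\<close>
  let ?M = "lebesgue_on \<Omega>" and ?A = "6 * 5 ^ CARD('n) :: real"
  let ?c = "?A * q / (q - 1) * 2 powr (q - 1)"
  have Fm[measurable]: "F \<in> borel_measurable ?M" using F by (simp add: finite_on_finite_def)
  have c: "0 < ?c" using q by simp
  have "(\<integral>\<^sup>+ z. ennreal_powr (cyl_max \<eta> F z) q \<partial>?M) \<le> ennreal ?c * (\<integral>\<^sup>+ z. ennreal_powr (F z) q \<partial>?M)"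
  proof (rule strong_type_of_level_sets[OF sigma_finite_\<Omega> cyl_max_measurable[OF MG F] Fm q])
    fix \<alpha> :: real assume \<alpha>: "0 < \<alpha>"
    define F1 where "F1 z = (if ennreal \<alpha> < 2 * F z then F z else 0)" for z
    have F1m: "F1 \<in> borel_measurable ?M" unfolding F1_def[abs_def] by measurable
    have F1: "finite_on_finite F1"
      unfolding finite_on_finite_def
    proof (intro conjI ballI impI F1m)
      fix A assume A: "A \<in> sets lebesgue" "A \<subseteq> \<Omega>" "emeasure lebesgue A < \<infinity>"
      have "(\<integral>\<^sup>+ z\<in>A. F1 z \<partial>lebesgue) \<le> (\<integral>\<^sup>+ z\<in>A. F z \<partial>lebesgue)"
        by (intro nn_integral_mono mult_right_mono) (auto simp: F1_def)
      also have "\<dots> < \<infinity>" using F A by (auto simp: finite_on_finite_def)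
      finally show "(\<integral>\<^sup>+ z\<in>A. F1 z \<partial>lebesgue) < \<infinity>" .
    qed
    have half: "2 * ennreal (\<alpha> / 2) = ennreal \<alpha>" using \<alpha> ennreal_mult''[of "\<alpha> / 2" 2] by simp
    have F_le: "F z \<le> F1 z + ennreal (\<alpha> / 2)" for z
    proof (cases "ennreal \<alpha> < 2 * F z")
      case False
      then have "2 * F z \<le> 2 * ennreal (\<alpha> / 2)" unfolding half by simp
      then have "F z \<le> ennreal (\<alpha> / 2)" by (simp add: ennreal_mult_le_mult_iff)
      then show ?thesis by (simp add: add_increasing)
    qed (simp add: F1_def)
    have imp: "ennreal (\<alpha> / 2) < cyl_max \<eta> F1 z" if "ennreal \<alpha> < cyl_max \<eta> F z" for z
    proof (rule ccontr)
      assume "\<not> ennreal (\<alpha> / 2) < cyl_max \<eta> F1 z"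
      then have "cyl_max \<eta> F z \<le> ennreal (\<alpha> / 2) + ennreal (\<alpha> / 2)"
        using order_trans[OF cyl_max_mono[OF F_le] cyl_max_add_const[OF F1m]] add_right_mono
        by (meson not_le order_trans)
      then show False using that half by (simp add: mult_2 not_le[symmetric])
    qed
    have m: "{z \<in> \<Omega>. ennreal (\<alpha> / 2) < cyl_max \<eta> F1 z} \<in> sets lebesgue"
    proof -
      have "{z. ennreal (\<alpha> / 2) < cyl_max \<eta> F1 z} \<in> sets lebesgue" using open_level_set[OF MG F1] by (simp add: lmeasurable_open)
      then have "\<Omega> \<inter> {z. ennreal (\<alpha> / 2) < cyl_max \<eta> F1 z} \<in> sets lebesgue" by (rule sets.Int[OF \<Omega>_measurable])
      also have "\<Omega> \<inter> {z. ennreal (\<alpha> / 2) < cyl_max \<eta> F1 z} = {z \<in> \<Omega>. ennreal (\<alpha> / 2) < cyl_max \<eta> F1 z}" by blast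
      finally show ?thesis .
    qed
    have "emeasure ?M {z \<in> space ?M. ennreal \<alpha> < cyl_max \<eta> F z} = emeasure lebesgue {z \<in> space ?M. ennreal \<alpha> < cyl_max \<eta> F z}"
      using \<Omega>_measurable by (intro emeasure_restrict_space) (auto simp: space_restrict_space)
    also have "\<dots> \<le> emeasure lebesgue {z \<in> \<Omega>. ennreal (\<alpha> / 2) < cyl_max \<eta> F1 z}"
      using imp m by (intro emeasure_mono) (auto simp: space_restrict_space)
    also have "\<dots> \<le> ennreal (3 * 5 ^ CARD('n) / (\<alpha> / 2)) * (\<integral>\<^sup>+ z. F1 z \<partial>?M)"
      using \<alpha> by (intro cyl_max_weak_type[OF B K \<eta> MG F1]) simp
    also have "3 * 5 ^ CARD('n) / (\<alpha> / 2) = ?A / \<alpha>" by simp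
    finally show "emeasure ?M {z \<in> space ?M. ennreal \<alpha> < cyl_max \<eta> F z}
        \<le> ennreal (?A / \<alpha>) * (\<integral>\<^sup>+ z. (if ennreal \<alpha> < 2 * F z then F z else 0) \<partial>?M)"
      unfolding F1_def .
  qed simp
  from ennreal_powr_mono[OF this, of "1 / q"] show ?thesis
    using q c ennreal_powr_cmult[OF c, of "1 / q"] by (simp add: Lp_norm_def)
qed

end

lemma Lp_norm_1: "Lp_norm 1 M g = (\<integral>\<^sup>+ z. g z \<partial>M)"
proof -
  have "ennreal_powr x 1 = x" for x by (cases x) (auto simp: ennreal_powr_def)
  then show ?thesis by (simp add: Lp_norm_def)
qed

theorem theorem3:
  fixes \<phi> :: "real^'n \<Rightarrow> real"
  assumes "mollifier \<phi>"
  shows "\<exists>\<eta>\<^sub>0>0. \<exists>(C\<^sub>1::real) (C :: real \<Rightarrow> real).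
    \<forall>\<eta> S T p\<^sub>0 p (u :: real \<Rightarrow> real^'n \<Rightarrow> real^'n) (G :: real \<Rightarrow> real^'n \<Rightarrow> real^'n^'n).
      0 < \<eta> \<and> \<eta> < \<eta>\<^sub>0 \<and> S < T \<and> 1 \<le> p\<^sub>0 \<and> L1loc_W1p S T p\<^sub>0 u G \<and> divergence_free S T G \<and>
      1 \<le> p \<and> grad_maximal G \<in> borel_measurable (lebesgue_on (spacetime S T)) \<and>
      Lp_norm p (lebesgue_on (spacetime S T)) (grad_maximal G) < \<infinity> \<longrightarrow>
      (let \<Lambda> = lebesgue_on (spacetime S T); M = cylinder_maximal S T \<phi> u G \<eta> in
        (\<forall>f. in_Lp \<infinity> \<Lambda> f \<longrightarrow>
           M f \<in> borel_measurable \<Lambda> \<and>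
           Lp_norm \<infinity> \<Lambda> (M f) \<le> Lp_norm \<infinity> \<Lambda> (\<lambda>z. ennreal \<bar>f z\<bar>)) \<and>
        (\<forall>f (\<alpha>::real). in_Lp 1 \<Lambda> f \<and> 0 < \<alpha> \<longrightarrow>
           {z \<in> spacetime S T. M f z > ennreal \<alpha>} \<in> sets lebesgue \<and>
           emeasure lebesgue {z \<in> spacetime S T. M f z > ennreal \<alpha>}
             \<le> ennreal (C\<^sub>1 / \<alpha>) * Lp_norm 1 \<Lambda> (\<lambda>z. ennreal \<bar>f z\<bar>)) \<and>
        (\<forall>q>1. \<forall>f. in_Lp (ennreal q) \<Lambda> f \<longrightarrow>
           M f \<in> borel_measurable \<Lambda> \<and>
           Lp_norm (ennreal q) \<Lambda> (M f)
             \<le> ennreal (C q) * Lp_norm (ennreal q) \<Lambda> (\<lambda>z. ennreal \<bar>f z\<bar>)))"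
proof -
  obtain B where B: "0 \<le> B" "\<And>x. \<phi> x \<le> B" using mollifier_bounded[OF assms] by blast
  \<comment> \<open>The summand \<open>1\<close> makes \<open>K\<close> positive, for the threshold \<open>1 / (10 K)\<close>.\<close>
  define K where "K = CARD('n) * B * measure lborel (ball (0::real^'n) 1) * 6 ^ CARD('n) + 1"
  have K: "CARD('n) * B * measure lborel (ball (0::real^'n) 1) * 6 ^ CARD('n) \<le> K" "0 < K"
    using B(1) by (auto simp: K_def intro!: add_nonneg_pos)
  show ?thesis
  proof (rule exI[of _ "1 / (10 * K)"], rule conjI[rotated], rule exI[of _ "3 * 5 ^ CARD('n)"],
      rule exI[of _ "\<lambda>q. (6 * 5 ^ CARD('n) * q / (q - 1) * 2 powr (q - 1)) powr (1 / q)"], intro allI impI, goal_cases)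
    case 2
    show ?case using K(2) by simp
  next
    case (1 \<eta> S T p\<^sub>0 p u G)
    note hyp = 1
    interpret sobolev_flow S T \<phi> u G p\<^sub>0 by unfold_locales (use assms hyp in auto)
    have MG: "finite_on_finite (grad_maximal G)" using hyp by (intro finite_on_finite_Lp[of p]) auto
    have \<eta>: "0 \<le> \<eta>" "10 * K * \<eta> \<le> 1" using hyp K(2) by (auto simp: field_simps)
    have fof: "finite_on_finite (\<lambda>z. ennreal \<bar>f z\<bar>)" if "in_Lp r (lebesgue_on \<Omega>) f" "1 \<le> r" for r f
      using that by (intro finite_on_finite_Lp[of r]) (auto simp: in_Lp_def)
    have meas: "cylinder_maximal S T \<phi> u G \<eta> f \<in> borel_measurable (lebesgue_on \<Omega>)"
      if "in_Lp r (lebesgue_on \<Omega>) f" "1 \<le> r" for r f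
      unfolding cylinder_maximal_eq by (rule cyl_max_measurable[OF MG fof[OF that]])
    have one: "(1::ennreal) \<le> ennreal q" if "1 < q" for q :: real using that by (simp flip: ennreal_1)
    show ?case
      unfolding Let_def
    proof (intro conjI allI impI)
      fix f assume f: "in_Lp \<infinity> (lebesgue_on \<Omega>) f"
      show "cylinder_maximal S T \<phi> u G \<eta> f \<in> borel_measurable (lebesgue_on \<Omega>)" by (rule meas[OF f]) simp
      then show "Lp_norm \<infinity> (lebesgue_on \<Omega>) (cylinder_maximal S T \<phi> u G \<eta> f) \<le> Lp_norm \<infinity> (lebesgue_on \<Omega>) (\<lambda>z. ennreal \<bar>f z\<bar>)"
        unfolding cylinder_maximal_eq using f
        by (auto simp: Lp_norm_def in_Lp_def intro!: esssup_I cyl_max_le_esssup)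
    next
      fix f and \<alpha> :: real assume f: "in_Lp 1 (lebesgue_on \<Omega>) f \<and> 0 < \<alpha>"
      have F: "finite_on_finite (\<lambda>z. ennreal \<bar>f z\<bar>)" using f by (intro fof[of 1]) auto
      have "\<Omega> \<inter> {z. ennreal \<alpha> < cyl_max \<eta> (\<lambda>z. ennreal \<bar>f z\<bar>) z} \<in> sets lebesgue"
        using open_level_set[OF MG F] by (intro sets.Int[OF \<Omega>_measurable]) (simp add: lmeasurable_open)
      also have "\<Omega> \<inter> {z. ennreal \<alpha> < cyl_max \<eta> (\<lambda>z. ennreal \<bar>f z\<bar>) z} = {z \<in> \<Omega>. ennreal \<alpha> < cylinder_maximal S T \<phi> u G \<eta> f z}"
        unfolding cylinder_maximal_eq by blast
      finally show "{z \<in> \<Omega>. ennreal \<alpha> < cylinder_maximal S T \<phi> u G \<eta> f z} \<in> sets lebesgue" .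
      show "emeasure lebesgue {z \<in> \<Omega>. ennreal \<alpha> < cylinder_maximal S T \<phi> u G \<eta> f z}
          \<le> ennreal (3 * 5 ^ CARD('n) / \<alpha>) * Lp_norm 1 (lebesgue_on \<Omega>) (\<lambda>z. ennreal \<bar>f z\<bar>)"
        unfolding cylinder_maximal_eq Lp_norm_1 using f by (intro cyl_max_weak_type[OF B K \<eta> MG F]) simp
    next
      fix q :: real and f assume q: "1 < q" and f: "in_Lp (ennreal q) (lebesgue_on \<Omega>) f"
      show "cylinder_maximal S T \<phi> u G \<eta> f \<in> borel_measurable (lebesgue_on \<Omega>)" by (rule meas[OF f one[OF q]])
      show "Lp_norm (ennreal q) (lebesgue_on \<Omega>) (cylinder_maximal S T \<phi> u G \<eta> f)
          \<le> ennreal ((6 * 5 ^ CARD('n) * q / (q - 1) * 2 powr (q - 1)) powr (1 / q)) * Lp_norm (ennreal q) (lebesgue_on \<Omega>) (\<lambda>z. ennreal \<bar>f z\<bar>)"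
        unfolding cylinder_maximal_eq by (rule cyl_max_strong_type[OF B K \<eta> MG fof[OF f one[OF q]] q])
    qed
  qed
qed

end
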